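(* In the setting described in the context, let $\theta\in[0,1]$, let $U_n\neq\{0\}$ be a finite dimensional subspace of $U$, let $N\ge1$ be an integer and $k=T/N$. If $\theta\in[0,\frac12)$, assume that $N$ is so large that $$k\le\frac{\alpha^2}{24\,\mu_n^2M^3(\frac12-\theta)}.$$ Then for each $f\in V'$ and $\xi_0\in H$ there is exactly one family $(w^{(m)})_{m=0,\dots,N}$ in $U_n$ solving the $\theta$-scheme $$\langle w^{(0)}-\Phi w^{(N)},u\rangle_H=\langle\xi_0,u\rangle_H\quad\text{for all }u\in U_n,$$ $$\Big\langle\frac{w^{(m+1)}-w^{(m)}}{k},u\Big\rangle_H+\frac1k\int_{mk}^{(m+1)k}a\big(t,\theta w^{(m+1)}+(1-\theta)w^{(m)},u\big)dt=\frac1k\int_{mk}^{(m+1)k}\langle f(t),u\rangle_{U',U}\,dt$$ for all $m=0,\dots,N-1$ and $u\in U_n$. Let $w_n\in W_n$ be the step function associated with this family. Moreover, there exists $\beta>0$ such that, for $u\in W$ a solution of $u'+\mathcal{A}u=f$, $u(0)-\Phi u(T)=\xi_0$, $$\Big(\|u'-\widehat{\partial}w_n\|_{V'}^2+\|u-w_n\|_V^2+\sup_{t\in[0,T]}\|u(t)-w_n(t)\|_H^2\Big)^{1/2}$$ $$\le\Big(1+\frac{2M}{\beta}\Big)\inf_{w\in W_n}\Big(\|u'-\widehat{\partial}w\|_{V'}^2+\|u-w\|_V^2+\sup_{t\in[0,T]}\|u(t)-w(t)\|_H^2\Big)^{1/2}.$$ The constant $\beta>0$ may be chosen depending only on (a)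 $\theta,M,\alpha,T$ and $C_H$ if $0\le\theta<\frac12$; (b) $M,\alpha,T$ and $C$ if $\theta=\frac12$ and $\|\Phi\|=1$, where $C>0$ is a constant such that $k\mu_n\le C$; (c) $M,\alpha,T$ and $\|\Phi\|$ if $\theta=\frac12$ and $\|\Phi\|<1$; (d) $\theta,M,\alpha,T$ and $C_H$ if $\frac12<\theta\le1$.
   Context: All vector spaces are real. Let $T>0$ and let $U,H$ be Hilbert spaces with $U$ continuously and densely embedded in $H$; $C_H>0$ satisfies $\|v\|_H\le C_H\|v\|_U$ for all $v\in U$. $H$ is identified with a subspace of $U'$ by $\langle y,u\rangle_{U',U}=\langle y,u\rangle_H$. Put $V=L^2(0,T;U)$, $V'=L^2(0,T;U')$, $\mathbb{H}=L^2(0,T;H)$. $W=H^1(0,T;U')\cap L^2(0,T;U)$ is the space of $u\in V$ having a weak derivative $u'\in V'$, i.e. $\langle u',v\rangle_{V',V}=-\langle u,v'\rangle_{\mathbb{H}}$ for all $v\in C^1_c((0,T);U)$; elements of $W$ are identified with their continuous representatives in $C([0,T];H)$. Let $a:[0,T]\times U\times U\to\mathbb{R}$ be such that $a(t,\cdot,\cdot)$ is bilinear for all $t$, $a(\cdot,v,w)$ is measurable for all $v,w\in U$, $|a(t,v,w)|\le M\|v\|_U\|w\|_U$ for a.e. $t$ and all $v,w\in U$, with $M\ge1$, and $a(t,v,v)\ge\alpha\|v\|_U^2$ for all $t\in[0,T]$, $v\in U$, with $\alpha>0$. Define $\mathcal{A}\in\mathcal{L}(V,V')$ by $\langle\mathcal{A}v,w\rangle_{V',V}=\int_0^Ta(t,v(t),w(t))\,dt$.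 Let $\Phi:H\to H$ be linear with $\|\Phi\|\le1$. $\mu_n=\max\{\|u\|_U/\|u\|_H:u\in U_n\setminus\{0\}\}$. $W_n$ is the space of functions $w:[0,T]\to U_n$ for which there are $w^{(0)},\dots,w^{(N)}\in U_n$ with $w(mk)=w^{(m)}$ for $m=0,\dots,N$ and $w(t)=\theta w^{(m+1)}+(1-\theta)w^{(m)}$ for $t\in(mk,(m+1)k)$, $m=0,\dots,N-1$ (this $w$ is the step function associated with the family $(w^{(m)})$). $V_n\subset V$ is the space of functions $(0,T)\to U_n$ constant on each $(mk,(m+1)k)$, $m=0,\dots,N-1$, and $P^V_n$ is the orthogonal projection of $V$ onto $V_n$. For $w\in W_n$ put $\partial w(t)=\frac{w^{(m+1)}-w^{(m)}}{k}$ for $t\in(mk,(m+1)k)$, and define $\widehat{\partial}w\in V'$ by $\langle\widehat{\partial}w,v\rangle_{V',V}=\langle\partial w,P^V_nv\rangle_{\mathbb{H}}$ for all $v\in V$.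
   Formalization: In (b) the constant β may also depend on C_H: with only M, α, T and C the claim fails uniformly in the spaces. β is chosen for a fixed pair of ambient Hilbert spaces U and H (uniformly in the embedding); uniformity over all spaces follows by orthogonal sums with a large Hilbert space. *)

theory Defs
  imports "HOL-Analysis.Analysis"
begin

text \<open>
  Hilbert spaces are types of sort \<open>{real_inner, complete_space}\<close>. The inclusion of U in H is an
  injective bounded operator \<open>j\<close> with dense range, and U' is \<open>'u \<Rightarrow>\<^sub>L real\<close> with its operator norm.
  The identification of H with a subspace of U' sends y to the functional mapping u to the inner
  product of y with \<open>j u\<close>, so an H inner product of elements of U is always taken after
  applying \<open>j\<close>.
\<close>

definition dense_embedding ::
  "('u::{real_inner,complete_space} \<Rightarrow>\<^sub>L 'h::{real_inner,complete_space}) \<Rightarrow> real \<Rightarrow> bool" where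
  "dense_embedding j C\<^sub>H \<longleftrightarrow>
     inj (blinfun_apply j) \<and> closure (range (blinfun_apply j)) = UNIV \<and>
     C\<^sub>H > 0 \<and> (\<forall>v. norm (j v) \<le> C\<^sub>H * norm v)"

subsection \<open>Square integrable vector-valued functions\<close>

text \<open>
  The spaces need not be separable, so measurability of vector-valued functions is Bochner (strong)
  measurability. Functions are not quotiented by equality almost everywhere.
\<close>

definition strongly_measurable :: "'a measure \<Rightarrow> ('a \<Rightarrow> 'b::real_normed_vector) \<Rightarrow> bool" where
  "strongly_measurable \<mu> f \<longleftrightarrow>
     (\<exists>s. (\<forall>i::nat. simple_function \<mu> (s i)) \<and> (AE x in \<mu>. (\<lambda>i. s i x) \<longlonglongrightarrow> f x))"

definition L2 :: "real \<Rightarrow> (real \<Rightarrow> 'b::real_normed_vector) set" where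
  "L2 T = {f. strongly_measurable (lebesgue_on {0..T}) f \<and>
              integrable (lebesgue_on {0..T}) (\<lambda>t. (norm (f t))\<^sup>2)}"

definition L2_norm :: "real \<Rightarrow> (real \<Rightarrow> 'b::real_normed_vector) \<Rightarrow> real" where
  "L2_norm T f = sqrt (LINT t|lebesgue_on {0..T}. (norm (f t))\<^sup>2)"

definition L2_inner :: "real \<Rightarrow> (real \<Rightarrow> 'b::real_inner) \<Rightarrow> (real \<Rightarrow> 'b) \<Rightarrow> real" where
  "L2_inner T f g = (LINT t|lebesgue_on {0..T}. inner (f t) (g t))"

text \<open>
  An element of V' is given either by a function in \<open>L2 T\<close> with values in U', acting on V by
  \<open>pairing\<close>, or directly as a functional on V. Its norm is the dual norm.
\<close>

definition pairing ::
  "real \<Rightarrow> (real \<Rightarrow> ('u::{real_inner,complete_space} \<Rightarrow>\<^sub>L real)) \<Rightarrow> (real \<Rightarrow> 'u) \<Rightarrow> real" where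
  "pairing T f v = (LINT t|lebesgue_on {0..T}. blinfun_apply (f t) (v t))"

definition dual_norm ::
  "real \<Rightarrow> ((real \<Rightarrow> 'u::{real_inner,complete_space}) \<Rightarrow> real) \<Rightarrow> real" where
  "dual_norm T F = Sup {\<bar>F v\<bar> | v. v \<in> L2 T \<and> L2_norm T v \<le> 1}"

subsection \<open>The space W and the evolution problem\<close>

text \<open>\<open>v\<close> is a continuously differentiable function with compact support in \<open>(0,T)\<close>, and \<open>v'\<close> is
  its derivative.\<close>

definition test_function ::
  "real \<Rightarrow> (real \<Rightarrow> 'u::real_normed_vector) \<Rightarrow> (real \<Rightarrow> 'u) \<Rightarrow> bool" where
  "test_function T v v' \<longleftrightarrow>
     (\<forall>t. (v has_vector_derivative v' t) (at t)) \<and> continuous_on UNIV v' \<and>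
     (\<exists>c d. 0 < c \<and> d < T \<and> (\<forall>t. t \<notin> {c..d} \<longrightarrow> v t = 0))"

definition has_weak_derivative ::
  "real \<Rightarrow> ('u::{real_inner,complete_space} \<Rightarrow>\<^sub>L 'h::{real_inner,complete_space}) \<Rightarrow>
   (real \<Rightarrow> 'u) \<Rightarrow> (real \<Rightarrow> ('u \<Rightarrow>\<^sub>L real)) \<Rightarrow> bool" where
  "has_weak_derivative T j u u' \<longleftrightarrow> u \<in> L2 T \<and> u' \<in> L2 T \<and>
     (\<forall>v v'. test_function T v v' \<longrightarrow>
        pairing T u' v = - L2_inner T (\<lambda>t. j (u t)) (\<lambda>t. j (v' t)))"

text \<open>
  An element of W is described by a representative \<open>u\<close> in V, its weak derivative \<open>u'\<close>, and its
  representative \<open>uc\<close> in \<open>C([0,T];H)\<close>. The latter is kept apart because its values at individual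
  times lie in H and in general not in U.
\<close>

definition W_element ::
  "real \<Rightarrow> ('u::{real_inner,complete_space} \<Rightarrow>\<^sub>L 'h::{real_inner,complete_space}) \<Rightarrow>
   (real \<Rightarrow> 'u) \<Rightarrow> (real \<Rightarrow> ('u \<Rightarrow>\<^sub>L real)) \<Rightarrow> (real \<Rightarrow> 'h) \<Rightarrow> bool" where
  "W_element T j u u' uc \<longleftrightarrow> has_weak_derivative T j u u' \<and>
     continuous_on {0..T} uc \<and> (AE t in lebesgue_on {0..T}. uc t = j (u t))"

definition admissible_form ::
  "real \<Rightarrow> (real \<Rightarrow> 'u::{real_inner,complete_space} \<Rightarrow> 'u \<Rightarrow> real) \<Rightarrow> real \<Rightarrow> real \<Rightarrow> bool" where
  "admissible_form T a M \<alpha> \<longleftrightarrow>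
     (\<forall>t\<in>{0..T}. bilinear (a t)) \<and>
     (\<forall>v w. (\<lambda>t. a t v w) \<in> borel_measurable (lebesgue_on {0..T})) \<and>
     1 \<le> M \<and> (AE t in lebesgue_on {0..T}. \<forall>v w. \<bar>a t v w\<bar> \<le> M * norm v * norm w) \<and>
     0 < \<alpha> \<and> (\<forall>t\<in>{0..T}. \<forall>v. a t v v \<ge> \<alpha> * (norm v)\<^sup>2)"

definition form_op ::
  "real \<Rightarrow> (real \<Rightarrow> 'u \<Rightarrow> 'u \<Rightarrow> real) \<Rightarrow> (real \<Rightarrow> 'u) \<Rightarrow> (real \<Rightarrow> 'u) \<Rightarrow> real" where
  "form_op T a v w = (LINT t|lebesgue_on {0..T}. a t (v t) (w t))"

definition setting ::
  "real \<Rightarrow> ('u::{real_inner,complete_space} \<Rightarrow>\<^sub>L 'h::{real_inner,complete_space}) \<Rightarrow> real \<Rightarrow>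
   (real \<Rightarrow> 'u \<Rightarrow> 'u \<Rightarrow> real) \<Rightarrow> real \<Rightarrow> real \<Rightarrow> ('h \<Rightarrow>\<^sub>L 'h) \<Rightarrow> bool" where
  "setting T j C\<^sub>H a M \<alpha> \<Phi> \<longleftrightarrow>
     0 < T \<and> dense_embedding j C\<^sub>H \<and> admissible_form T a M \<alpha> \<and> norm \<Phi> \<le> 1"

definition solves ::
  "real \<Rightarrow> ('u::{real_inner,complete_space} \<Rightarrow>\<^sub>L 'h::{real_inner,complete_space}) \<Rightarrow>
   (real \<Rightarrow> 'u \<Rightarrow> 'u \<Rightarrow> real) \<Rightarrow> ('h \<Rightarrow>\<^sub>L 'h) \<Rightarrow> (real \<Rightarrow> ('u \<Rightarrow>\<^sub>L real)) \<Rightarrow> 'h \<Rightarrow>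
   (real \<Rightarrow> 'u) \<Rightarrow> (real \<Rightarrow> ('u \<Rightarrow>\<^sub>L real)) \<Rightarrow> (real \<Rightarrow> 'h) \<Rightarrow> bool" where
  "solves T j a \<Phi> f \<xi>\<^sub>0 u u' uc \<longleftrightarrow> W_element T j u u' uc \<and>
     (\<forall>v\<in>L2 T. pairing T u' v + form_op T a u v = pairing T f v) \<and>
     uc 0 - \<Phi> (uc T) = \<xi>\<^sub>0"

subsection \<open>Discretisation\<close>

definition step_size :: "real \<Rightarrow> nat \<Rightarrow> real" where
  "step_size T N = T / real N"

text \<open>For a nonzero finite dimensional \<open>U\<^sub>n\<close> this supremum is a maximum.\<close>

definition inverse_constant ::
  "('u::{real_inner,complete_space} \<Rightarrow>\<^sub>L 'h::{real_inner,complete_space}) \<Rightarrow> 'u set \<Rightarrow> real" where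
  "inverse_constant j U\<^sub>n = (SUP u\<in>U\<^sub>n - {0}. norm u / norm (j u))"

definition discretisation ::
  "real \<Rightarrow> ('u::{real_inner,complete_space} \<Rightarrow>\<^sub>L 'h::{real_inner,complete_space}) \<Rightarrow>
   real \<Rightarrow> real \<Rightarrow> real \<Rightarrow> 'u set \<Rightarrow> nat \<Rightarrow> bool" where
  "discretisation T j M \<alpha> \<theta> U\<^sub>n N \<longleftrightarrow>
     0 \<le> \<theta> \<and> \<theta> \<le> 1 \<and>
     subspace U\<^sub>n \<and> (\<exists>B. finite B \<and> U\<^sub>n = span B) \<and> U\<^sub>n \<noteq> {0} \<and> 1 \<le> N \<and>
     (\<theta> < 1/2 \<longrightarrow>
        step_size T N \<le> \<alpha>\<^sup>2 / (24 * (inverse_constant j U\<^sub>n)\<^sup>2 * M^3 * (1/2 - \<theta>)))"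

text \<open>A family indexed by \<open>0..N\<close> is a function on \<open>nat\<close> of which only the values up to \<open>N\<close> matter.\<close>

definition theta_scheme ::
  "real \<Rightarrow> ('u::{real_inner,complete_space} \<Rightarrow>\<^sub>L 'h::{real_inner,complete_space}) \<Rightarrow>
   (real \<Rightarrow> 'u \<Rightarrow> 'u \<Rightarrow> real) \<Rightarrow> ('h \<Rightarrow>\<^sub>L 'h) \<Rightarrow> real \<Rightarrow> 'u set \<Rightarrow> nat \<Rightarrow>
   (real \<Rightarrow> ('u \<Rightarrow>\<^sub>L real)) \<Rightarrow> 'h \<Rightarrow> (nat \<Rightarrow> 'u) \<Rightarrow> bool" where
  "theta_scheme T j a \<Phi> \<theta> U\<^sub>n N f \<xi>\<^sub>0 w \<longleftrightarrow> (let k = step_size T N in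
     (\<forall>m\<le>N. w m \<in> U\<^sub>n) \<and>
     (\<forall>u\<in>U\<^sub>n. inner (j (w 0) - \<Phi> (j (w N))) (j u) = inner \<xi>\<^sub>0 (j u)) \<and>
     (\<forall>m<N. \<forall>u\<in>U\<^sub>n.
        inner (j ((w (m + 1) - w m) /\<^sub>R k)) (j u)
        + 1 / k * (LINT t|lebesgue_on {real m * k..real (m + 1) * k}.
                     a t (\<theta> *\<^sub>R w (m + 1) + (1 - \<theta>) *\<^sub>R w m) u)
        = 1 / k * (LINT t|lebesgue_on {real m * k..real (m + 1) * k}. blinfun_apply (f t) u)))"

text \<open>For \<open>0 \<le> t\<close>, \<open>m = nat \<lfloor>t / k\<rfloor>\<close> is the index with \<open>m k \<le> t < (m + 1) k\<close>.\<close>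

definition step_function :: "real \<Rightarrow> real \<Rightarrow> nat \<Rightarrow> (nat \<Rightarrow> 'u::real_vector) \<Rightarrow> real \<Rightarrow> 'u" where
  "step_function T \<theta> N w t = (let k = step_size T N; m = nat \<lfloor>t / k\<rfloor> in
     if t = real m * k then w m else \<theta> *\<^sub>R w (m + 1) + (1 - \<theta>) *\<^sub>R w m)"

definition W_discrete :: "real \<Rightarrow> real \<Rightarrow> 'u::real_vector set \<Rightarrow> nat \<Rightarrow> (real \<Rightarrow> 'u) set" where
  "W_discrete T \<theta> U\<^sub>n N = {step_function T \<theta> N w | w. \<forall>m\<le>N. w m \<in> U\<^sub>n}"

definition V_discrete :: "real \<Rightarrow> 'u::real_vector set \<Rightarrow> nat \<Rightarrow> (real \<Rightarrow> 'u) set" where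
  "V_discrete T U\<^sub>n N = {v. (\<forall>t\<in>{0<..<T}. v t \<in> U\<^sub>n) \<and>
     (\<forall>m<N. \<exists>c. \<forall>t\<in>{real m * step_size T N<..<real (m + 1) * step_size T N}. v t = c)}"

text \<open>The orthogonal projection of V onto \<open>V_discrete\<close>, determined up to null sets.\<close>

definition V_projection ::
  "real \<Rightarrow> 'u::{real_inner,complete_space} set \<Rightarrow> nat \<Rightarrow> (real \<Rightarrow> 'u) \<Rightarrow> real \<Rightarrow> 'u" where
  "V_projection T U\<^sub>n N v = (SOME p. p \<in> V_discrete T U\<^sub>n N \<and>
     (\<forall>z\<in>V_discrete T U\<^sub>n N. L2_inner T (\<lambda>t. v t - p t) z = 0))"

text \<open>The nodal values of \<open>w\<close> in \<open>W_discrete\<close> are the members of the family it comes from.\<close>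

definition difference_quotient ::
  "real \<Rightarrow> nat \<Rightarrow> (real \<Rightarrow> 'u::real_vector) \<Rightarrow> real \<Rightarrow> 'u" where
  "difference_quotient T N w t = (let k = step_size T N; m = nat \<lfloor>t / k\<rfloor> in
     (w (real (m + 1) * k) - w (real m * k)) /\<^sub>R k)"

definition discrete_derivative ::
  "real \<Rightarrow> ('u::{real_inner,complete_space} \<Rightarrow>\<^sub>L 'h::{real_inner,complete_space}) \<Rightarrow>
   'u set \<Rightarrow> nat \<Rightarrow> (real \<Rightarrow> 'u) \<Rightarrow> (real \<Rightarrow> 'u) \<Rightarrow> real" where
  "discrete_derivative T j U\<^sub>n N w v =
     L2_inner T (\<lambda>t. j (difference_quotient T N w t)) (\<lambda>t. j (V_projection T U\<^sub>n N v t))"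

definition total_error ::
  "real \<Rightarrow> ('u::{real_inner,complete_space} \<Rightarrow>\<^sub>L 'h::{real_inner,complete_space}) \<Rightarrow>
   'u set \<Rightarrow> nat \<Rightarrow> (real \<Rightarrow> 'u) \<Rightarrow> (real \<Rightarrow> ('u \<Rightarrow>\<^sub>L real)) \<Rightarrow> (real \<Rightarrow> 'h) \<Rightarrow> (real \<Rightarrow> 'u) \<Rightarrow> real" where
  "total_error T j U\<^sub>n N u u' uc w = sqrt (
     (dual_norm T (\<lambda>v. pairing T u' v - discrete_derivative T j U\<^sub>n N w v))\<^sup>2
     + (L2_norm T (\<lambda>t. u t - w t))\<^sup>2
     + (SUP t\<in>{0..T}. (norm (uc t - j (w t)))\<^sup>2))"

definition quasi_optimal ::
  "real \<Rightarrow> real \<Rightarrow> ('u::{real_inner,complete_space} \<Rightarrow>\<^sub>L 'h::{real_inner,complete_space}) \<Rightarrow>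
   (real \<Rightarrow> 'u \<Rightarrow> 'u \<Rightarrow> real) \<Rightarrow> real \<Rightarrow> ('h \<Rightarrow>\<^sub>L 'h) \<Rightarrow> real \<Rightarrow> 'u set \<Rightarrow> nat \<Rightarrow> bool" where
  "quasi_optimal \<beta> T j a M \<Phi> \<theta> U\<^sub>n N \<longleftrightarrow>
     (\<forall>f\<in>L2 T. \<forall>\<xi>\<^sub>0 w u u' uc.
        theta_scheme T j a \<Phi> \<theta> U\<^sub>n N f \<xi>\<^sub>0 w \<longrightarrow> solves T j a \<Phi> f \<xi>\<^sub>0 u u' uc \<longrightarrow>
        total_error T j U\<^sub>n N u u' uc (step_function T \<theta> N w)
        \<le> (1 + 2 * M / \<beta>) * (INF v\<in>W_discrete T \<theta> U\<^sub>n N. total_error T j U\<^sub>n N u u' uc v))"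

end

theory Submission
  imports Defs
begin

text \<open>
  Let \<open>z\<close> be the difference of the discrete solution and an arbitrary comparison function
  \<open>w\<close> in \<open>W\<^sub>n\<close>. It solves the scheme with a right-hand side bounded, as a functional on
  \<open>V\<^sub>n\<close>, by the error of \<open>w\<close>, so it suffices to bound \<open>z\<close> by its data. Testing
  with \<open>z\<^sub>m\<^sub>+\<^sub>\<theta> = \<theta> z\<^sub>m\<^sub>+\<^sub>1 + (1 - \<theta>) z\<^sub>m\<close> gives an energy inequality between any two nodes; for
  \<open>\<theta> < 1/2\<close> the jumps enter with the wrong sign, but testing with the jumps themselves and using the
  inverse inequality together with the bound on the step size absorbs them. The boundary condition couples
  \<open>z\<^sub>0\<close> to \<open>z\<^sub>N\<close>, so the energy must strictly contract from \<open>0\<close> to \<open>T\<close>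
  unless \<open>\<Phi>\<close> contracts: as the final energy is bounded by the energy at every earlier node, averaging
  over the nodes bounds it by the dissipation. The same bound with zero data shows that the square linear
  system is uniquely solvable. Since \<open>\<beta>\<close> is only required to be positive, all constants are
  collected in a single factor \<open>L > 1\<close> and \<open>\<beta> = 2 M / (L - 1)\<close>.
\<close>

section \<open>Linear algebra on finite-dimensional subspaces\<close>

text \<open>The dissipation controls only the intermediate values \<open>mid z m\<close>, whereas
  the averaging over the nodes needs the \<open>z m\<close>. A node differs from the intermediate
  value by \<theta> times a jump, so k times the sum of the squared jumps has to be bounded, and
  this is what separates the cases. For \<theta> > 1/2 the jumps are dissipated themselves; for
  \<theta> < 1/2 the step size condition bounds k * \<mu>^2; for \<theta> = 1/2 the energy does not
  see the jumps, so a bound on k * \<mu> must be supplied, unless norm \<Phi> < 1 closes the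
  estimate directly. Existence is a shooting problem: marching forward from an initial value in U_n
  is always possible, so the only unknown is the initial value and the linear system lives on U_n.
  On V_n the projection acts as the identity, so the scheme is the evolution equation tested on V_n;
  subtracting the two leaves the error of the derivative and the defect of the form.\<close>

definition linear_on_subspace :: "'a::real_vector set \<Rightarrow> ('a \<Rightarrow> 'b::real_vector) \<Rightarrow> bool" where
  "linear_on_subspace U f \<longleftrightarrow> (\<forall>x\<in>U. \<forall>y\<in>U. f (x + y) = f x + f y) \<and> (\<forall>c. \<forall>x\<in>U. f (c *\<^sub>R x) = c *\<^sub>R f x)"

lemma linear_on_subspace_sum:
  assumes "linear_on_subspace U f" "subspace U" "finite A" "\<And>i. i \<in> A \<Longrightarrow> e i \<in> U"
  shows "f (\<Sum>i\<in>A. c i *\<^sub>R e i) = (\<Sum>i\<in>A. c i *\<^sub>R f (e i))"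
  using assms(3,4)
proof (induction rule: finite_induct)
  case empty
  have "f (0 *\<^sub>R 0) = 0 *\<^sub>R f 0"
    using assms(1) subspace_0[OF assms(2)] unfolding linear_on_subspace_def by blast
  then show ?case by simp
next
  case (insert x F)
  have "f (c x *\<^sub>R e x + (\<Sum>i\<in>F. c i *\<^sub>R e i)) = c x *\<^sub>R f (e x) + f (\<Sum>i\<in>F. c i *\<^sub>R e i)"
    using assms(1,2) insert.prems unfolding linear_on_subspace_def
    by (simp add: subspace_scale subspace_sum)
  then show ?case using insert by simp
qed

text \<open>A dimension count by cardinalities: if some b in span B lay outside the span of the
  image of B, adding it to that independent image would give an independent subset of span B with
  more elements than B.\<close>

lemma linear_inj_imp_surj_on_span:
  fixes f :: "'a::real_vector \<Rightarrow> 'a"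
  assumes "finite B" "independent B" "linear f" "f ` span B \<subseteq> span B"
    and "\<And>x. x \<in> span B \<Longrightarrow> f x = 0 \<Longrightarrow> x = 0"
  shows "f ` span B = span B"
proof -
  have inj: "inj_on f (span B)"
    using assms(3,5) by (simp add: linear_injective_on_subspace_0)
  have ind: "independent (f ` B)"
    using linear_independent_injective_image[OF assms(3,2) inj] .
  have c: "card (f ` B) = card B"
    using inj by (meson card_image inj_on_subset span_superset)
  have sub: "f ` B \<subseteq> span B"
    using assms(4) by (meson image_mono order_trans span_superset)
  have "span B \<subseteq> span (f ` B)"
  proof (rule ccontr)
    assume "\<not> ?thesis"
    then obtain b where b: "b \<in> span B" "b \<notin> span (f ` B)" by blast
    then have "independent (insert b (f ` B))" "insert b (f ` B) \<subseteq> span B"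
      using ind sub by (simp_all add: real_vector.independent_insertI)
    from real_vector.independent_span_bound[OF assms(1) this] c b(2) assms(1)
    show False by (simp add: card_insert_if span_base split: if_splits)
  qed
  then have "span B \<subseteq> f ` span B"
    by (simp add: assms(3) linear_span_image)
  with assms(4) show ?thesis by blast
qed

text \<open>In a basis E the map sending x to the vector with coordinates \<open>F x e\<close> is an
  injective endomorphism of U, hence onto, and a preimage of the vector with coordinates
  \<open>l e\<close> is the solution. Linearity is asked only on U because the shooting map in
  \<open>scheme_exists\<close> is known to be linear only there.\<close>

lemma nondegenerate_form_solvable:
  fixes F :: "'a::real_vector \<Rightarrow> 'a \<Rightarrow> real"
  assumes fin: "finite B" and U: "U = span B"
    and lin1: "\<And>u. u \<in> U \<Longrightarrow> linear_on_subspace U (\<lambda>x. F x u)"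
    and lin2: "\<And>x. x \<in> U \<Longrightarrow> linear_on_subspace U (F x)"
    and lin: "linear_on_subspace U l"
    and nondeg: "\<And>x. x \<in> U \<Longrightarrow> (\<And>u. u \<in> U \<Longrightarrow> F x u = 0) \<Longrightarrow> x = 0"
  shows "\<exists>x\<in>U. \<forall>u\<in>U. F x u = l u"
proof -
  obtain E where E: "E \<subseteq> B" "independent E" "span E = U"
    by (metis U maximal_independent_subset span_mono span_span subset_antisym span_superset)
  have finE: "finite E" using E(1) fin finite_subset by blast
  have sub: "subspace U" using U by simp
  have EU: "E \<subseteq> U" using E(3) span_superset by blast
  define f0 where "f0 x = (\<Sum>e\<in>E. F x e *\<^sub>R e)" for x
  \<comment> \<open>\<open>f0\<close> is linear only on U, while \<open>linear\<close> is a global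
    property; \<open>f\<close> is a globally linear map that agrees with \<open>f0\<close> on the
    basis and therefore on U.\<close>
  obtain f where f: "linear f" "\<And>x. x \<in> E \<Longrightarrow> f x = f0 x"
    using linear_independent_extend[OF E(2), of f0] by auto
  have ff0: "f x = f0 x" if xU: "x \<in> U" for x
  proof -
    obtain c where x: "x = (\<Sum>b\<in>E. c b *\<^sub>R b)"
      using xU E(3) finE by (auto simp: span_finite)
    have *: "F x e = (\<Sum>b\<in>E. c b *\<^sub>R F b e)" if "e \<in> E" for e
      unfolding x using linear_on_subspace_sum[OF lin1 sub finE, of e "\<lambda>x. x" c] that EU by blast
    have "f x = (\<Sum>b\<in>E. c b *\<^sub>R f b)" unfolding x using f(1)
      by (simp add: linear_sum linear_cmul)
    also have "\<dots> = (\<Sum>b\<in>E. \<Sum>e\<in>E. (c b * F b e) *\<^sub>R e)"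
      using f(2) by (auto simp: f0_def scaleR_sum_right intro!: sum.cong)
    also have "\<dots> = (\<Sum>e\<in>E. \<Sum>b\<in>E. (c b * F b e) *\<^sub>R e)" by (rule sum.swap)
    also have "\<dots> = f0 x" unfolding f0_def
      using * by (auto simp: scaleR_sum_left intro!: sum.cong)
    finally show ?thesis .
  qed
  have ext: "F x u = m u" if "\<And>e. e \<in> E \<Longrightarrow> F x e = m e" "x \<in> U" and uU: "u \<in> U" and "linear_on_subspace U m" for m x u
  proof -
    obtain c where u: "u = (\<Sum>b\<in>E. c b *\<^sub>R b)"
      using uU E(3) finE by (auto simp: span_finite)
    have "F x u = (\<Sum>b\<in>E. c b *\<^sub>R F x b)" unfolding u
      using linear_on_subspace_sum[OF lin2 sub finE, of x "\<lambda>x. x" c] that EU by blast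
    moreover have "m u = (\<Sum>b\<in>E. c b *\<^sub>R m b)" unfolding u
      using linear_on_subspace_sum[OF that(4) sub finE, of "\<lambda>x. x" c] EU by blast
    ultimately show ?thesis using that by simp
  qed
  have coeff: "a e = b e" if "(\<Sum>e\<in>E. a e *\<^sub>R e) = (\<Sum>e\<in>E. b e *\<^sub>R e)" "e \<in> E" for a b e
  proof -
    have "(\<Sum>e\<in>E. (a e - b e) *\<^sub>R e) = 0" using that by (simp add: scaleR_diff_left sum_subtractf)
    then have "a e - b e = 0"
      using real_vector.independentD[OF E(2) finE subset_refl, of "\<lambda>e. a e - b e" e] that(2) by blast
    then show ?thesis by simp
  qed
  have "f ` span E = span E"
  proof (rule linear_inj_imp_surj_on_span[OF finE E(2) f(1)])
    show "f ` span E \<subseteq> span E"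
      using ff0 E(3) unfolding f0_def by (auto intro!: span_sum intro: span_scale span_base)
    fix x assume x: "x \<in> span E" "f x = 0"
    then have "(\<Sum>e\<in>E. F x e *\<^sub>R e) = (\<Sum>e\<in>E. 0 *\<^sub>R e)"
      using ff0 E(3) f0_def by simp
    then have z: "F x e = 0" if "e \<in> E" for e using coeff[of "F x" "\<lambda>_. 0"] that by blast
    have "linear_on_subspace U (\<lambda>_. 0::real)" by (simp add: linear_on_subspace_def)
    from ext[OF _ _ _ this] z nondeg x E(3) show "x = 0" by blast
  qed
  moreover have "(\<Sum>e\<in>E. l e *\<^sub>R e) \<in> span E" by (auto intro!: span_sum intro: span_scale span_base)
  ultimately obtain x where x: "x \<in> span E" "f x = (\<Sum>e\<in>E. l e *\<^sub>R e)"
    by (metis (no_types, lifting) imageE)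
  then have "F x e = l e" if "e \<in> E" for e
    using coeff[of "F x" l] ff0 E(3) f0_def that by simp
  from ext[OF this _ _ lin] x E(3) show ?thesis by blast
qed

text \<open>The map \<open>j\<close> is kept general to serve twice: the embedding gives inner
  products in H, the identity those in U, which the projection onto V_n uses.\<close>

lemma Riesz_finite_span:
  fixes j :: "'a::real_vector \<Rightarrow> 'b::real_inner"
  assumes "finite B" "linear j" "\<And>x. x \<in> span B \<Longrightarrow> j x = 0 \<Longrightarrow> x = 0"
    and "linear_on_subspace (span B) l"
  shows "\<exists>x\<in>span B. \<forall>u\<in>span B. inner (j x) (j u) = l u"
proof (rule nondegenerate_form_solvable[OF assms(1) refl _ _ assms(4)])
  show "x = 0" if "x \<in> span B" "\<And>u. u \<in> span B \<Longrightarrow> inner (j x) (j u) = 0" for x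
    using that assms(3) by (metis inner_eq_zero_iff)
qed (use assms(2) in \<open>auto simp: linear_on_subspace_def linear_add linear_cmul inner_add\<close>)

text \<open>The coordinate functionals of a basis have Riesz representatives \<open>y e\<close> for
  the inner product carried over by \<open>j\<close>, so Cauchy-Schwarz bounds each coordinate by a
  multiple of norm (j x).\<close>

lemma finite_span_norm_le:
  fixes j :: "'a::real_normed_vector \<Rightarrow> 'b::real_inner"
  assumes "finite B" "linear j" "\<And>x. x \<in> span B \<Longrightarrow> j x = 0 \<Longrightarrow> x = 0"
  shows "\<exists>C. \<forall>x\<in>span B. norm x \<le> C * norm (j x)"
proof -
  obtain E where E: "E \<subseteq> B" "independent E" "span E = span B"
    by (metis maximal_independent_subset span_mono span_span subset_antisym span_superset)
  have finE: "finite E" using E(1) assms(1) finite_subset by blast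
  define r where "r = representation E"
  have lin: "linear_on_subspace (span E) (\<lambda>x. r x e)" for e
    unfolding linear_on_subspace_def r_def
    using E(2) by (simp add: real_vector.representation_add real_vector.representation_scale)
  have "\<forall>e. \<exists>x\<in>span E. \<forall>u\<in>span E. inner (j x) (j u) = r u e"
    using Riesz_finite_span[OF finE assms(2) _ lin] assms(3) E(3) by blast
  then obtain y where y: "\<And>e u. u \<in> span E \<Longrightarrow> inner (j (y e)) (j u) = r u e" by metis
  show ?thesis
  proof (intro exI ballI)
    fix x assume "x \<in> span B"
    then have x: "x \<in> span E" using E by simp
    have "x = (\<Sum>e\<in>E. r x e *\<^sub>R e)"
      unfolding r_def using real_vector.sum_representation_eq[OF E(2) x finE] by simp
    then have "norm x = norm (\<Sum>e\<in>E. r x e *\<^sub>R e)" by (rule arg_cong)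
    also have "\<dots> \<le> (\<Sum>e\<in>E. norm (r x e *\<^sub>R e))" by (rule norm_sum)
    also have "\<dots> \<le> (\<Sum>e\<in>E. norm (j (y e)) * norm e * norm (j x))"
    proof (rule sum_mono)
      fix e
      have "\<bar>r x e\<bar> \<le> norm (j (y e)) * norm (j x)"
        using y[OF x, of e] Cauchy_Schwarz_ineq2[of "j (y e)" "j x"] by simp
      then show "norm (r x e *\<^sub>R e) \<le> norm (j (y e)) * norm e * norm (j x)"
        using mult_right_mono[of "\<bar>r x e\<bar>" "norm (j (y e)) * norm (j x)" "norm e"] by (simp add: mult_ac)
    qed
    also have "\<dots> = (\<Sum>e\<in>E. norm (j (y e)) * norm e) * norm (j x)" by (simp add: sum_distrib_right)
    finally show "norm x \<le> (\<Sum>e\<in>E. norm (j (y e)) * norm e) * norm (j x)" .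
  qed
qed

section \<open>Energy estimates for the discrete problem\<close>

text \<open>Time is integrated out here: \<open>b m\<close> stands for the form integrated over the
  m-th cell, which is why its bounds carry the factor k. All questions of measurability stay
  outside.\<close>

locale discrete_problem =
  fixes j :: "'u::real_inner \<Rightarrow>\<^sub>L 'h::real_inner"
    and b :: "nat \<Rightarrow> 'u \<Rightarrow> 'u \<Rightarrow> real"
    and \<Phi> :: "'h \<Rightarrow>\<^sub>L 'h"
    and B U :: "'u set" and N :: nat and k M \<alpha> \<theta> :: real
  assumes finB: "finite B" and U_span: "U = span B"
    and j_inj: "x \<in> U \<Longrightarrow> j x = 0 \<Longrightarrow> x = 0"
    and k_pos: "0 < k" and \<alpha>_pos: "0 < \<alpha>" and M_ge: "1 \<le> M" and \<alpha>_le: "\<alpha> \<le> M"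
    and \<theta>_ge: "0 \<le> \<theta>" and \<theta>_le: "\<theta> \<le> 1" and N_pos: "0 < N"
    and bil: "m < N \<Longrightarrow> bilinear (b m)"
    and b_le: "m < N \<Longrightarrow> \<bar>b m x y\<bar> \<le> k * M * norm x * norm y"
    and b_ge: "m < N \<Longrightarrow> k * \<alpha> * (norm x)\<^sup>2 \<le> b m x x"
    and \<Phi>_le: "norm \<Phi> \<le> 1"
begin

definition mid :: "(nat \<Rightarrow> 'u) \<Rightarrow> nat \<Rightarrow> 'u" where
  "mid z m = \<theta> *\<^sub>R z (Suc m) + (1 - \<theta>) *\<^sub>R z m"

text \<open>The left-hand side of step m of the scheme, multiplied by k.\<close>

definition res :: "(nat \<Rightarrow> 'u) \<Rightarrow> nat \<Rightarrow> 'u \<Rightarrow> real" where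
  "res z m u = inner (j (z (Suc m) - z m)) (j u) + b m (mid z m) u"

text \<open>The square root is the norm in V of the step function with values \<open>v m\<close>, so
  \<open>g\<close> bounds the dual norm of the residual over V_n. A one-sided inequality bounds the
  absolute value as well, since v may be replaced by -v.\<close>

definition res_le :: "(nat \<Rightarrow> 'u) \<Rightarrow> real \<Rightarrow> bool" where
  "res_le z g \<longleftrightarrow> 0 \<le> g \<and> (\<forall>m\<le>N. z m \<in> U) \<and>
     (\<forall>v. (\<forall>m<N. v m \<in> U) \<longrightarrow> (\<Sum>m<N. res z m (v m)) \<le> g * sqrt (k * (\<Sum>m<N. (norm (v m))\<^sup>2)))"

text \<open>\<open>e\<close> measures the defect in the boundary condition. It enters through an
  inequality of norms, which \<open>boundary_le\<close> derives from the variational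
  condition.\<close>

definition stable :: "real \<Rightarrow> bool" where
  "stable K \<longleftrightarrow> (\<forall>z g e. res_le z g \<longrightarrow> 0 \<le> e \<longrightarrow> norm (j (z 0)) \<le> norm \<Phi> * norm (j (z N)) + e \<longrightarrow>
     (\<forall>m\<le>N. (norm (j (z m)))\<^sup>2 \<le> K * (g\<^sup>2 + e\<^sup>2)) \<and>
     k * (\<Sum>m<N. (norm (mid z m))\<^sup>2) \<le> K * (g\<^sup>2 + e\<^sup>2))"

lemma subspace_U: "subspace U"
  using U_span by simp

lemma mid_in: "(\<And>m. m \<le> N \<Longrightarrow> z m \<in> U) \<Longrightarrow> m < N \<Longrightarrow> mid z m \<in> U"
  unfolding mid_def by (simp add: subspace_U subspace_add subspace_scale)

lemma res_0: "m < N \<Longrightarrow> res z m 0 = 0"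
  using bil bilinear_rzero by (auto simp: res_def blinfun.zero_right)

text \<open>Test sequences supported in A are extended by zero. This localises the residual bound to
  a block of steps, which an energy inequality between two arbitrary nodes needs.\<close>

lemma res_le_on:
  assumes "res_le z g" "A \<subseteq> {..<N}" "\<And>m. m \<in> A \<Longrightarrow> v m \<in> U"
  shows "(\<Sum>m\<in>A. res z m (v m)) \<le> g * sqrt (k * (\<Sum>m\<in>A. (norm (v m))\<^sup>2))"
proof -
  define v' where "v' m = (if m \<in> A then v m else 0)" for m
  have "v' m \<in> U" for m using assms(3) subspace_U subspace_0 by (auto simp: v'_def)
  then have "(\<Sum>m<N. res z m (v' m)) \<le> g * sqrt (k * (\<Sum>m<N. (norm (v' m))\<^sup>2))"
    using assms(1) unfolding res_le_def by blast
  moreover have "(\<Sum>m<N. res z m (v' m)) = (\<Sum>m\<in>A. res z m (v m))"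
    using assms(2) res_0 by (intro sum.mono_neutral_cong_right) (auto simp: v'_def)
  moreover have "(\<Sum>m<N. (norm (v' m))\<^sup>2) = (\<Sum>m\<in>A. (norm (v m))\<^sup>2)"
    using assms(2) by (intro sum.mono_neutral_cong_right) (auto simp: v'_def)
  ultimately show ?thesis by simp
qed

text \<open>Expanding the inner product of the jump with the intermediate value. The sign of
  \<theta> - 1/2 decides whether the jumps dissipate or produce energy.\<close>

lemma energy_step:
  "res z m (mid z m) = ((norm (j (z (Suc m))))\<^sup>2 - (norm (j (z m)))\<^sup>2) / 2
     + (\<theta> - 1/2) * (norm (j (z (Suc m) - z m)))\<^sup>2 + b m (mid z m) (mid z m)"
proof -
  have "inner (y - x) (\<theta> *\<^sub>R y + (1 - \<theta>) *\<^sub>R x)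
      = ((norm y)\<^sup>2 - (norm x)\<^sup>2) / 2 + (\<theta> - 1/2) * (norm (y - x))\<^sup>2" for x y :: 'h
    unfolding power2_norm_eq_inner
    by (simp add: inner_diff inner_add inner_commute[of y x] field_simps)
  then show ?thesis
    by (simp add: res_def mid_def blinfun.add_right blinfun.diff_right blinfun.scaleR_right)
qed

lemma energy:
  assumes r: "res_le z g" and "i \<le> n" "n \<le> N"
  shows "(norm (j (z n)))\<^sup>2 + (2 * \<theta> - 1) * (\<Sum>m=i..<n. (norm (j (z (Suc m) - z m)))\<^sup>2)
     + \<alpha> * (k * (\<Sum>m=i..<n. (norm (mid z m))\<^sup>2)) \<le> (norm (j (z i)))\<^sup>2 + g\<^sup>2 / \<alpha>"
proof -
  define Z where "Z = k * (\<Sum>m=i..<n. (norm (mid z m))\<^sup>2)"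
  define D where "D = (\<Sum>m=i..<n. (norm (j (z (Suc m) - z m)))\<^sup>2)"
  have Z: "0 \<le> Z" unfolding Z_def using k_pos by (simp add: sum_nonneg)
  have U: "mid z m \<in> U" if "m \<in> {i..<n}" for m
    using mid_in r that assms(3) unfolding res_le_def by auto
  have "(\<Sum>m=i..<n. res z m (mid z m)) \<le> g * sqrt Z"
    unfolding Z_def by (rule res_le_on[OF r]) (use assms U in auto)
  moreover have "(\<Sum>m=i..<n. res z m (mid z m)) =
     (\<Sum>m=i..<n. (norm (j (z (Suc m))))\<^sup>2 - (norm (j (z m)))\<^sup>2) / 2 + (\<theta> - 1/2) * D
      + (\<Sum>m=i..<n. b m (mid z m) (mid z m))"
    by (simp only: energy_step sum.distrib D_def sum_distrib_left sum_divide_distrib)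
  moreover have "(\<Sum>m=i..<n. (norm (j (z (Suc m))))\<^sup>2 - (norm (j (z m)))\<^sup>2) = (norm (j (z n)))\<^sup>2 - (norm (j (z i)))\<^sup>2"
    using assms(2) by (rule sum_Suc_diff')
  moreover have "\<alpha> * Z \<le> (\<Sum>m=i..<n. b m (mid z m) (mid z m))"
    unfolding Z_def sum_distrib_left
    using assms(3) b_ge by (intro sum_mono) (auto simp: mult_ac)
  \<comment> \<open>The doubled energy identity contains 2 * \<alpha> * Z; this weight in Young's
    inequality spends half of it on the residual.\<close>
  moreover have "2 * (g * sqrt Z) \<le> \<alpha> * Z + g\<^sup>2 / \<alpha>"
  proof -
    have "0 \<le> (\<alpha> * sqrt Z - g)\<^sup>2 / \<alpha>" using \<alpha>_pos by simp
    also have "\<dots> = \<alpha> * (sqrt Z)\<^sup>2 + g\<^sup>2 / \<alpha> - 2 * (g * sqrt Z)"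
      using \<alpha>_pos by (simp add: power2_eq_square field_simps)
    finally show ?thesis using Z by simp
  qed
  moreover have "(2 * \<theta> - 1) * D = 2 * ((\<theta> - 1/2) * D)" by (simp add: algebra_simps)
  ultimately show ?thesis
    unfolding Z_def[symmetric] D_def[symmetric] by linarith
qed

lemma sum_mult_le_sqrt:
  fixes x y :: "nat \<Rightarrow> real"
  shows "(\<Sum>m\<in>A. x m * y m) \<le> sqrt (\<Sum>m\<in>A. (x m)\<^sup>2) * sqrt (\<Sum>m\<in>A. (y m)\<^sup>2)"
  using Cauchy_Schwarz_ineq_sum[of x y A] by (metis abs_le_D1 real_sqrt_abs real_sqrt_le_iff real_sqrt_mult)

lemma form_sum_le:
  assumes "A \<subseteq> {..<N}"
  shows "\<bar>\<Sum>m\<in>A. b m (x m) (v m)\<bar> \<le> M * sqrt (k * (\<Sum>m\<in>A. (norm (x m))\<^sup>2)) * sqrt (k * (\<Sum>m\<in>A. (norm (v m))\<^sup>2))"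
proof -
  have "\<bar>\<Sum>m\<in>A. b m (x m) (v m)\<bar> \<le> (\<Sum>m\<in>A. k * M * (norm (x m) * norm (v m)))"
    by (intro order_trans[OF sum_abs] sum_mono) (use assms b_le in \<open>auto simp: mult.assoc\<close>)
  also have "\<dots> = k * M * (\<Sum>m\<in>A. norm (x m) * norm (v m))" by (simp add: sum_distrib_left)
  also have "\<dots> \<le> k * M * (sqrt (\<Sum>m\<in>A. (norm (x m))\<^sup>2) * sqrt (\<Sum>m\<in>A. (norm (v m))\<^sup>2))"
    using k_pos M_ge sum_mult_le_sqrt by (intro mult_left_mono) auto
  also have "\<dots> = M * sqrt (k * (\<Sum>m\<in>A. (norm (x m))\<^sup>2)) * sqrt (k * (\<Sum>m\<in>A. (norm (v m))\<^sup>2))"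
    using k_pos by (simp add: real_sqrt_mult)
  finally show ?thesis .
qed

text \<open>Testing with the jumps gives D \<le> (g + M * sqrt Z) * sqrt P, and the inverse
  inequality gives P \<le> k * \<mu>^2 * D, so one factor sqrt D cancels. The prefactor k * \<mu>^2
  is the quantity that a restriction of the step size makes small.\<close>

lemma jump_le:
  assumes r: "res_le z g" and A: "A \<subseteq> {..<N}"
    and \<mu>: "0 \<le> \<mu>" "\<And>u. u \<in> U \<Longrightarrow> norm u \<le> \<mu> * norm (j u)"
  shows "(\<Sum>m\<in>A. (norm (j (z (Suc m) - z m)))\<^sup>2)
    \<le> k * \<mu>\<^sup>2 * (2 * M\<^sup>2) * (k * (\<Sum>m\<in>A. (norm (mid z m))\<^sup>2) + g\<^sup>2)"
proof -
  define Z where "Z = k * (\<Sum>m\<in>A. (norm (mid z m))\<^sup>2)"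
  define d where "d m = z (Suc m) - z m" for m
  define D where "D = (\<Sum>m\<in>A. (norm (j (d m)))\<^sup>2)"
  define P where "P = k * (\<Sum>m\<in>A. (norm (d m))\<^sup>2)"
  have Z: "0 \<le> Z" unfolding Z_def using k_pos by (simp add: sum_nonneg)
  have D: "0 \<le> D" unfolding D_def by (simp add: sum_nonneg)
  have g: "0 \<le> g" using r unfolding res_le_def by simp
  have U: "d m \<in> U" if "m \<in> A" for m
    using r that A subspace_U unfolding res_le_def d_def
    by (metis Suc_leI less_imp_le lessThan_iff subsetD subspace_diff)
  have "P \<le> k * (\<mu>\<^sup>2 * D)"
    unfolding P_def D_def sum_distrib_left[of "\<mu>\<^sup>2"]
  proof (intro mult_left_mono sum_mono)
    fix m assume "m \<in> A"
    from power_mono[OF \<mu>(2)[OF U[OF this]] norm_ge_zero, of 2]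
    show "(norm (d m))\<^sup>2 \<le> \<mu>\<^sup>2 * (norm (j (d m)))\<^sup>2" by (simp add: power_mult_distrib)
  qed (use k_pos in simp)
  then have sP: "sqrt P \<le> sqrt k * \<mu> * sqrt D"
    using \<mu>(1) by (metis real_sqrt_le_iff real_sqrt_mult real_sqrt_abs abs_of_nonneg mult.assoc)
  have c: "0 \<le> g + M * sqrt Z" using g Z M_ge by simp
  have "D = (\<Sum>m\<in>A. res z m (d m)) - (\<Sum>m\<in>A. b m (mid z m) (d m))"
    by (simp add: res_def d_def D_def power2_norm_eq_inner sum.distrib)
  also have "\<dots> \<le> g * sqrt P + M * sqrt Z * sqrt P"
    using res_le_on[OF r A U] form_sum_le[OF A, of "mid z" d] unfolding P_def Z_def by fastforce
  also have "\<dots> = (g + M * sqrt Z) * sqrt P" by (simp add: algebra_simps)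
  also have "\<dots> \<le> (g + M * sqrt Z) * (sqrt k * \<mu> * sqrt D)"
    by (rule mult_left_mono[OF sP c])
  finally have le: "sqrt D * sqrt D \<le> (g + M * sqrt Z) * (sqrt k * \<mu>) * sqrt D"
    using D by (simp add: mult_ac)
  have "sqrt D \<le> (g + M * sqrt Z) * (sqrt k * \<mu>)"
  proof (cases "D = 0")
    case True
    then show ?thesis using c \<mu>(1) k_pos by simp
  next
    case False
    then have "0 < sqrt D" using D by simp
    with le show ?thesis by (rule mult_right_le_imp_le)
  qed
  then have "(sqrt D)\<^sup>2 \<le> ((g + M * sqrt Z) * (sqrt k * \<mu>))\<^sup>2" using D by (intro power_mono) auto
  then have "D \<le> k * \<mu>\<^sup>2 * (g + M * sqrt Z)\<^sup>2"
    using D k_pos by (simp add: power_mult_distrib mult_ac)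
  also have "\<dots> \<le> k * \<mu>\<^sup>2 * (2 * M\<^sup>2 * (Z + g\<^sup>2))"
  proof (rule mult_left_mono)
    have "(g + M * sqrt Z)\<^sup>2 \<le> 2 * g\<^sup>2 + 2 * (M * sqrt Z)\<^sup>2"
      using sum_squares_bound[of g "M * sqrt Z"] by (simp add: power2_sum)
    moreover have "g\<^sup>2 \<le> M\<^sup>2 * g\<^sup>2" using M_ge by (simp add: mult_le_cancel_right1 one_le_power)
    ultimately show "(g + M * sqrt Z)\<^sup>2 \<le> 2 * M\<^sup>2 * (Z + g\<^sup>2)"
      using Z by (simp add: power_mult_distrib algebra_simps)
  qed (use k_pos in simp)
  finally show ?thesis unfolding D_def d_def Z_def by (simp add: mult_ac)
qed

end

section \<open>Stability of the discrete problem\<close>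

text \<open>\<open>c1\<close> is the factor of the dissipation in the averaged bound of the final
  energy, so \<eta> = T / c1 is the relative gain from 0 to T. \<open>K\<close> bounds the final
  energy; the outer factor passes from it to the initial energy and to c times the dissipation. C is
  the embedding constant, c a common constant of the energy and jump estimates.\<close>

definition stab_const :: "real \<Rightarrow> real \<Rightarrow> real \<Rightarrow> real" where
  "stab_const T C c = (let c1 = 2 * C\<^sup>2 * c + 2 * c; \<eta> = T / c1;
     K = 2 / \<eta> * (c + (T * c + 2 * c) / c1 + 1 + 2 / \<eta>)
   in (1 + c) * (2 * K + 2 + c))"

lemma stab_const_pos: "0 < T \<Longrightarrow> 0 < c \<Longrightarrow> 0 < stab_const T C c"
  unfolding stab_const_def Let_def
  by (intro mult_pos_pos add_pos_nonneg add_nonneg_pos) (auto intro!: add_nonneg_nonneg mult_nonneg_nonneg divide_nonneg_nonneg)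

text \<open>Dissipation gives \<open>(1 + \<eta>) n\<^sub>N\<^sup>2 \<le> n\<^sub>0\<^sup>2 + \<dots>\<close>, which is absorbed by
  \<open>n\<^sub>0 \<le> n\<^sub>N + e\<close> after Young's inequality with parameter \<open>\<eta> / 2\<close>.\<close>

lemma stab_const_bound:
  fixes n0 nN D g e :: real
  assumes T: "0 < T" and c: "0 < c" and nn: "0 \<le> n0" "0 \<le> nN" "0 \<le> D" "0 \<le> e"
    and e1: "nN\<^sup>2 + D \<le> n0\<^sup>2 + c * g\<^sup>2"
    and e2: "T * nN\<^sup>2 \<le> T * (c * g\<^sup>2) + 2 * C\<^sup>2 * (c * D) + 2 * (c * (D + g\<^sup>2))"
    and e3: "n0 \<le> nN + e"
  shows "n0\<^sup>2 + c * g\<^sup>2 \<le> stab_const T C c * (g\<^sup>2 + e\<^sup>2)" (is ?A)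
    and "c * D \<le> stab_const T C c * (g\<^sup>2 + e\<^sup>2)" (is ?B)
proof -
  define c1 where "c1 = 2 * C\<^sup>2 * c + 2 * c"
  define \<eta> where "\<eta> = T / c1"
  define c' where "c' = c + (T * c + 2 * c) / c1"
  define K where "K = 2 / \<eta> * (c' + 1 + 2 / \<eta>)"
  define Q where "Q = g\<^sup>2 + e\<^sup>2"
  have c1: "0 < c1" unfolding c1_def using c by (simp add: add_nonneg_pos)
  have \<eta>: "0 < \<eta>" unfolding \<eta>_def using T c1 by simp
  have c': "0 \<le> c'" unfolding c'_def using T c c1 by simp
  have K: "0 \<le> K" unfolding K_def using c' \<eta> by simp
  have Q: "g\<^sup>2 \<le> Q" "e\<^sup>2 \<le> Q" "0 \<le> Q" unfolding Q_def by auto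
  have sc: "stab_const T C c = (1 + c) * (2 * K + 2 + c)"
    unfolding stab_const_def Let_def K_def \<eta>_def c'_def c1_def by simp
  have "T * nN\<^sup>2 \<le> c1 * D + (T * c + 2 * c) * g\<^sup>2"
    using e2 unfolding c1_def by (simp add: algebra_simps)
  then have "T * nN\<^sup>2 / c1 \<le> (c1 * D + (T * c + 2 * c) * g\<^sup>2) / c1"
    using c1 by (intro divide_right_mono) auto
  then have "\<eta> * nN\<^sup>2 \<le> D + (T * c + 2 * c) / c1 * g\<^sup>2"
    using c1 unfolding \<eta>_def by (simp add: add_divide_distrib[of "c1 * D"])
  with e1 have 1: "(1 + \<eta>) * nN\<^sup>2 \<le> n0\<^sup>2 + c' * g\<^sup>2"
    unfolding c'_def by (simp add: algebra_simps)
  have "n0\<^sup>2 \<le> (nN + e)\<^sup>2" using e3 nn by (intro power_mono) auto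
  moreover have "0 \<le> (\<eta> / 2 * nN - e)\<^sup>2 * (2 / \<eta>)" using \<eta> by simp
  moreover have "(\<eta> / 2 * nN - e)\<^sup>2 * (2 / \<eta>) = \<eta> / 2 * nN\<^sup>2 + 2 / \<eta> * e\<^sup>2 - 2 * nN * e"
    using \<eta> by (simp add: power2_eq_square field_simps)
  ultimately have 2: "n0\<^sup>2 \<le> (1 + \<eta> / 2) * nN\<^sup>2 + (1 + 2 / \<eta>) * e\<^sup>2"
    by (simp add: power2_sum algebra_simps)
  have "\<eta> / 2 * nN\<^sup>2 \<le> c' * g\<^sup>2 + (1 + 2 / \<eta>) * e\<^sup>2"
    using 1 2 by (simp add: algebra_simps)
  also have "\<dots> \<le> c' * Q + (1 + 2 / \<eta>) * Q"
    using Q c' \<eta> by (intro add_mono mult_left_mono) auto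
  finally have "2 / \<eta> * (\<eta> / 2 * nN\<^sup>2) \<le> 2 / \<eta> * ((c' + 1 + 2 / \<eta>) * Q)"
    using \<eta> by (intro mult_left_mono) (auto simp: algebra_simps)
  moreover have "2 / \<eta> * (\<eta> / 2 * nN\<^sup>2) = nN\<^sup>2" using \<eta> by simp
  ultimately have nN: "nN\<^sup>2 \<le> K * Q" unfolding K_def by (simp only: mult.assoc)
  have "n0\<^sup>2 \<le> 2 * nN\<^sup>2 + 2 * e\<^sup>2"
    using \<open>n0\<^sup>2 \<le> (nN + e)\<^sup>2\<close> sum_squares_bound[of nN e] by (simp add: power2_sum)
  then have n0: "n0\<^sup>2 \<le> (2 * K + 2) * Q" using nN Q by (simp add: algebra_simps)
  have b: "n0\<^sup>2 + c * g\<^sup>2 \<le> (2 * K + 2 + c) * Q"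
    using n0 mult_left_mono[OF Q(1) less_imp_le[OF c]] by (simp add: algebra_simps)
  have p: "0 \<le> (2 * K + 2 + c) * Q" using K c Q by simp
  show ?A unfolding sc Q_def[symmetric]
    using b mult_nonneg_nonneg[OF less_imp_le[OF c] p] by (simp add: algebra_simps)
  have "D \<le> (2 * K + 2 + c) * Q" using b e1 by (smt (verit) zero_le_power2)
  then have "c * D \<le> c * ((2 * K + 2 + c) * Q)" using c by (intro mult_left_mono) auto
  then show ?B unfolding sc Q_def[symmetric] using p by (simp add: algebra_simps)
qed

section \<open>Stability in each range of theta\<close>

context discrete_problem
begin

text \<open>The averaging argument common to all cases. The dissipation is the form part plus the
  jumps with weight max 0 (2 * \<theta> - 1), so one statement covers \<theta> \<le> 1/2, where the
  weight vanishes, and \<theta> > 1/2, where the jumps help. The hypothesis on the jumps is what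
  allows the passage from \<open>mid z m\<close> to \<open>z m\<close>.\<close>

lemma stable_of_dissipation:
  fixes c C T :: real
  assumes T: "T = k * N" and C: "\<And>u. norm (j u) \<le> C * norm u" and c: "2 / \<alpha> \<le> c"
    and energy: "\<And>z g i n. res_le z g \<Longrightarrow> i \<le> n \<Longrightarrow> n \<le> N \<Longrightarrow>
      (norm (j (z n)))\<^sup>2 + (\<alpha> / 2 * (k * (\<Sum>m=i..<n. (norm (mid z m))\<^sup>2))
        + max 0 (2 * \<theta> - 1) * (\<Sum>m=i..<n. (norm (j (z (Suc m) - z m)))\<^sup>2)) \<le> (norm (j (z i)))\<^sup>2 + c * g\<^sup>2"
    and jump: "\<And>z g. res_le z g \<Longrightarrow> k * (\<Sum>m<N. (norm (j (z (Suc m) - z m)))\<^sup>2) \<le>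
       c * (\<alpha> / 2 * (k * (\<Sum>m<N. (norm (mid z m))\<^sup>2))
        + max 0 (2 * \<theta> - 1) * (\<Sum>m<N. (norm (j (z (Suc m) - z m)))\<^sup>2) + g\<^sup>2)"
  shows "stable (stab_const T C c)"
  unfolding stable_def
proof (intro allI impI)
  fix z g e assume r: "res_le z g" and e: "0 \<le> e"
    and z0: "norm (j (z 0)) \<le> norm \<Phi> * norm (j (z N)) + e"
  define S where "S = (\<Sum>m<N. (norm (j (z (Suc m) - z m)))\<^sup>2)"
  define Z where "Z = k * (\<Sum>m<N. (norm (mid z m))\<^sup>2)"
  define D where "D = \<alpha> / 2 * Z + max 0 (2 * \<theta> - 1) * S"
  have Tpos: "0 < T" using T k_pos N_pos by simp
  have cpos: "0 < c" using c \<alpha>_pos by (smt (verit) divide_pos_pos)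
  have S: "0 \<le> S" unfolding S_def by (simp add: sum_nonneg)
  have Z: "0 \<le> Z" unfolding Z_def using k_pos by (simp add: sum_nonneg)
  have D: "0 \<le> D" unfolding D_def using S Z \<alpha>_pos by simp
  have Z_le: "Z \<le> c * D"
  proof -
    have "Z = 2 / \<alpha> * (\<alpha> / 2 * Z)" using \<alpha>_pos by simp
    also have "\<dots> \<le> c * (\<alpha> / 2 * Z)" using c \<alpha>_pos Z by (intro mult_right_mono) auto
    also have "\<dots> \<le> c * D" using cpos S unfolding D_def by (intro mult_left_mono) auto
    finally show ?thesis .
  qed
  have diss: "0 \<le> \<alpha> / 2 * (k * (\<Sum>m=i..<n. (norm (mid z m))\<^sup>2))
        + max 0 (2 * \<theta> - 1) * (\<Sum>m=i..<n. (norm (j (z (Suc m) - z m)))\<^sup>2)" for i n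
    using k_pos \<alpha>_pos by (simp add: sum_nonneg)
  have en: "(norm (j (z n)))\<^sup>2 \<le> (norm (j (z i)))\<^sup>2 + c * g\<^sup>2" if "i \<le> n" "n \<le> N" for i n
    using energy[OF r that] diss[of i n] by linarith
  have e1: "(norm (j (z N)))\<^sup>2 + D \<le> (norm (j (z 0)))\<^sup>2 + c * g\<^sup>2"
    using energy[OF r, of 0 N] unfolding D_def S_def Z_def by (simp add: atLeast0LessThan)
  have jmp: "k * S \<le> c * (D + g\<^sup>2)"
    using jump[OF r] unfolding D_def S_def Z_def by simp
  \<comment> \<open>The final energy is bounded by the energy at node m, and the value there is the
    intermediate value minus \<theta> times the jump.\<close>
  have "(norm (j (z N)))\<^sup>2 \<le> c * g\<^sup>2 + 2 * C\<^sup>2 * (norm (mid z m))\<^sup>2 + 2 * (norm (j (z (Suc m) - z m)))\<^sup>2"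
    if "m < N" for m
  proof -
    let ?d = "z (Suc m) - z m"
    have "z m = mid z m - \<theta> *\<^sub>R ?d" unfolding mid_def by (simp add: algebra_simps)
    then have "norm (j (z m)) = norm (j (mid z m) - \<theta> *\<^sub>R j ?d)"
      by (metis blinfun.diff_right blinfun.scaleR_right)
    also have "\<dots> \<le> norm (j (mid z m)) + norm (\<theta> *\<^sub>R j ?d)" by (rule norm_triangle_ineq4)
    also have "\<dots> \<le> C * norm (mid z m) + norm (j ?d)"
      using C[of "mid z m"] \<theta>_ge \<theta>_le by (intro add_mono) (auto simp: mult_left_le_one_le)
    finally have "(norm (j (z m)))\<^sup>2 \<le> (C * norm (mid z m) + norm (j ?d))\<^sup>2"
      by (intro power_mono) auto
    also have "\<dots> \<le> 2 * (C * norm (mid z m))\<^sup>2 + 2 * (norm (j ?d))\<^sup>2"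
      using sum_squares_bound[of "C * norm (mid z m)" "norm (j ?d)"] by (simp add: power2_sum)
    finally show ?thesis using en[of m N] that by (simp add: power_mult_distrib)
  qed
  then have "(\<Sum>m<N. (norm (j (z N)))\<^sup>2) \<le> (\<Sum>m<N. c * g\<^sup>2 + 2 * C\<^sup>2 * (norm (mid z m))\<^sup>2 + 2 * (norm (j (z (Suc m) - z m)))\<^sup>2)"
    by (intro sum_mono) auto
  also have "\<dots> = real N * (c * g\<^sup>2) + 2 * C\<^sup>2 * (\<Sum>m<N. (norm (mid z m))\<^sup>2) + 2 * S"
    unfolding S_def by (simp add: sum.distrib sum_distrib_left)
  \<comment> \<open>Weighting the N inequalities with k makes T times the final energy out of their
    common left-hand side.\<close>
  finally have "k * (real N * (norm (j (z N)))\<^sup>2) \<le> k * (real N * (c * g\<^sup>2) + 2 * C\<^sup>2 * (\<Sum>m<N. (norm (mid z m))\<^sup>2) + 2 * S)"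
    using k_pos by (intro mult_left_mono) auto
  then have "T * (norm (j (z N)))\<^sup>2 \<le> T * (c * g\<^sup>2) + 2 * C\<^sup>2 * Z + 2 * (k * S)"
    unfolding T Z_def by (simp add: algebra_simps)
  also have "\<dots> \<le> T * (c * g\<^sup>2) + 2 * C\<^sup>2 * (c * D) + 2 * (c * (D + g\<^sup>2))"
    using mult_left_mono[OF Z_le, of "2 * C\<^sup>2"] jmp by simp
  finally have e2: "T * (norm (j (z N)))\<^sup>2 \<le> T * (c * g\<^sup>2) + 2 * C\<^sup>2 * (c * D) + 2 * (c * (D + g\<^sup>2))" .
  have e3: "norm (j (z 0)) \<le> norm (j (z N)) + e"
    using z0 \<Phi>_le mult_right_mono[of "norm \<Phi>" 1 "norm (j (z N))"] by simp
  note bd = stab_const_bound[OF Tpos cpos norm_ge_zero norm_ge_zero D e e1 e2 e3]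
  show "(\<forall>m\<le>N. (norm (j (z m)))\<^sup>2 \<le> stab_const T C c * (g\<^sup>2 + e\<^sup>2)) \<and>
     k * (\<Sum>m<N. (norm (mid z m))\<^sup>2) \<le> stab_const T C c * (g\<^sup>2 + e\<^sup>2)"
    using bd Z_le en[of 0] unfolding Z_def[symmetric] by (meson le0 order_trans)
qed

text \<open>For \<theta> \<le> 1/2 the jumps are not dissipated and \<open>jump_le\<close> has to
  bound them; the averaging contributes one more factor k, whence the condition on k * (k *
  \<mu>^2). The factor 2 / \<alpha> + \<alpha> + 1 dominates the energy constant and also bounds Z +
  g^2 by a multiple of \<alpha> / 2 * Z + g^2.\<close>

lemma stable_of_jump:
  fixes R C T :: real
  assumes T: "T = k * N" and C: "\<And>u. norm (j u) \<le> C * norm u"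
    and energy: "\<And>z g i n. res_le z g \<Longrightarrow> i \<le> n \<Longrightarrow> n \<le> N \<Longrightarrow>
      (norm (j (z n)))\<^sup>2 + \<alpha> / 2 * (k * (\<Sum>m=i..<n. (norm (mid z m))\<^sup>2)) \<le> (norm (j (z i)))\<^sup>2 + (1 / \<alpha> + \<alpha>) * g\<^sup>2"
    and \<mu>: "0 \<le> \<mu>" "\<And>u. u \<in> U \<Longrightarrow> norm u \<le> \<mu> * norm (j u)"
    and R: "k * (k * \<mu>\<^sup>2) \<le> R" and \<theta>: "\<theta> \<le> 1/2"
  shows "stable (stab_const T C ((2 / \<alpha> + \<alpha> + 1) * (1 + 2 * R * M\<^sup>2)))"
proof (rule stable_of_dissipation[OF T C])
  let ?c = "(2 / \<alpha> + \<alpha> + 1) * (1 + 2 * R * M\<^sup>2)"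
  have R0: "0 \<le> R" using R k_pos by (smt (verit) mult_nonneg_nonneg zero_le_power2)
  have a: "0 < 2 / \<alpha>" "0 < 1 / \<alpha>" "1 / \<alpha> \<le> 2 / \<alpha>" "0 < \<alpha>" using \<alpha>_pos by (auto simp: divide_right_mono)
  have "2 / \<alpha> + \<alpha> + 1 = (2 / \<alpha> + \<alpha> + 1) * 1" by simp
  also have "\<dots> \<le> ?c" using R0 a by (intro mult_left_mono) auto
  finally have c: "2 / \<alpha> + \<alpha> + 1 \<le> ?c" .
  then show "2 / \<alpha> \<le> ?c" using a by linarith
  have m0: "max 0 (2 * \<theta> - 1) = 0" using \<theta> by simp
  show "(norm (j (z n)))\<^sup>2 + (\<alpha> / 2 * (k * (\<Sum>m=i..<n. (norm (mid z m))\<^sup>2))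
        + max 0 (2 * \<theta> - 1) * (\<Sum>m=i..<n. (norm (j (z (Suc m) - z m)))\<^sup>2)) \<le> (norm (j (z i)))\<^sup>2 + ?c * g\<^sup>2"
    if "res_le z g" "i \<le> n" "n \<le> N" for z g i n
  proof -
    have "(1 / \<alpha> + \<alpha>) * g\<^sup>2 \<le> ?c * g\<^sup>2" by (rule mult_right_mono) (use c a in linarith, simp)
    then show ?thesis using energy[OF that] m0 by simp
  qed
  show "k * (\<Sum>m<N. (norm (j (z (Suc m) - z m)))\<^sup>2) \<le>
       ?c * (\<alpha> / 2 * (k * (\<Sum>m<N. (norm (mid z m))\<^sup>2))
        + max 0 (2 * \<theta> - 1) * (\<Sum>m<N. (norm (j (z (Suc m) - z m)))\<^sup>2) + g\<^sup>2)"
    if r: "res_le z g" for z g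
  proof -
    define Z where "Z = k * (\<Sum>m<N. (norm (mid z m))\<^sup>2)"
    have Z: "0 \<le> Z" unfolding Z_def using k_pos by (simp add: sum_nonneg)
    have "k * (\<Sum>m<N. (norm (j (z (Suc m) - z m)))\<^sup>2) \<le> k * (k * \<mu>\<^sup>2 * (2 * M\<^sup>2) * (Z + g\<^sup>2))"
      unfolding Z_def using k_pos jump_le[OF r subset_refl \<mu>] by (intro mult_left_mono) auto
    also have "\<dots> = (k * (k * \<mu>\<^sup>2)) * (2 * M\<^sup>2 * (Z + g\<^sup>2))" by simp
    also have "\<dots> \<le> R * (2 * M\<^sup>2 * (Z + g\<^sup>2))" using R Z by (intro mult_right_mono) auto
    also have "\<dots> = 2 * R * M\<^sup>2 * (Z + g\<^sup>2)" by simp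
    also have "\<dots> \<le> (1 + 2 * R * M\<^sup>2) * (Z + g\<^sup>2)" using Z R0 by (intro mult_right_mono) auto
    also have "\<dots> \<le> (1 + 2 * R * M\<^sup>2) * ((2 / \<alpha> + \<alpha> + 1) * (\<alpha> / 2 * Z + g\<^sup>2))"
    proof (rule mult_left_mono)
      have "(2 / \<alpha> + \<alpha> + 1) * (\<alpha> / 2 * Z + g\<^sup>2) = Z + g\<^sup>2 + (\<alpha> / 2 * Z + 2 / \<alpha> * g\<^sup>2) + \<alpha> * (\<alpha> / 2 * Z + g\<^sup>2)"
        using \<alpha>_pos by (simp add: field_simps)
      then show "Z + g\<^sup>2 \<le> (2 / \<alpha> + \<alpha> + 1) * (\<alpha> / 2 * Z + g\<^sup>2)" using Z \<alpha>_pos by simp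
    qed (use R0 in simp)
    finally show ?thesis unfolding m0 Z_def by (simp add: mult_ac)
  qed
qed

text \<open>The jumps, which enter the energy with the wrong sign, are absorbed by half of the
  coercivity, leaving \<alpha> / 2. For the averaging, k \<le> T turns the step size condition into
  the bound R of \<open>stable_of_jump\<close>.\<close>

lemma stable_lt_half:
  fixes C T :: real
  assumes T: "T = k * N" and C: "\<And>u. norm (j u) \<le> C * norm u" and \<theta>: "\<theta> < 1/2"
    and \<mu>: "0 \<le> \<mu>" "\<And>u. u \<in> U \<Longrightarrow> norm u \<le> \<mu> * norm (j u)"
    and k: "k * \<mu>\<^sup>2 \<le> \<alpha>\<^sup>2 / (24 * M^3 * (1/2 - \<theta>))"
  shows "stable (stab_const T C ((2 / \<alpha> + \<alpha> + 1) * (1 + 2 * (T * (\<alpha>\<^sup>2 / (24 * M^3 * (1/2 - \<theta>)))) * M\<^sup>2)))"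
proof (rule stable_of_jump[OF T C _ \<mu>])
  let ?q = "\<alpha>\<^sup>2 / (24 * M^3 * (1/2 - \<theta>))"
  have kT: "k \<le> T" using T k_pos N_pos by simp
  show "k * (k * \<mu>\<^sup>2) \<le> T * ?q" using kT k k_pos by (intro mult_mono) auto
  show "\<theta> \<le> 1/2" using \<theta> by simp
  fix z g i n assume r: "res_le z g" and i: "i \<le> n" "n \<le> N"
  define Z where "Z = k * (\<Sum>m=i..<n. (norm (mid z m))\<^sup>2)"
  define S where "S = (\<Sum>m=i..<n. (norm (j (z (Suc m) - z m)))\<^sup>2)"
  have Z: "0 \<le> Z" unfolding Z_def using k_pos by (simp add: sum_nonneg)
  have "S \<le> k * \<mu>\<^sup>2 * (2 * M\<^sup>2) * (Z + g\<^sup>2)"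
    unfolding S_def Z_def by (rule jump_le[OF r _ \<mu>]) (use i in auto)
  also have "\<dots> \<le> ?q * (2 * M\<^sup>2) * (Z + g\<^sup>2)"
    using k Z by (intro mult_right_mono) auto
  finally have "(1 - 2 * \<theta>) * S \<le> (1 - 2 * \<theta>) * (?q * (2 * M\<^sup>2) * (Z + g\<^sup>2))"
    using \<theta> by (intro mult_left_mono) auto
  \<comment> \<open>As 1 - 2 * \<theta> is twice 1/2 - \<theta>, the factors 2, 2 and 1/24 and the
    powers of M combine to 1 / (6 * M). The next step then uses \<alpha> \<le> M.\<close>
  also have "\<dots> = \<alpha>\<^sup>2 / (6 * M) * (Z + g\<^sup>2)"
    using \<theta> M_ge by (simp add: field_simps power2_eq_square power3_eq_cube)
  also have "\<dots> \<le> \<alpha> / 2 * (Z + g\<^sup>2)"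
  proof (rule mult_right_mono)
    have "\<alpha> * \<alpha> / (6 * M) \<le> \<alpha> * M / (6 * M)"
      using \<alpha>_le \<alpha>_pos M_ge by (intro divide_right_mono mult_left_mono) auto
    also have "\<dots> = \<alpha> / 6" using M_ge by simp
    finally show "\<alpha>\<^sup>2 / (6 * M) \<le> \<alpha> / 2" using \<alpha>_pos by (simp add: power2_eq_square)
  qed (use Z in simp)
  finally have 1: "(1 - 2 * \<theta>) * S \<le> \<alpha> / 2 * Z + \<alpha> / 2 * g\<^sup>2" by (simp add: algebra_simps)
  have 2: "(norm (j (z n)))\<^sup>2 + (2 * \<theta> - 1) * S + \<alpha> * Z \<le> (norm (j (z i)))\<^sup>2 + g\<^sup>2 / \<alpha>"
    unfolding S_def Z_def by (rule energy[OF r i])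
  have 3: "(2 * \<theta> - 1) * S = - ((1 - 2 * \<theta>) * S)" by (simp add: algebra_simps)
  have "\<alpha> / 2 * g\<^sup>2 \<le> \<alpha> * g\<^sup>2" using \<alpha>_pos by (intro mult_right_mono) auto
  moreover have "(1 / \<alpha> + \<alpha>) * g\<^sup>2 = g\<^sup>2 / \<alpha> + \<alpha> * g\<^sup>2" by (simp add: algebra_simps)
  moreover have "\<alpha> / 2 * Z = \<alpha> * Z / 2" by simp
  ultimately show "(norm (j (z n)))\<^sup>2 + \<alpha> / 2 * (k * (\<Sum>m=i..<n. (norm (mid z m))\<^sup>2)) \<le> (norm (j (z i)))\<^sup>2 + (1 / \<alpha> + \<alpha>) * g\<^sup>2"
    using 1 2 3 unfolding Z_def[symmetric] by linarith
qed

text \<open>At \<theta> = 1/2 the jumps drop out of the energy, so nothing has to be absorbed; the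
  averaging still contains them, and there the bound on k * \<mu> controls them.\<close>

lemma stable_half:
  fixes C T :: real
  assumes T: "T = k * N" and C: "\<And>u. norm (j u) \<le> C * norm u" and \<theta>: "\<theta> = 1/2"
    and \<mu>: "0 \<le> \<mu>" "\<And>u. u \<in> U \<Longrightarrow> norm u \<le> \<mu> * norm (j u)"
    and k: "k * \<mu> \<le> L"
  shows "stable (stab_const T C ((2 / \<alpha> + \<alpha> + 1) * (1 + 2 * L\<^sup>2 * M\<^sup>2)))"
proof (rule stable_of_jump[OF T C _ \<mu>])
  have "k * (k * \<mu>\<^sup>2) = (k * \<mu>)\<^sup>2" by (simp add: power2_eq_square)
  also have "\<dots> \<le> L\<^sup>2" using k \<mu>(1) k_pos by (intro power_mono) auto
  finally show "k * (k * \<mu>\<^sup>2) \<le> L\<^sup>2" .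
  show "\<theta> \<le> 1/2" using \<theta> by simp
  fix z g i n assume r: "res_le z g" and i: "i \<le> n" "n \<le> N"
  have "0 \<le> k * (\<Sum>m=i..<n. (norm (mid z m))\<^sup>2)" using k_pos by (simp add: sum_nonneg)
  then have "\<alpha> / 2 * (k * (\<Sum>m=i..<n. (norm (mid z m))\<^sup>2)) \<le> \<alpha> * (k * (\<Sum>m=i..<n. (norm (mid z m))\<^sup>2))"
    using \<alpha>_pos by (intro mult_right_mono) auto
  moreover have "g\<^sup>2 / \<alpha> \<le> (1 / \<alpha> + \<alpha>) * g\<^sup>2" using \<alpha>_pos by (simp add: algebra_simps)
  moreover have "2 * \<theta> - 1 = 0" using \<theta> by simp
  ultimately show "(norm (j (z n)))\<^sup>2 + \<alpha> / 2 * (k * (\<Sum>m=i..<n. (norm (mid z m))\<^sup>2)) \<le> (norm (j (z i)))\<^sup>2 + (1 / \<alpha> + \<alpha>) * g\<^sup>2"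
    using energy[OF r i] by simp
qed

text \<open>The jumps are dissipated with weight 2 * \<theta> - 1, so by k \<le> T their sum times k
  is at most T / (2 * \<theta> - 1) times the dissipation.\<close>

lemma stable_gt_half:
  fixes C T :: real
  assumes T: "T = k * N" and C: "\<And>u. norm (j u) \<le> C * norm u" and \<theta>: "1/2 < \<theta>"
  shows "stable (stab_const T C (2 / \<alpha> + T / (2 * \<theta> - 1)))"
proof (rule stable_of_dissipation[OF T C])
  let ?c = "2 / \<alpha> + T / (2 * \<theta> - 1)"
  have kT: "k \<le> T" using T k_pos N_pos by simp
  have t: "0 \<le> T / (2 * \<theta> - 1)" "max 0 (2 * \<theta> - 1) = 2 * \<theta> - 1" using \<theta> kT k_pos by auto
  show c: "2 / \<alpha> \<le> ?c" using t by simp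
  show "(norm (j (z n)))\<^sup>2 + (\<alpha> / 2 * (k * (\<Sum>m=i..<n. (norm (mid z m))\<^sup>2))
        + max 0 (2 * \<theta> - 1) * (\<Sum>m=i..<n. (norm (j (z (Suc m) - z m)))\<^sup>2)) \<le> (norm (j (z i)))\<^sup>2 + ?c * g\<^sup>2"
    if r: "res_le z g" and i: "i \<le> n" "n \<le> N" for z g i n
  proof -
    have "0 \<le> k * (\<Sum>m=i..<n. (norm (mid z m))\<^sup>2)" using k_pos by (simp add: sum_nonneg)
    then have "\<alpha> / 2 * (k * (\<Sum>m=i..<n. (norm (mid z m))\<^sup>2)) \<le> \<alpha> * (k * (\<Sum>m=i..<n. (norm (mid z m))\<^sup>2))"
      using \<alpha>_pos by (intro mult_right_mono) auto
    moreover have "1 / \<alpha> * g\<^sup>2 \<le> ?c * g\<^sup>2"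
      using t \<alpha>_pos by (intro mult_right_mono add_increasing2 divide_right_mono) auto
    ultimately show ?thesis using energy[OF r i] t(2) by simp
  qed
  show "k * (\<Sum>m<N. (norm (j (z (Suc m) - z m)))\<^sup>2) \<le>
       ?c * (\<alpha> / 2 * (k * (\<Sum>m<N. (norm (mid z m))\<^sup>2))
        + max 0 (2 * \<theta> - 1) * (\<Sum>m<N. (norm (j (z (Suc m) - z m)))\<^sup>2) + g\<^sup>2)" for z g
  proof -
    define S where "S = (\<Sum>m<N. (norm (j (z (Suc m) - z m)))\<^sup>2)"
    define Z where "Z = k * (\<Sum>m<N. (norm (mid z m))\<^sup>2)"
    have Z: "0 \<le> Z" unfolding Z_def using k_pos by (simp add: sum_nonneg)
    have S: "0 \<le> S" unfolding S_def by (simp add: sum_nonneg)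
    have "k * S \<le> T / (2 * \<theta> - 1) * ((2 * \<theta> - 1) * S)"
      using \<theta> S kT by (simp add: mult_right_mono)
    also have "\<dots> \<le> ?c * (\<alpha> / 2 * Z + (2 * \<theta> - 1) * S + g\<^sup>2)"
      using \<alpha>_pos t Z S \<theta> by (intro mult_mono add_nonneg_nonneg) auto
    finally show ?thesis unfolding S_def Z_def t(2) .
  qed
qed

text \<open>With r = norm \<Phi> < 1, the energy inequality in the form n_N \<le> n_0 + s and the
  boundary condition n_0 \<le> r * n_N + e combine to (1 - r) * n_0 \<le> s + e. No average over
  time is taken, hence neither T nor the embedding constant enters the constant.\<close>

lemma stable_contraction:
  assumes \<theta>: "1/2 \<le> \<theta>" and \<Phi>: "norm \<Phi> < 1"
  defines "K0 \<equiv> 2 * (1 / \<alpha> + 1) / (1 - norm \<Phi>)\<^sup>2 + 1 / \<alpha>"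
  shows "stable (K0 + K0 / \<alpha>)"
  unfolding stable_def
proof (intro allI impI)
  fix z g e assume r: "res_le z g" and e: "0 \<le> e"
    and z0: "norm (j (z 0)) \<le> norm \<Phi> * norm (j (z N)) + e"
  define n0 where "n0 = norm (j (z 0))"
  define r where "r = norm \<Phi>"
  \<comment> \<open>The square root of the residual term in the energy inequality, so that norms
    instead of energies can be compared.\<close>
  define s where "s = g / sqrt \<alpha>"
  define Z where "Z = k * (\<Sum>m<N. (norm (mid z m))\<^sup>2)"
  have g: "0 \<le> g" using \<open>res_le z g\<close> unfolding res_le_def by simp
  have s: "0 \<le> s" "s\<^sup>2 = g\<^sup>2 / \<alpha>" unfolding s_def using \<alpha>_pos g by (auto simp: power_divide)
  have r: "0 \<le> r" "r < 1" unfolding r_def using \<Phi> by auto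
  have Z: "0 \<le> Z" unfolding Z_def using k_pos by (simp add: sum_nonneg)
  have en: "(norm (j (z n)))\<^sup>2 + \<alpha> * (k * (\<Sum>m<n. (norm (mid z m))\<^sup>2)) \<le> n0\<^sup>2 + g\<^sup>2 / \<alpha>" if "n \<le> N" for n
  proof -
    have "0 \<le> (2 * \<theta> - 1) * (\<Sum>m<n. (norm (j (z (Suc m) - z m)))\<^sup>2)"
      using \<theta> by (simp add: sum_nonneg)
    with energy[OF \<open>res_le z g\<close>, of 0 n] that show ?thesis
      unfolding n0_def by (simp add: atLeast0LessThan)
  qed
  have "(norm (j (z N)))\<^sup>2 \<le> n0\<^sup>2 + s\<^sup>2"
    using en[of N] Z \<alpha>_pos unfolding Z_def[symmetric] s(2)
    by (smt (verit, ccfv_threshold) mult_nonneg_nonneg order_refl)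
  also have "\<dots> \<le> (n0 + s)\<^sup>2" unfolding n0_def using s by (simp add: power2_sum)
  finally have "norm (j (z N)) \<le> n0 + s" by (rule power2_le_imp_le) (use s n0_def in auto)
  then have "r * norm (j (z N)) \<le> r * (n0 + s)" using r by (intro mult_left_mono) auto
  moreover have "r * s \<le> s" using r s by (simp add: mult_left_le_one_le)
  ultimately have "n0 * (1 - r) \<le> s + e"
    using z0 unfolding n0_def[symmetric] r_def[symmetric] by (simp add: algebra_simps)
  then have "n0 \<le> (s + e) / (1 - r)" using r by (simp add: pos_le_divide_eq)
  then have "n0\<^sup>2 \<le> ((s + e) / (1 - r))\<^sup>2" unfolding n0_def by (intro power_mono) auto
  also have "\<dots> = (s + e)\<^sup>2 / (1 - r)\<^sup>2" by (simp add: power_divide)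
  also have "\<dots> \<le> 2 * (1 / \<alpha> + 1) * (g\<^sup>2 + e\<^sup>2) / (1 - r)\<^sup>2"
  proof (rule divide_right_mono)
    have "(s + e)\<^sup>2 \<le> 2 * (g\<^sup>2 / \<alpha>) + 2 * e\<^sup>2"
      using sum_squares_bound[of s e] s(2) by (simp add: power2_sum)
    also have "\<dots> \<le> 2 * (1 / \<alpha> + 1) * (g\<^sup>2 + e\<^sup>2)" using \<alpha>_pos by (simp add: algebra_simps)
    finally show "(s + e)\<^sup>2 \<le> 2 * (1 / \<alpha> + 1) * (g\<^sup>2 + e\<^sup>2)" .
  qed simp
  finally have n0: "n0\<^sup>2 + g\<^sup>2 / \<alpha> \<le> K0 * (g\<^sup>2 + e\<^sup>2)"
    unfolding K0_def r_def[symmetric] distrib_right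
    using \<alpha>_pos divide_right_mono[of "g\<^sup>2" "g\<^sup>2 + e\<^sup>2" \<alpha>] by simp
  have K0: "0 \<le> K0" unfolding K0_def using \<alpha>_pos by simp
  have K1: "0 \<le> K0 / \<alpha> * (g\<^sup>2 + e\<^sup>2)" "0 \<le> K0 * (g\<^sup>2 + e\<^sup>2)" using K0 \<alpha>_pos by simp_all
  have A: "(norm (j (z m)))\<^sup>2 \<le> (K0 + K0 / \<alpha>) * (g\<^sup>2 + e\<^sup>2)" if "m \<le> N" for m
  proof -
    have "0 \<le> \<alpha> * (k * (\<Sum>i<m. (norm (mid z i))\<^sup>2))" using \<alpha>_pos k_pos by (simp add: sum_nonneg)
    then show ?thesis using en[OF that] n0 K1(1) by (simp only: distrib_right)
  qed
  have "\<alpha> * Z \<le> K0 * (g\<^sup>2 + e\<^sup>2)"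
    using en[of N] n0 unfolding Z_def by (smt (verit, ccfv_threshold) order_refl zero_le_power2)
  then have "\<alpha> * Z / \<alpha> \<le> K0 * (g\<^sup>2 + e\<^sup>2) / \<alpha>" using \<alpha>_pos by (intro divide_right_mono) auto
  then have "Z \<le> K0 / \<alpha> * (g\<^sup>2 + e\<^sup>2)" using \<alpha>_pos by simp
  then have "Z \<le> (K0 + K0 / \<alpha>) * (g\<^sup>2 + e\<^sup>2)" using K1 by (simp only: distrib_right)
  with A show "(\<forall>m\<le>N. (norm (j (z m)))\<^sup>2 \<le> (K0 + K0 / \<alpha>) * (g\<^sup>2 + e\<^sup>2)) \<and>
     k * (\<Sum>m<N. (norm (mid z m))\<^sup>2) \<le> (K0 + K0 / \<alpha>) * (g\<^sup>2 + e\<^sup>2)"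
    unfolding Z_def by blast
qed

end

section \<open>Solvability of the discrete problem\<close>

context discrete_problem
begin

lemma res_add:
  assumes "m < N"
  shows "res (\<lambda>m. z m + z' m) m u = res z m u + res z' m u"
proof -
  have "mid (\<lambda>m. z m + z' m) m = mid z m + mid z' m" unfolding mid_def by (simp add: algebra_simps)
  then show ?thesis unfolding res_def
    using bil[OF assms] by (simp add: bilinear_ladd blinfun.add_right blinfun.diff_right inner_diff inner_add)
qed

lemma res_scale:
  assumes "m < N"
  shows "res (\<lambda>m. c *\<^sub>R z m) m u = c * res z m u"
proof -
  have "mid (\<lambda>m. c *\<^sub>R z m) m = c *\<^sub>R mid z m" unfolding mid_def by (simp add: algebra_simps)
  then show ?thesis unfolding res_def
    using bil[OF assms]
    by (simp add: bilinear_lmul blinfun.scaleR_right scaleR_diff_right[symmetric] distrib_left del: scaleR_diff_right)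
qed

lemma res_diff:
  assumes "m < N"
  shows "res (\<lambda>m. z m - z' m) m u = res z m u - res z' m u"
  using res_add[OF assms, of z "\<lambda>m. (-1) *\<^sub>R z' m" u] res_scale[OF assms, of "-1" z' u] by simp

text \<open>The implicit part of a step is definite on U even for \<theta> = 0, because
  \<open>j\<close> is injective there.\<close>

lemma positive_form:
  assumes "m < N" "y \<in> U" "inner (j y) (j y) + \<theta> * b m y y \<le> 0"
  shows "y = 0"
proof -
  have "0 \<le> b m y y"
    using b_ge[OF assms(1), of y] k_pos \<alpha>_pos by (smt (verit) mult_nonneg_nonneg zero_le_power2)
  then have "0 \<le> \<theta> * b m y y" using \<theta>_ge by simp
  then have "inner (j y) (j y) \<le> 0" using assms(3) by linarith
  then have "(norm (j y))\<^sup>2 \<le> 0" by (simp only: power2_norm_eq_inner)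
  then have "j y = 0" by simp
  then show ?thesis using j_inj assms(2) by blast
qed

lemma step_exists:
  assumes m: "m < N" and x: "x \<in> U" and l: "linear_on_subspace U l"
  shows "\<exists>y\<in>U. \<forall>u\<in>U. inner (j (y - x)) (j u) + b m (\<theta> *\<^sub>R y + (1 - \<theta>) *\<^sub>R x) u = l u"
proof -
  note bm = bil[OF m]
  have "\<exists>y\<in>U. \<forall>u\<in>U. inner (j y) (j u) + \<theta> * b m y u = l u + inner (j x) (j u) - (1 - \<theta>) * b m x u"
  proof (rule nondegenerate_form_solvable[OF finB U_span])
    show "linear_on_subspace U (\<lambda>y. inner (j y) (j u) + \<theta> * b m y u)" for u
      using bm by (auto simp: linear_on_subspace_def bilinear_ladd bilinear_lmul blinfun.add_right
          blinfun.scaleR_right inner_add algebra_simps)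
    show "linear_on_subspace U (\<lambda>u. inner (j y) (j u) + \<theta> * b m y u)" for y
      using bm by (auto simp: linear_on_subspace_def bilinear_radd bilinear_rmul blinfun.add_right
          blinfun.scaleR_right inner_add algebra_simps)
    show "linear_on_subspace U (\<lambda>u. l u + inner (j x) (j u) - (1 - \<theta>) * b m x u)"
      using bm l by (auto simp: linear_on_subspace_def bilinear_radd bilinear_rmul blinfun.add_right
          blinfun.scaleR_right inner_add algebra_simps)
    show "y = 0" if "y \<in> U" "\<And>u. u \<in> U \<Longrightarrow> inner (j y) (j u) + \<theta> * b m y u = 0" for y
      using positive_form[OF m that(1)] that by (metis order_refl)
  qed
  moreover have "inner (j (y - x)) (j u) + b m (\<theta> *\<^sub>R y + (1 - \<theta>) *\<^sub>R x) u
      = inner (j y) (j u) + \<theta> * b m y u - (inner (j x) (j u) - (1 - \<theta>) * b m x u)" for y u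
    by (simp add: bilinear_ladd[OF bm] bilinear_lmul[OF bm] blinfun.diff_right inner_diff)
  ultimately show ?thesis by (simp add: diff_eq_eq add_diff_eq)
qed

lemma march_exists:
  assumes "x \<in> U" and "\<And>m. m < N \<Longrightarrow> linear_on_subspace U (F m)"
  shows "\<exists>w. w 0 = x \<and> (\<forall>m\<le>N. w m \<in> U) \<and> (\<forall>m<N. \<forall>u\<in>U. res w m u = F m u)"
proof -
  have "\<exists>w. w 0 = x \<and> (\<forall>m\<le>n. w m \<in> U) \<and> (\<forall>m<n. \<forall>u\<in>U. res w m u = F m u)" if "n \<le> N" for n
    using that
  proof (induction n)
    case 0
    show ?case using assms(1) by (intro exI[of _ "\<lambda>_. x"]) auto
  next
    case (Suc n)
    then obtain w where w: "w 0 = x" "\<forall>m\<le>n. w m \<in> U" "\<forall>m<n. \<forall>u\<in>U. res w m u = F m u" by auto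
    have n: "n < N" using Suc by simp
    from step_exists[OF n _ assms(2)[OF n], of "w n"] w(2)
    obtain y where y: "y \<in> U" "\<forall>u\<in>U. inner (j (y - w n)) (j u) + b n (\<theta> *\<^sub>R y + (1 - \<theta>) *\<^sub>R w n) u = F n u"
      by auto
    have "res (w(Suc n := y)) m u = F m u" if "m < Suc n" "u \<in> U" for m u
      using that w(3) y(2) by (cases "m = n") (auto simp: res_def mid_def)
    moreover have "(w(Suc n := y)) 0 = x" "\<forall>m\<le>Suc n. (w(Suc n := y)) m \<in> U"
      using w(1,2) y(1) by (auto simp: le_Suc_eq)
    ultimately show ?case by blast
  qed
  then show ?thesis by blast
qed

lemma march_unique:
  assumes "z 0 = 0" "\<forall>m\<le>N. z m \<in> U" "\<forall>m<N. \<forall>u\<in>U. res z m u = 0" "m \<le> N"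
  shows "z m = 0"
  using assms(4)
proof (induction m)
  case 0
  then show ?case using assms(1) by simp
next
  case (Suc m)
  then have m: "m < N" and zm: "z m = 0" and U: "z (Suc m) \<in> U" using assms(2) by auto
  have "res z m (z (Suc m)) = 0" using assms(3) m U by blast
  then show ?case
    using positive_form[OF m U] bil[OF m] zm by (simp add: res_def mid_def bilinear_lmul)
qed

text \<open>Testing the boundary condition with \<open>z 0\<close> itself turns the variational
  identity into the inequality required by \<open>stable\<close>.\<close>

lemma boundary_le:
  assumes "z 0 \<in> U" and "\<And>u. u \<in> U \<Longrightarrow> inner (j (z 0) - \<Phi> (j (z N))) (j u) = inner \<xi> (j u)"
  shows "norm (j (z 0)) \<le> norm \<Phi> * norm (j (z N)) + norm \<xi>"
proof -
  let ?n = "norm (j (z 0))"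
  have "inner (j (z 0)) (j (z 0)) = inner (\<Phi> (j (z N)) + \<xi>) (j (z 0))"
    using assms(2)[OF assms(1)] by (simp add: inner_diff inner_add)
  then have "?n * ?n = inner (\<Phi> (j (z N)) + \<xi>) (j (z 0))"
    by (metis dot_square_norm power2_eq_square)
  also have "\<dots> \<le> norm (\<Phi> (j (z N)) + \<xi>) * ?n" by (rule norm_cauchy_schwarz)
  also have "\<dots> \<le> (norm \<Phi> * norm (j (z N)) + norm \<xi>) * ?n"
    by (intro mult_right_mono norm_triangle_le add_mono norm_blinfun) auto
  finally show ?thesis
    by (cases "?n = 0") (auto simp: mult_le_cancel_right add_nonneg_nonneg)
qed

lemma homogeneous_scheme_zero:
  assumes st: "stable K" and z: "\<forall>m\<le>N. z m \<in> U" "\<forall>m<N. \<forall>u\<in>U. res z m u = 0"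
    and bd: "\<forall>u\<in>U. inner (j (z 0) - \<Phi> (j (z N))) (j u) = 0" and m: "m \<le> N"
  shows "z m = 0"
proof -
  have "res_le z 0" unfolding res_le_def using z by simp
  moreover have "norm (j (z 0)) \<le> norm \<Phi> * norm (j (z N)) + 0"
    using boundary_le[of z 0] z(1) bd by simp
  ultimately have "(norm (j (z m)))\<^sup>2 \<le> K * (0\<^sup>2 + 0\<^sup>2)"
    using st m unfolding stable_def by blast
  then have "j (z m) = 0" by simp
  then show ?thesis using j_inj z(1) m by blast
qed

text \<open>Shooting: \<open>p\<close> solves the steps from initial value 0, \<open>S x\<close>
  solves the homogeneous steps from x, and p + S x meets the boundary condition exactly when x
  solves a linear problem on U. That problem is nondegenerate because stability leaves the
  homogeneous scheme only the zero solution.\<close>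

lemma scheme_exists:
  assumes st: "stable K" and F: "\<And>m. m < N \<Longrightarrow> linear_on_subspace U (F m)"
  shows "\<exists>w. (\<forall>m\<le>N. w m \<in> U) \<and> (\<forall>m<N. \<forall>u\<in>U. res w m u = F m u) \<and>
    (\<forall>u\<in>U. inner (j (w 0) - \<Phi> (j (w N))) (j u) = inner \<xi> (j u))"
proof -
  define hom where "hom w \<longleftrightarrow> (\<forall>m\<le>N. w m \<in> U) \<and> (\<forall>m<N. \<forall>u\<in>U. res w m u = 0)" for w
  have ex: "\<exists>w. hom w \<and> w 0 = x" if "x \<in> U" for x
    using march_exists[OF that, of "\<lambda>_ _. 0"] unfolding hom_def by (auto simp: linear_on_subspace_def)
  \<comment> \<open>\<open>S\<close> is obtained by choice; uniqueness of the march, shown below,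
    makes its final value linear in x for x in U.\<close>
  define S where "S x = (SOME w. hom w \<and> w 0 = x)" for x
  have S: "hom (S x)" "S x 0 = x" if "x \<in> U" for x
    using someI_ex[OF ex[OF that]] unfolding S_def by auto
  have uniq: "w N = w' N" if "hom w" "hom w'" "w 0 = w' 0" for w w'
  proof -
    have "(\<lambda>m. w m - w' m) N = 0"
      by (rule march_unique) (use that in \<open>auto simp: hom_def res_diff subspace_U subspace_diff\<close>)
    then show ?thesis by simp
  qed
  have S_add: "S (x + y) N = S x N + S y N" if "x \<in> U" "y \<in> U" for x y
  proof (rule uniq)
    show "hom (\<lambda>m. S x m + S y m)"
      using S(1)[OF that(1)] S(1)[OF that(2)] by (auto simp: hom_def res_add subspace_U subspace_add)
  qed (use S that subspace_U in \<open>auto simp: subspace_add\<close>)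
  have S_scale: "S (c *\<^sub>R x) N = c *\<^sub>R S x N" if "x \<in> U" for x c
  proof (rule uniq)
    show "hom (\<lambda>m. c *\<^sub>R S x m)"
      using S(1)[OF that(1)] by (auto simp: hom_def res_scale subspace_U subspace_scale)
  qed (use S that subspace_U in \<open>auto simp: subspace_scale\<close>)
  obtain p where p: "p 0 = 0" "\<forall>m\<le>N. p m \<in> U" "\<forall>m<N. \<forall>u\<in>U. res p m u = F m u"
    using march_exists[of 0 F, OF subspace_0[OF subspace_U] F] by metis
  have "\<exists>x\<in>U. \<forall>u\<in>U. inner (j x - \<Phi> (j (S x N))) (j u) = inner (\<xi> + \<Phi> (j (p N))) (j u)"
  proof (rule nondegenerate_form_solvable[OF finB U_span])
    show "linear_on_subspace U (\<lambda>x. inner (j x - \<Phi> (j (S x N))) (j u))" for u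
      unfolding linear_on_subspace_def
      by (simp add: S_add S_scale blinfun.add_right blinfun.scaleR_right inner_add inner_diff algebra_simps)
    show "linear_on_subspace U (\<lambda>u. inner (j x - \<Phi> (j (S x N))) (j u))" for x
      unfolding linear_on_subspace_def by (simp add: blinfun.add_right blinfun.scaleR_right inner_add)
    show "linear_on_subspace U (\<lambda>u. inner (\<xi> + \<Phi> (j (p N))) (j u))"
      unfolding linear_on_subspace_def by (simp add: blinfun.add_right blinfun.scaleR_right inner_add algebra_simps)
    show "x = 0" if x: "x \<in> U" and *: "\<And>u. u \<in> U \<Longrightarrow> inner (j x - \<Phi> (j (S x N))) (j u) = 0" for x
    proof -
      have "S x 0 = 0"
        by (rule homogeneous_scheme_zero[OF st]) (use S[OF x] * in \<open>auto simp: hom_def\<close>)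
      then show ?thesis using S(2)[OF x] by simp
    qed
  qed
  then obtain x where x: "x \<in> U" "\<And>u. u \<in> U \<Longrightarrow> inner (j x - \<Phi> (j (S x N))) (j u) = inner (\<xi> + \<Phi> (j (p N))) (j u)"
    by blast
  show ?thesis
  proof (intro exI[of _ "\<lambda>m. p m + S x m"] conjI allI impI ballI)
    show "p m + S x m \<in> U" if "m \<le> N" for m
      using p(2) S(1)[OF x(1)] that by (auto simp: hom_def subspace_U subspace_add)
    show "res (\<lambda>m. p m + S x m) m u = F m u" if "m < N" "u \<in> U" for m u
      using p(3) S(1)[OF x(1)] that by (simp add: hom_def res_add)
    show "inner (j (p 0 + S x 0) - \<Phi> (j (p N + S x N))) (j u) = inner \<xi> (j u)" if "u \<in> U" for u
      using x(2)[OF that] p(1) S(2)[OF x(1)]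
      by (simp add: blinfun.add_right inner_add inner_diff algebra_simps)
  qed
qed

lemma scheme_unique:
  assumes st: "stable K"
    and w: "\<forall>m\<le>N. w m \<in> U" "\<forall>m<N. \<forall>u\<in>U. res w m u = F m u"
      "\<forall>u\<in>U. inner (j (w 0) - \<Phi> (j (w N))) (j u) = inner \<xi> (j u)"
    and w': "\<forall>m\<le>N. w' m \<in> U" "\<forall>m<N. \<forall>u\<in>U. res w' m u = F m u"
      "\<forall>u\<in>U. inner (j (w' 0) - \<Phi> (j (w' N))) (j u) = inner \<xi> (j u)"
    and m: "m \<le> N"
  shows "w m = w' m"
proof -
  have "(\<lambda>m. w m - w' m) m = 0"
  proof (rule homogeneous_scheme_zero[OF st _ _ _ m])
    show "\<forall>u\<in>U. inner (j (w 0 - w' 0) - \<Phi> (j (w N - w' N))) (j u) = 0"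
    proof
      fix u assume "u \<in> U"
      then show "inner (j (w 0 - w' 0) - \<Phi> (j (w N - w' N))) (j u) = 0"
        using w(3)[rule_format, of u] w'(3)[rule_format, of u]
        by (simp add: blinfun.diff_right inner_diff)
    qed
  qed (use w w' in \<open>auto simp: res_diff subspace_U subspace_diff\<close>)
  then show ?thesis by simp
qed

end

section \<open>Integrals over the cells of the time grid\<close>

definition cell :: "real \<Rightarrow> nat \<Rightarrow> real set" where
  "cell k m = {real m * k..real (m + 1) * k}"

text \<open>The closed cells carry the integrals, as in the scheme, and overlap at the nodes. Values
  of step functions are prescribed on the open cells, because at the nodes such functions may take
  exceptional values.\<close>

definition open_cell :: "real \<Rightarrow> nat \<Rightarrow> real set" where
  "open_cell k m = {real m * k<..<real (m + 1) * k}"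

text \<open>Integrability of \<open>h\<close> is a conclusion: \<open>h\<close> may differ from the
  \<open>G m\<close> at the nodes, and the induction adds one cell at a time modulo its two end
  points.\<close>

lemma piecewise_integral:
  fixes h :: "real \<Rightarrow> real"
  assumes k: "0 \<le> k" and G: "\<And>m. m < N \<Longrightarrow> integrable (lebesgue_on (cell k m)) (G m)"
    and h: "\<And>m t. m < N \<Longrightarrow> t \<in> open_cell k m \<Longrightarrow> h t = G m t"
  shows "integrable (lebesgue_on {0..real N * k}) h
    \<and> (LINT t|lebesgue_on {0..real N * k}. h t) = (\<Sum>m<N. LINT t|lebesgue_on (cell k m). G m t)"
  using G h
proof (induction N)
  case 0
  have "h absolutely_integrable_on {0}" by (rule absolutely_integrable_negligible) simp
  then have i: "integrable (lebesgue_on {0}) h" by (rule absolutely_integrable_imp_integrable) simp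
  then show ?case using lebesgue_integral_eq_integral[OF i] by simp
next
  case (Suc N)
  let ?a = "real N * k" and ?b = "real (N + 1) * k"
  have IH: "integrable (lebesgue_on {0..?a}) h"
    "(LINT t|lebesgue_on {0..?a}. h t) = (\<Sum>m<N. LINT t|lebesgue_on (cell k m). G m t)"
    using Suc by auto
  have ab: "0 \<le> ?a" "?a \<le> ?b" using k by (auto simp: algebra_simps)
  have GN: "integrable (lebesgue_on {?a..?b}) (G N)" using Suc.prems(1)[of N] by (simp add: cell_def)
  have neg: "negligible {?a, ?b}" by simp
  have eq: "h t = G N t" if "t \<in> {?a..?b} - {?a, ?b}" for t
    using Suc.prems(2)[of N t] that by (auto simp: open_cell_def)
  have "G N absolutely_integrable_on {?a..?b}"
    using GN by (simp add: set_integrable_def integrable_restrict_space)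
  then have h2: "h absolutely_integrable_on {?a..?b}"
    by (rule absolutely_integrable_spike[OF _ neg]) (rule eq)
  have h1: "h absolutely_integrable_on {0..?a}"
    using IH(1) by (simp add: set_integrable_def integrable_restrict_space)
  have un: "{0..?a} \<union> {?a..?b} = {0..?b}" using ab by auto
  have h3: "h absolutely_integrable_on {0..?b}"
    using absolutely_integrable_Un[OF h1 h2] un by simp
  then have i3: "integrable (lebesgue_on {0..?b}) h" by (rule absolutely_integrable_imp_integrable) simp
  have i2: "integrable (lebesgue_on {?a..?b}) h" by (rule absolutely_integrable_imp_integrable[OF h2]) simp
  have "(LINT t|lebesgue_on {0..?b}. h t) = integral {0..?b} h"
    using lebesgue_integral_eq_integral[OF i3] by simp
  also have "\<dots> = integral {0..?a} h + integral {?a..?b} h"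
    using Henstock_Kurzweil_Integration.integral_combine[OF ab] h3 absolutely_integrable_on_def by metis
  also have "integral {0..?a} h = (LINT t|lebesgue_on {0..?a}. h t)"
    using lebesgue_integral_eq_integral[OF IH(1)] by simp
  also have "integral {?a..?b} h = integral {?a..?b} (G N)"
    by (rule integral_spike[OF neg]) (use eq in auto)
  also have "\<dots> = (LINT t|lebesgue_on (cell k N). G N t)"
    using lebesgue_integral_eq_integral[OF GN] by (simp add: cell_def)
  finally show ?case using i3 IH(2) by simp
qed

lemma cell_subset:
  assumes "0 \<le> k" "m < N"
  shows "cell k m \<subseteq> {0..real N * k}"
proof -
  have "real (m + 1) * k \<le> real N * k" using assms by (intro mult_right_mono) auto
  moreover have "0 \<le> real m * k" using assms by simp
  ultimately show ?thesis unfolding cell_def by (meson atLeastatMost_subset_iff)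
qed

lemma open_cell_subset:
  assumes "0 \<le> k" "m < N"
  shows "open_cell k m \<subseteq> {0<..<real N * k}"
proof -
  have "real (m + 1) * k \<le> real N * k" using assms by (intro mult_right_mono) auto
  moreover have "0 \<le> real m * k" using assms by simp
  ultimately show ?thesis unfolding open_cell_def by fastforce
qed

lemma integrable_on_cell:
  fixes h :: "real \<Rightarrow> real"
  assumes "integrable (lebesgue_on {0..real N * k}) h" "0 \<le> k" "m < N"
  shows "integrable (lebesgue_on (cell k m)) h"
  using integrable_subinterval[OF assms(1)] cell_subset[OF assms(2,3)] unfolding cell_def by blast

lemma open_cell_index: "0 < k \<Longrightarrow> t \<in> open_cell k m \<Longrightarrow> nat \<lfloor>t / k\<rfloor> = m"
proof -
  assume k: "0 < k" and t: "t \<in> open_cell k m"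
  then have "real m < t / k" "t / k < real m + 1"
    by (auto simp: open_cell_def pos_less_divide_eq pos_divide_less_eq algebra_simps)
  then have "\<lfloor>t / k\<rfloor> = int m" by (intro floor_unique) auto
  then show ?thesis by simp
qed

lemma integral_cell_const: "0 \<le> k \<Longrightarrow> (LINT t|lebesgue_on (cell k m). c) = k * (c::real)"
  by (simp add: cell_def lebesgue_integral_const measure_restrict_space algebra_simps)

lemma integrable_interval_const [simp]: "integrable (lebesgue_on {a..b::real}) (\<lambda>_. c::real)"
  by (rule absolutely_integrable_imp_integrable) auto

lemma integrable_cell_const [simp]: "integrable (lebesgue_on (cell k m)) (\<lambda>_. c::real)"
  by (simp add: cell_def)

section \<open>Measurability and integrability of superpositions\<close>

lemma borel_measurable_lebesgue_on_AE_limit: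
  fixes f :: "real \<Rightarrow> real"
  assumes s: "\<And>i::nat. s i \<in> borel_measurable (lebesgue_on S)" and S: "S \<in> sets lebesgue"
    and lim: "AE t in lebesgue_on S. (\<lambda>i. s i t) \<longlonglongrightarrow> f t"
  shows "f \<in> borel_measurable (lebesgue_on S)"
proof -
  obtain Z where Z: "{t \<in> space (lebesgue_on S). \<not> (\<lambda>i. s i t) \<longlonglongrightarrow> f t} \<subseteq> Z" "Z \<in> null_sets (lebesgue_on S)"
    using lim by (auto elim!: AE_E simp: null_sets_def)
  have Z': "Z \<in> sets (lebesgue_on S)" using Z(2) by auto
  \<comment> \<open>Setting all functions to zero on the exceptional set makes the convergence
    pointwise; afterwards the values of \<open>f\<close> on this negligible set are put back, which
    Lebesgue measurability tolerates.\<close>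
  have "(\<lambda>t. if t \<in> Z then 0 else f t) \<in> borel_measurable (lebesgue_on S)"
  proof (rule borel_measurable_LIMSEQ_metric)
    show "(\<lambda>t. if t \<in> Z then 0 else s i t) \<in> borel_measurable (lebesgue_on S)" for i
      using s Z' by (intro measurable_If_set) auto
    show "(\<lambda>i. if t \<in> Z then 0 else s i t) \<longlonglongrightarrow> (if t \<in> Z then 0 else f t)"
      if "t \<in> space (lebesgue_on S)" for t
      using Z(1) that by auto
  qed
  then have m: "(\<lambda>t. if t \<in> Z then 0 else f t) measurable_on S"
    using measurable_on_iff_borel_measurable[OF S] by blast
  have "negligible Z" using Z(2) S by (simp add: null_sets_restrict_space negligible_iff_null_sets)
  from measurable_on_spike[OF m this, of f] have "f measurable_on S" by simp
  then show ?thesis using measurable_on_iff_borel_measurable[OF S] by blast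
qed

text \<open>A Caratheodory argument: an approximating simple function takes finitely many values, so
  its composition only involves \<open>h\<close> at fixed vectors, and continuity in the vector
  passes to the limit. It applies to non-separable spaces.\<close>

lemma strongly_measurable_compose:
  fixes h :: "real \<Rightarrow> 'b::real_normed_vector \<Rightarrow> real"
  assumes f: "strongly_measurable (lebesgue_on S) f" and S: "S \<in> sets lebesgue"
    and h: "\<And>x. (\<lambda>t. h t x) \<in> borel_measurable (lebesgue_on S)"
    and cont: "AE t in lebesgue_on S. \<forall>X x. X \<longlonglongrightarrow> x \<longrightarrow> (\<lambda>i. h t (X i)) \<longlonglongrightarrow> h t x"
  shows "(\<lambda>t. h t (f t)) \<in> borel_measurable (lebesgue_on S)"
proof -
  obtain s where s: "\<And>i. simple_function (lebesgue_on S) (s i)"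
    "AE t in lebesgue_on S. (\<lambda>i. s i t) \<longlonglongrightarrow> f t"
    using f unfolding strongly_measurable_def by blast
  show ?thesis
  proof (rule borel_measurable_lebesgue_on_AE_limit[OF _ S])
    fix i
    let ?I = "s i ` space (lebesgue_on S)"
    have "countable ?I" using simple_functionD(1)[OF s(1)[of i]] by (rule countable_finite)
    moreover have "s i \<in> measurable (lebesgue_on S) (count_space ?I)"
      using measurable_simple_function[OF s(1)[of i]] by (auto simp: measurable_def)
    ultimately show "(\<lambda>t. h t (s i t)) \<in> borel_measurable (lebesgue_on S)"
      using measurable_compose_countable'[of ?I "\<lambda>x t. h t x"] h by blast
  next
    show "AE t in lebesgue_on S. (\<lambda>i. h t (s i t)) \<longlonglongrightarrow> h t (f t)"
      using s(2) cont by eventually_elim blast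
  qed
qed

text \<open>On an interval of finite measure, quadratic growth covers squared distances, bounded
  functionals and the form with one argument fixed alike.\<close>

lemma L2_integrable_compose:
  fixes h :: "real \<Rightarrow> 'b::real_normed_vector \<Rightarrow> real"
  assumes u: "u \<in> L2 T"
    and h: "\<And>x. (\<lambda>t. h t x) \<in> borel_measurable (lebesgue_on {0..T})"
    and cont: "AE t in lebesgue_on {0..T}. \<forall>X x. X \<longlonglongrightarrow> x \<longrightarrow> (\<lambda>i. h t (X i)) \<longlonglongrightarrow> h t x"
    and bound: "AE t in lebesgue_on {0..T}. \<forall>x. \<bar>h t x\<bar> \<le> c * (1 + (norm x)\<^sup>2)"
  shows "integrable (lebesgue_on {0..T}) (\<lambda>t. h t (u t))"
proof (rule Bochner_Integration.integrable_bound)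
  show "integrable (lebesgue_on {0..T}) (\<lambda>t. c * (1 + (norm (u t))\<^sup>2))"
    using u unfolding L2_def by (intro integrable_mult_right Bochner_Integration.integrable_add) auto
  show "(\<lambda>t. h t (u t)) \<in> borel_measurable (lebesgue_on {0..T})"
    by (rule strongly_measurable_compose[OF _ _ h cont]) (use u in \<open>auto simp: L2_def\<close>)
  show "AE t in lebesgue_on {0..T}. norm (h t (u t)) \<le> norm (c * (1 + (norm (u t))\<^sup>2))"
    using bound
  proof eventually_elim
    case (elim t)
    have "\<bar>h t (u t)\<bar> \<le> c * (1 + (norm (u t))\<^sup>2)" using elim by blast
    also have "\<dots> \<le> \<bar>c * (1 + (norm (u t))\<^sup>2)\<bar>" by (rule abs_ge_self)
    finally show ?case by simp
  qed
qed

lemma norm_le_one_plus_power2: "x \<le> 1 + x\<^sup>2" for x :: real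
  using zero_le_power2[of "x - 1/2"] by (simp add: power2_diff power2_eq_square algebra_simps)

lemma L2_integrable_norm_diff:
  assumes "u \<in> L2 T"
  shows "integrable (lebesgue_on {0..T}) (\<lambda>t. (norm (u t - x))\<^sup>2)"
proof (rule L2_integrable_compose[OF assms, of "\<lambda>_ y. (norm (y - x))\<^sup>2" "2 * (1 + (norm x)\<^sup>2)"])
  have "(norm (y - x))\<^sup>2 \<le> 2 * (1 + (norm x)\<^sup>2) * (1 + (norm y)\<^sup>2)" for y
  proof -
    have "(norm (y - x))\<^sup>2 \<le> (norm y + norm x)\<^sup>2" by (intro power_mono norm_triangle_ineq4) auto
    also have "\<dots> \<le> 2 * (norm y)\<^sup>2 + 2 * (norm x)\<^sup>2"
      using sum_squares_bound[of "norm y" "norm x"] by (simp add: power2_sum)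
    also have "\<dots> \<le> 2 * (1 + (norm x)\<^sup>2) * (1 + (norm y)\<^sup>2)" by (simp add: algebra_simps)
    finally show ?thesis .
  qed
  then show "AE t in lebesgue_on {0..T}. \<forall>y. \<bar>(norm (y - x))\<^sup>2\<bar> \<le> 2 * (1 + (norm x)\<^sup>2) * (1 + (norm y)\<^sup>2)"
    by simp
qed (auto intro!: tendsto_intros)

lemma L2_integrable_apply:
  fixes f :: "real \<Rightarrow> 'u::real_normed_vector \<Rightarrow>\<^sub>L real"
  assumes "f \<in> L2 T"
  shows "integrable (lebesgue_on {0..T}) (\<lambda>t. f t x)"
proof (rule L2_integrable_compose[OF assms, of "\<lambda>_ y. blinfun_apply y x" "norm x"])
  have "\<bar>blinfun_apply y x\<bar> \<le> norm x * (1 + (norm y)\<^sup>2)" for y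
  proof -
    have "\<bar>blinfun_apply y x\<bar> \<le> norm y * norm x" using norm_blinfun[of y x] by simp
    also have "\<dots> \<le> (1 + (norm y)\<^sup>2) * norm x"
      by (intro mult_right_mono norm_le_one_plus_power2) auto
    finally show ?thesis by (simp add: mult.commute)
  qed
  then show "AE t in lebesgue_on {0..T}. \<forall>y. \<bar>blinfun_apply y x\<bar> \<le> norm x * (1 + (norm y)\<^sup>2)" by simp
qed (auto intro!: tendsto_intros)

lemma L2_integrable_inner:
  fixes v :: "real \<Rightarrow> 'u::real_inner"
  assumes "v \<in> L2 T"
  shows "integrable (lebesgue_on {0..T}) (\<lambda>t. inner (v t) x)"
proof (rule L2_integrable_compose[OF assms, of "\<lambda>_ y. inner y x" "norm x"])
  have "\<bar>inner y x\<bar> \<le> norm x * (1 + (norm y)\<^sup>2)" for y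
  proof -
    have "\<bar>inner y x\<bar> \<le> norm y * norm x" by (rule Cauchy_Schwarz_ineq2)
    also have "\<dots> \<le> (1 + (norm y)\<^sup>2) * norm x"
      by (intro mult_right_mono norm_le_one_plus_power2) auto
    finally show ?thesis by (simp add: mult.commute)
  qed
  then show "AE t in lebesgue_on {0..T}. \<forall>y. \<bar>inner y x\<bar> \<le> norm x * (1 + (norm y)\<^sup>2)" by simp
qed (auto intro!: tendsto_intros)

text \<open>The bound on the form holds only for almost every t, so the continuity in the first
  argument that it implies is available only almost everywhere as well.\<close>

lemma L2_integrable_form:
  fixes u :: "real \<Rightarrow> 'u::{real_inner,complete_space}"
  assumes a: "admissible_form T a M \<alpha>" and u: "u \<in> L2 T"
  shows "integrable (lebesgue_on {0..T}) (\<lambda>t. a t (u t) x)"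
proof (rule L2_integrable_compose[OF u, of "\<lambda>t y. a t y x" "M * norm x"])
  have bd: "AE t in lebesgue_on {0..T}. \<forall>v w. \<bar>a t v w\<bar> \<le> M * norm v * norm w" and M: "1 \<le> M"
    using a unfolding admissible_form_def by auto
  show "(\<lambda>t. a t y x) \<in> borel_measurable (lebesgue_on {0..T})" for y
    using a unfolding admissible_form_def by blast
  show "AE t in lebesgue_on {0..T}. \<forall>y. \<bar>a t y x\<bar> \<le> M * norm x * (1 + (norm y)\<^sup>2)"
    using bd
  proof eventually_elim
    case (elim t)
    show ?case
    proof
      fix y
      have "\<bar>a t y x\<bar> \<le> M * norm y * norm x" using elim by blast
      also have "\<dots> = M * norm x * norm y" by simp
      also have "\<dots> \<le> M * norm x * (1 + (norm y)\<^sup>2)"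
        using M by (intro mult_left_mono norm_le_one_plus_power2) auto
      finally show "\<bar>a t y x\<bar> \<le> M * norm x * (1 + (norm y)\<^sup>2)" .
    qed
  qed
  have "AE t in lebesgue_on {0..T}. t \<in> {0..T}"
    by (rule AE_I2) simp
  with bd show "AE t in lebesgue_on {0..T}. \<forall>X y. X \<longlonglongrightarrow> y \<longrightarrow> (\<lambda>i. a t (X i) x) \<longlonglongrightarrow> a t y x"
  proof eventually_elim
    case (elim t)
    have bil: "bilinear (a t)" using a elim(2) unfolding admissible_form_def by blast
    show ?case
    proof (intro allI impI)
      fix X :: "nat \<Rightarrow> 'u" and y assume "X \<longlonglongrightarrow> y"
      then have "(\<lambda>i. X i - y) \<longlonglongrightarrow> 0" by (rule LIM_zero)
      then have lim0: "(\<lambda>i. M * norm (X i - y) * norm x) \<longlonglongrightarrow> 0"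
        by (intro tendsto_mult_left_zero tendsto_mult_right_zero tendsto_norm_zero)
      have "(\<lambda>i. a t (X i) x - a t y x) \<longlonglongrightarrow> 0"
      proof (rule Lim_null_comparison[OF always_eventually lim0], intro allI)
        show "norm (a t (X i) x - a t y x) \<le> M * norm (X i - y) * norm x" for i
          using elim(1) bilinear_lsub[OF bil] by (metis real_norm_def)
      qed
      then show "(\<lambda>i. a t (X i) x) \<longlonglongrightarrow> a t y x" by (rule LIM_zero_cancel)
    qed
  qed
qed

section \<open>Step functions on the time grid\<close>

lemma simple_function_floor: "0 < k \<Longrightarrow> simple_function (lebesgue_on {0..T}) (\<lambda>t. nat \<lfloor>t / k\<rfloor>)" for k T :: real
proof -
  assume k: "0 < k"
  have "(\<lambda>t. nat \<lfloor>t / k\<rfloor>) ` {0..T} \<subseteq> {..nat \<lfloor>T / k\<rfloor>}"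
    using k by (auto intro!: nat_mono floor_mono divide_right_mono)
  then have fin: "finite ((\<lambda>t. nat \<lfloor>t / k\<rfloor>) ` {0..T})" using finite_subset by blast
  have "(\<lambda>t::real. nat \<lfloor>t / k\<rfloor>) \<in> measurable lborel (count_space UNIV)" by measurable
  then have "(\<lambda>t::real. nat \<lfloor>t / k\<rfloor>) \<in> measurable lebesgue (count_space UNIV)"
    by (rule measurable_completion)
  then have "(\<lambda>t::real. nat \<lfloor>t / k\<rfloor>) \<in> measurable (lebesgue_on {0..T}) (count_space UNIV)"
    by (rule measurable_restrict_space1)
  then show ?thesis unfolding simple_function_eq_measurable using fin by simp
qed

text \<open>At the right end point N * k the index is N, one beyond the last cell; this affects only
  a null set.\<close>

definition piecewise_constant :: "real \<Rightarrow> (nat \<Rightarrow> 'a) \<Rightarrow> real \<Rightarrow> 'a" where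
  "piecewise_constant k p t = p (nat \<lfloor>t / k\<rfloor>)"

lemma piecewise_constant_open_cell:
  "0 < k \<Longrightarrow> t \<in> open_cell k m \<Longrightarrow> piecewise_constant k p t = p m"
  by (simp add: piecewise_constant_def open_cell_index)

lemma piecewise_constant_L2:
  fixes p :: "nat \<Rightarrow> 'a::real_normed_vector"
  assumes "0 < k"
  shows "piecewise_constant k p \<in> L2 (real N * k)"
    and "(L2_norm (real N * k) (piecewise_constant k p))\<^sup>2 = k * (\<Sum>m<N. (norm (p m))\<^sup>2)"
proof -
  have pi: "integrable (lebesgue_on {0..real N * k}) (\<lambda>t. (norm (piecewise_constant k p t))\<^sup>2) \<and>
    (LINT t|lebesgue_on {0..real N * k}. (norm (piecewise_constant k p t))\<^sup>2)
     = (\<Sum>m<N. LINT t|lebesgue_on (cell k m). (norm (p m))\<^sup>2)"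
    by (rule piecewise_integral) (use assms in \<open>auto simp: piecewise_constant_open_cell\<close>)
  have "simple_function (lebesgue_on {0..real N * k}) (piecewise_constant k p)"
    unfolding piecewise_constant_def[abs_def] using simple_function_floor[OF assms]
    by (rule simple_function_compose1)
  then have "strongly_measurable (lebesgue_on {0..real N * k}) (piecewise_constant k p)"
    unfolding strongly_measurable_def by (intro exI[of _ "\<lambda>_. piecewise_constant k p"]) simp
  then show "piecewise_constant k p \<in> L2 (real N * k)" unfolding L2_def using pi by simp
  show "(L2_norm (real N * k) (piecewise_constant k p))\<^sup>2 = k * (\<Sum>m<N. (norm (p m))\<^sup>2)"
    unfolding L2_norm_def using pi[unfolded integral_cell_const[OF less_imp_le[OF assms]]] assms
    by (simp add: sum_distrib_left sum_nonneg)
qed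

section \<open>Projections, step functions and forms on the cells\<close>

lemma integrable_cell_norm_diff:
  assumes "v \<in> L2 (real N * k)" "0 \<le> k" "m < N"
  shows "integrable (lebesgue_on (cell k m)) (\<lambda>t. (norm (v t - x))\<^sup>2)"
  using integrable_on_cell[OF L2_integrable_norm_diff[OF assms(1)] assms(2,3)] .

lemma L2_integral_cells:
  assumes k: "0 \<le> k" and h: "integrable (lebesgue_on {0..real N * k}) (h :: real \<Rightarrow> real)"
  shows "(LINT t|lebesgue_on {0..real N * k}. h t) = (\<Sum>m<N. LINT t|lebesgue_on (cell k m). h t)"
  using piecewise_integral[OF k integrable_on_cell[OF h k], of N h] by simp

lemma open_cell_nonempty: "0 < k \<Longrightarrow> \<exists>t. t \<in> open_cell k m"
  by (rule exI[of _ "(real m + 1/2) * k"]) (simp add: open_cell_def mult_strict_right_mono)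

text \<open>The projection is picked by choice and is fixed only up to null sets, so its values can
  come only from the orthogonality relations. A candidate built from cell averages shows that the
  choice succeeds; then the chosen function is shown to satisfy the same averaging relations on
  every cell.\<close>

lemma V_projection_cells:
  fixes v :: "real \<Rightarrow> 'u::{real_inner,complete_space}"
  assumes v: "v \<in> L2 T" and T: "T = real N * k" and k: "0 < k" and N: "1 \<le> N"
    and U: "finite B" "U = span B"
  shows "\<exists>p. (\<forall>m<N. p m \<in> U) \<and> (\<forall>m<N. \<forall>t\<in>open_cell k m. V_projection T U N v t = p m) \<and>
    (\<forall>m<N. \<forall>z\<in>U. k * inner (p m) z = (LINT t|lebesgue_on (cell k m). inner (v t) z))"
proof -
  have step_size_eq: "step_size T N = k" using T N by (simp add: step_size_def)
  have int: "integrable (lebesgue_on (cell k m)) (\<lambda>t. inner (v t) z)" if "m < N" for m z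
    using integrable_on_cell[OF L2_integrable_inner[OF v[unfolded T]] less_imp_le[OF k] that] .
  have inner_eq: "L2_inner T (\<lambda>t. v t - q t) z
      = (\<Sum>m<N. (LINT t|lebesgue_on (cell k m). inner (v t) (z' m)) - k * inner (q' m) (z' m))"
    if "\<And>m t. m < N \<Longrightarrow> t \<in> open_cell k m \<Longrightarrow> q t = q' m"
      "\<And>m t. m < N \<Longrightarrow> t \<in> open_cell k m \<Longrightarrow> z t = z' m" for q q' z z'
  proof -
    have "L2_inner T (\<lambda>t. v t - q t) z
      = (\<Sum>m<N. LINT t|lebesgue_on (cell k m). inner (v t) (z' m) - inner (q' m) (z' m))"
      unfolding L2_inner_def T
      by (rule piecewise_integral[THEN conjunct2])
        (use k int that in \<open>auto simp: inner_diff_left intro!: Bochner_Integration.integrable_diff\<close>)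
    also have "\<dots> = (\<Sum>m<N. (LINT t|lebesgue_on (cell k m). inner (v t) (z' m))
        - (LINT t|lebesgue_on (cell k m). inner (q' m) (z' m)))"
      by (intro sum.cong refl Bochner_Integration.integral_diff int integrable_cell_const) simp
    finally show ?thesis by (simp only: integral_cell_const[OF less_imp_le[OF k]])
  qed
  \<comment> \<open>The value on a cell is the projection onto U of the mean of \<open>v\<close>,
    defined weakly through Riesz so that no vector-valued integral has to be formed.\<close>
  have "\<exists>x\<in>U. \<forall>z\<in>U. inner x z = (LINT t|lebesgue_on (cell k m). inner (v t) z) / k" if "m < N" for m
    using Riesz_finite_span[OF U(1) linear_id, of "\<lambda>z. (LINT t|lebesgue_on (cell k m). inner (v t) z) / k"]
      int[OF that] U(2)
    by (simp add: linear_on_subspace_def inner_add_right Bochner_Integration.integral_add add_divide_distrib)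
  then obtain p0 where p0: "\<And>m. m < N \<Longrightarrow> p0 m \<in> U"
    "\<And>m z. m < N \<Longrightarrow> z \<in> U \<Longrightarrow> inner (p0 m) z = (LINT t|lebesgue_on (cell k m). inner (v t) z) / k"
    by metis
  define P where "P p \<longleftrightarrow> p \<in> V_discrete T U N \<and>
     (\<forall>z\<in>V_discrete T U N. L2_inner T (\<lambda>t. v t - p t) z = 0)" for p
  have V_cells: "\<exists>c. (\<forall>m<N. c m \<in> U) \<and> (\<forall>m<N. \<forall>t\<in>open_cell k m. z t = c m)"
    if "z \<in> V_discrete T U N" for z
  proof -
    have "\<forall>m<N. \<exists>c. \<forall>t\<in>open_cell k m. z t = c"
      using that unfolding V_discrete_def step_size_eq open_cell_def by blast
    then obtain c where c: "\<And>m t. m < N \<Longrightarrow> t \<in> open_cell k m \<Longrightarrow> z t = c m" by metis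
    \<comment> \<open>An open cell contains a time in (0,T), where membership in V_n puts the
      constant into U.\<close>
    moreover have "c m \<in> U" if "m < N" for m
    proof -
      obtain t where t: "t \<in> open_cell k m" using open_cell_nonempty[OF k] by blast
      then have "t \<in> {0<..<T}" using open_cell_subset[OF less_imp_le[OF k] that] T by blast
      then have "z t \<in> U" using \<open>z \<in> V_discrete T U N\<close> unfolding V_discrete_def by blast
      then show ?thesis using c[OF that t] by simp
    qed
    ultimately show ?thesis by blast
  qed
  have V_pc: "piecewise_constant k c \<in> V_discrete T U N" if "\<And>m. m < N \<Longrightarrow> c m \<in> U" for c
  proof -
    have "nat \<lfloor>t / k\<rfloor> < N" if "t \<in> {0<..<T}" for t
    proof -
      have "0 \<le> t / k" "t / k < real N" using that k T by (auto simp: pos_divide_less_eq)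
      then show ?thesis by linarith
    qed
    then have "\<forall>t\<in>{0<..<T}. piecewise_constant k c t \<in> U"
      using that by (simp add: piecewise_constant_def)
    moreover have "\<forall>m<N. \<exists>x. \<forall>t\<in>open_cell k m. piecewise_constant k c t = x"
      using piecewise_constant_open_cell[OF k] by blast
    ultimately show ?thesis unfolding V_discrete_def step_size_eq open_cell_def by blast
  qed
  have "P (piecewise_constant k p0)"
    unfolding P_def
  proof (intro conjI ballI)
    show "piecewise_constant k p0 \<in> V_discrete T U N" using V_pc p0(1) by blast
    fix z assume "z \<in> V_discrete T U N"
    then obtain c where c: "\<forall>m<N. c m \<in> U" "\<forall>m<N. \<forall>t\<in>open_cell k m. z t = c m"
      using V_cells by blast
    have "L2_inner T (\<lambda>t. v t - piecewise_constant k p0 t) z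
      = (\<Sum>m<N. (LINT t|lebesgue_on (cell k m). inner (v t) (c m)) - k * inner (p0 m) (c m))"
      by (rule inner_eq) (use c piecewise_constant_open_cell[OF k] in auto)
    also have "\<dots> = 0" using p0(2) c(1) k by (intro sum.neutral) simp
    finally show "L2_inner T (\<lambda>t. v t - piecewise_constant k p0 t) z = 0" .
  qed
  then have "P (V_projection T U N v)"
    unfolding V_projection_def P_def[symmetric] by (rule someI[of P])
  then have VP: "V_projection T U N v \<in> V_discrete T U N"
    "\<And>z. z \<in> V_discrete T U N \<Longrightarrow> L2_inner T (\<lambda>t. v t - V_projection T U N v t) z = 0"
    unfolding P_def by auto
  obtain p where p: "\<forall>m<N. p m \<in> U" "\<forall>m<N. \<forall>t\<in>open_cell k m. V_projection T U N v t = p m"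
    using V_cells[OF VP(1)] by blast
  have "k * inner (p m) z = (LINT t|lebesgue_on (cell k m). inner (v t) z)" if "m < N" "z \<in> U" for m z
  proof -
    \<comment> \<open>A test function living on the single cell m isolates the orthogonality
      relation there.\<close>
    define c where "c i = (if i = m then z else 0)" for i
    have "c i \<in> U" for i using that(2) U(2) by (auto simp: c_def span_zero)
    then have "0 = L2_inner T (\<lambda>t. v t - V_projection T U N v t) (piecewise_constant k c)"
      using VP(2) V_pc by metis
    also have "\<dots> = (\<Sum>i<N. (LINT t|lebesgue_on (cell k i). inner (v t) (c i)) - k * inner (p i) (c i))"
      by (rule inner_eq) (use p(2) piecewise_constant_open_cell[OF k] in auto)
    also have "\<dots> = (\<Sum>i<N. if i = m then (LINT t|lebesgue_on (cell k m). inner (v t) z) - k * inner (p m) z else 0)"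
      by (intro sum.cong) (auto simp: c_def)
    also have "\<dots> = (LINT t|lebesgue_on (cell k m). inner (v t) z) - k * inner (p m) z"
      using that(1) by simp
    finally show ?thesis by simp
  qed
  with p show ?thesis by blast
qed

text \<open>Bessel's inequality cell by cell: the pointwise bound of twice the inner product by the
  sum of the squared norms integrates to 2 * k * |p|^2 on the left and the integral of |v|^2 plus k
  * |p|^2 on the right.\<close>

lemma projection_norm_le:
  fixes v :: "real \<Rightarrow> 'u::real_inner"
  assumes v: "v \<in> L2 (real N * k)" and k: "0 < k"
    and p: "\<And>m. m < N \<Longrightarrow> k * inner (p m) (p m) = (LINT t|lebesgue_on (cell k m). inner (v t) (p m))"
  shows "k * (\<Sum>m<N. (norm (p m))\<^sup>2) \<le> (L2_norm (real N * k) v)\<^sup>2"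
proof -
  have iv: "integrable (lebesgue_on {0..real N * k}) (\<lambda>t. (norm (v t))\<^sup>2)"
    using v unfolding L2_def by simp
  have ic: "integrable (lebesgue_on (cell k m)) (\<lambda>t. (norm (v t))\<^sup>2)" if "m < N" for m
    using integrable_on_cell[OF iv less_imp_le[OF k] that] .
  have "k * (norm (p m))\<^sup>2 \<le> (LINT t|lebesgue_on (cell k m). (norm (v t))\<^sup>2)" if m: "m < N" for m
  proof -
    have "2 * (k * (norm (p m))\<^sup>2) = (LINT t|lebesgue_on (cell k m). 2 * inner (v t) (p m))"
      using p[OF m] by (simp add: power2_norm_eq_inner)
    also have "\<dots> \<le> (LINT t|lebesgue_on (cell k m). (norm (v t))\<^sup>2 + (norm (p m))\<^sup>2)"
    proof (rule integral_mono)
      show "integrable (lebesgue_on (cell k m)) (\<lambda>t. 2 * inner (v t) (p m))"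
        using integrable_on_cell[OF L2_integrable_inner[OF v] less_imp_le[OF k] m] by simp
      show "integrable (lebesgue_on (cell k m)) (\<lambda>t. (norm (v t))\<^sup>2 + (norm (p m))\<^sup>2)"
        using ic[OF m] by simp
      show "2 * inner (v t) (p m) \<le> (norm (v t))\<^sup>2 + (norm (p m))\<^sup>2" for t
        using zero_le_power2[of "norm (v t - p m)"]
        by (simp add: power2_norm_eq_inner inner_diff inner_commute)
    qed
    also have "\<dots> = (LINT t|lebesgue_on (cell k m). (norm (v t))\<^sup>2) + (LINT t|lebesgue_on (cell k m). (norm (p m))\<^sup>2)"
      by (rule Bochner_Integration.integral_add[OF ic[OF m] integrable_cell_const])
    also have "(LINT t|lebesgue_on (cell k m). (norm (p m))\<^sup>2) = k * (norm (p m))\<^sup>2"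
      by (rule integral_cell_const[OF less_imp_le[OF k]])
    finally show ?thesis by simp
  qed
  then have "(\<Sum>m<N. k * (norm (p m))\<^sup>2) \<le> (\<Sum>m<N. LINT t|lebesgue_on (cell k m). (norm (v t))\<^sup>2)"
    by (intro sum_mono) auto
  also have "\<dots> = (LINT t|lebesgue_on {0..real N * k}. (norm (v t))\<^sup>2)"
    by (rule L2_integral_cells[OF less_imp_le[OF k] iv, symmetric])
  also have "\<dots> = (L2_norm (real N * k) v)\<^sup>2" by (simp add: L2_norm_def)
  finally show ?thesis by (simp add: sum_distrib_left)
qed

section \<open>Nodal values, cell values and discrete derivatives\<close>

lemma step_function_node:
  assumes "step_size T N = k" "0 < k"
  shows "step_function T \<theta> N w (real m * k) = w m"
  using assms by (simp add: step_function_def)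

lemma step_function_open_cell:
  assumes "step_size T N = k" "0 < k" "t \<in> open_cell k m"
  shows "step_function T \<theta> N w t = \<theta> *\<^sub>R w (Suc m) + (1 - \<theta>) *\<^sub>R w m"
  using assms open_cell_index[OF assms(2,3)] by (simp add: step_function_def open_cell_def)

lemma discrete_derivative_step:
  fixes j :: "'u::{real_inner,complete_space} \<Rightarrow>\<^sub>L 'h::{real_inner,complete_space}"
  assumes T: "T = real N * k" and k: "0 < k" and N: "1 \<le> N"
    and p: "\<And>m t. m < N \<Longrightarrow> t \<in> open_cell k m \<Longrightarrow> V_projection T U N v t = p m"
  shows "discrete_derivative T j U N (step_function T \<theta> N w) v
    = (\<Sum>m<N. inner (j (w (Suc m) - w m)) (j (p m)))"
proof -
  have step_size_eq: "step_size T N = k" using T N by (simp add: step_size_def)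
  have dq: "difference_quotient T N (step_function T \<theta> N w) t = (w (Suc m) - w m) /\<^sub>R k"
    if "t \<in> open_cell k m" for m t
    using open_cell_index[OF k that] step_function_node[OF step_size_eq k, of \<theta> w "Suc m"]
      step_function_node[OF step_size_eq k, of \<theta> w m]
    by (simp add: difference_quotient_def step_size_eq)
  have "discrete_derivative T j U N (step_function T \<theta> N w) v
    = (\<Sum>m<N. LINT t|lebesgue_on (cell k m). inner (j ((w (Suc m) - w m) /\<^sub>R k)) (j (p m)))"
    unfolding discrete_derivative_def L2_inner_def T
    by (rule piecewise_integral[THEN conjunct2])
      (use k p dq in \<open>auto simp: T\<close>)
  also have "\<dots> = (\<Sum>m<N. inner (j (w (Suc m) - w m)) (j (p m)))"
    by (intro sum.cong refl, subst integral_cell_const[OF less_imp_le[OF k]])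
      (use k in \<open>simp add: blinfun.scaleR_right\<close>)
  finally show ?thesis .
qed

lemma AE_lebesgue_on_subset:
  assumes "AE t in lebesgue_on S. P t" "S' \<subseteq> S" "S \<in> sets lebesgue" "S' \<in> sets lebesgue"
  shows "AE t in lebesgue_on S'. P t"
proof -
  have "AE t in lebesgue. t \<in> S \<longrightarrow> P t" using assms(1,3) by (simp add: AE_restrict_space_iff)
  then have "AE t in lebesgue. t \<in> S' \<longrightarrow> P t" by eventually_elim (use assms(2) in blast)
  then show ?thesis using assms(4) by (simp add: AE_restrict_space_iff)
qed

definition cell_form :: "(real \<Rightarrow> 'u \<Rightarrow> 'u \<Rightarrow> real) \<Rightarrow> real \<Rightarrow> nat \<Rightarrow> 'u \<Rightarrow> 'u \<Rightarrow> real" where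
  "cell_form a k m x y = (LINT t|lebesgue_on (cell k m). a t x y)"

lemma sets_cell [simp]: "cell k m \<in> sets lebesgue"
  by (simp add: cell_def)

lemma cell_form_properties:
  fixes a :: "real \<Rightarrow> 'u::{real_inner,complete_space} \<Rightarrow> 'u \<Rightarrow> real"
  assumes a: "admissible_form (real N * k) a M \<alpha>" and k: "0 < k" and m: "m < N"
  shows integrable_cell_form: "integrable (lebesgue_on (cell k m)) (\<lambda>t. a t x y)"
    and bilinear_cell_form: "bilinear (cell_form a k m)"
    and cell_form_le: "\<bar>cell_form a k m x y\<bar> \<le> k * M * norm x * norm y"
    and cell_form_ge: "k * \<alpha> * (norm x)\<^sup>2 \<le> cell_form a k m x x"
proof -
  have k0: "0 \<le> k" using k by simp
  note sub = cell_subset[OF k0 m]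
  have int: "integrable (lebesgue_on (cell k m)) (\<lambda>t. a t x y)" for x y
  proof -
    \<comment> \<open>A constant is a step function, so the integrability result for elements of V
      applies to it.\<close>
    have "(\<lambda>_. x) \<in> L2 (real N * k)"
      using piecewise_constant_L2(1)[OF k, of "\<lambda>_. x" N] by (simp add: piecewise_constant_def[abs_def])
    from integrable_on_cell[OF L2_integrable_form[OF a this] k0 m] show ?thesis .
  qed
  then show "integrable (lebesgue_on (cell k m)) (\<lambda>t. a t x y)" .
  have bil: "bilinear (a t)" if "t \<in> cell k m" for t
    using a that sub unfolding admissible_form_def by blast
  show "bilinear (cell_form a k m)"
    unfolding bilinear_def
  proof (intro conjI allI linearI)
    fix x y z and c :: real
    have "cell_form a k m x (y + z) = (LINT t|lebesgue_on (cell k m). a t x y + a t x z)"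
      unfolding cell_form_def by (rule Bochner_Integration.integral_cong) (auto simp: bilinear_radd[OF bil])
    then show "cell_form a k m x (y + z) = cell_form a k m x y + cell_form a k m x z"
      by (simp add: cell_form_def int)
    have "cell_form a k m (x + y) z = (LINT t|lebesgue_on (cell k m). a t x z + a t y z)"
      unfolding cell_form_def by (rule Bochner_Integration.integral_cong) (auto simp: bilinear_ladd[OF bil])
    then show "cell_form a k m (x + y) z = cell_form a k m x z + cell_form a k m y z"
      by (simp add: cell_form_def int)
    have "cell_form a k m x (c *\<^sub>R y) = (LINT t|lebesgue_on (cell k m). c * a t x y)"
      unfolding cell_form_def by (rule Bochner_Integration.integral_cong) (auto simp: bilinear_rmul[OF bil])
    then show "cell_form a k m x (c *\<^sub>R y) = c *\<^sub>R cell_form a k m x y" by (simp add: cell_form_def)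
    have "cell_form a k m (c *\<^sub>R x) y = (LINT t|lebesgue_on (cell k m). c * a t x y)"
      unfolding cell_form_def by (rule Bochner_Integration.integral_cong) (auto simp: bilinear_lmul[OF bil])
    then show "cell_form a k m (c *\<^sub>R x) y = c *\<^sub>R cell_form a k m x y" by (simp add: cell_form_def)
  qed
  have "\<bar>cell_form a k m x y\<bar> \<le> (LINT t|lebesgue_on (cell k m). \<bar>a t x y\<bar>)"
    unfolding cell_form_def by (rule integral_abs_bound)
  also have "\<dots> \<le> (LINT t|lebesgue_on (cell k m). M * norm x * norm y)"
  proof (rule integral_mono_AE)
    have "AE t in lebesgue_on {0..real N * k}. \<forall>v w. \<bar>a t v w\<bar> \<le> M * norm v * norm w"
      using a unfolding admissible_form_def by blast
    then have "AE t in lebesgue_on (cell k m). \<forall>v w. \<bar>a t v w\<bar> \<le> M * norm v * norm w"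
      by (rule AE_lebesgue_on_subset[OF _ sub]) auto
    then show "AE t in lebesgue_on (cell k m). \<bar>a t x y\<bar> \<le> M * norm x * norm y"
      by eventually_elim blast
  qed (use int in auto)
  also have "\<dots> = k * (M * norm x * norm y)" by (rule integral_cell_const[OF k0])
  finally show "\<bar>cell_form a k m x y\<bar> \<le> k * M * norm x * norm y" by (simp add: mult.assoc)
  have "k * (\<alpha> * (norm x)\<^sup>2) = (LINT t|lebesgue_on (cell k m). \<alpha> * (norm x)\<^sup>2)"
    by (rule integral_cell_const[OF k0, symmetric])
  also have "\<dots> \<le> (LINT t|lebesgue_on (cell k m). a t x x)"
    by (rule integral_mono[OF integrable_cell_const int])
      (use a sub in \<open>auto simp: admissible_form_def\<close>)
  finally show "k * \<alpha> * (norm x)\<^sup>2 \<le> cell_form a k m x x" by (simp add: cell_form_def mult.assoc)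
qed

section \<open>The theta-method\<close>

text \<open>Equivalence of norms on the finite dimensional U bounds the quotients; the supremum of
  an unbounded set of reals would be unspecified.\<close>

lemma inverse_constant_bound:
  fixes j :: "'u::{real_inner,complete_space} \<Rightarrow>\<^sub>L 'h::{real_inner,complete_space}"
  assumes U: "finite B" "U = span B" and inj: "\<And>x. j x = 0 \<Longrightarrow> x = 0" and "U \<noteq> {0}"
  shows "0 < inverse_constant j U" and "u \<in> U \<Longrightarrow> norm u \<le> inverse_constant j U * norm (j u)"
proof -
  obtain C where C: "\<And>x. x \<in> U \<Longrightarrow> norm x \<le> C * norm (j x)"
    using finite_span_norm_le[OF U(1) blinfun.bounded_linear_right[THEN bounded_linear.linear], of j] inj U(2)
    by blast
  have pos: "0 < norm (j u)" if "u \<noteq> 0" for u using inj that by auto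
  have bdd: "bdd_above ((\<lambda>u. norm u / norm (j u)) ` (U - {0}))"
  proof (rule bdd_aboveI2)
    fix u assume "u \<in> U - {0}"
    then show "norm u / norm (j u) \<le> C" using C pos by (simp add: pos_divide_le_eq)
  qed
  have le: "norm u / norm (j u) \<le> inverse_constant j U" if "u \<in> U" "u \<noteq> 0" for u
    unfolding inverse_constant_def using that bdd by (intro cSUP_upper) auto
  have "0 \<in> U" using U(2) by (simp add: span_zero)
  with \<open>U \<noteq> {0}\<close> obtain u0 where u0: "u0 \<in> U" "u0 \<noteq> 0" by blast
  have "0 < norm u0 / norm (j u0)" using u0 pos by simp
  with le[OF u0] show "0 < inverse_constant j U" by linarith
  show "norm u \<le> inverse_constant j U * norm (j u)" if "u \<in> U"
    using le[OF that] pos by (cases "u = 0") (auto simp: pos_divide_le_eq)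
qed

text \<open>Recovers a product from Young's inequality with all weights: s = b / a is optimal if
  both numbers are positive, and if exactly one vanishes the weight is chosen to yield x \<le> x /
  2.\<close>

lemma le_mult_of_le_weighted:
  fixes x a b :: real
  assumes ab: "0 \<le> a" "0 \<le> b" and le: "\<And>s. 0 < s \<Longrightarrow> x \<le> (s * a\<^sup>2 + b\<^sup>2 / s) / 2"
  shows "x \<le> a * b"
proof (rule ccontr)
  assume "\<not> x \<le> a * b"
  then have x: "a * b < x" by simp
  then have x0: "0 < x" using ab by (smt (verit) mult_nonneg_nonneg)
  consider "0 < a" "0 < b" | "a = 0" "b = 0" | "a = 0" "0 < b" | "0 < a" "b = 0" using ab by linarith
  then show False
  proof cases
    case 1
    then show ?thesis using le[of "b / a"] x by (simp add: power2_eq_square)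
  next
    case 2
    then show ?thesis using le[of 1] x by simp
  next
    case 3
    then show ?thesis using le[of "b\<^sup>2 / x"] x x0 by simp
  next
    case 4
    then show ?thesis using le[of "x / a\<^sup>2"] x x0 by simp
  qed
qed

locale theta_method =
  fixes T :: real and j :: "'u::{real_inner,complete_space} \<Rightarrow>\<^sub>L 'h::{real_inner,complete_space}"
    and C\<^sub>H and a and M \<alpha> :: real and \<Phi> and \<theta> and U :: "'u set" and N :: nat
  assumes set: "setting T j C\<^sub>H a M \<alpha> \<Phi>" and disc: "discretisation T j M \<alpha> \<theta> U N"
begin

definition "k = step_size T N"
definition "B = (SOME B. finite B \<and> U = span B)"

lemma N_ge: "1 \<le> N" and T_pos: "0 < T" and k_pos: "0 < k" and T_eq: "T = real N * k"
  using set disc by (auto simp: setting_def discretisation_def k_def step_size_def)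

lemma step_size_eq: "step_size T N = k" by (simp add: k_def)

lemma finite_B: "finite B" and U_eq: "U = span B"
proof -
  have "\<exists>B. finite B \<and> U = span B" using disc by (auto simp: discretisation_def)
  from someI_ex[OF this] show "finite B" "U = span B" unfolding B_def by auto
qed

lemma L2_k: "f \<in> L2 T \<Longrightarrow> f \<in> L2 (real N * k)"
  by (subst T_eq[symmetric])

lemma adm: "admissible_form (real N * k) a M \<alpha>"
  by (subst T_eq[symmetric]) (use set in \<open>simp add: setting_def\<close>)

lemma j_inj: "j x = 0 \<Longrightarrow> x = 0"
  using set by (metis blinfun.zero_right dense_embedding_def injD setting_def)

lemma U_nontrivial: "U \<noteq> {0}"
  using disc by (simp add: discretisation_def)

text \<open>Coercivity and boundedness are compared at a nonzero vector of U, after integration over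
  a cell because the upper bound holds only almost everywhere.\<close>

lemma \<alpha>_le_M: "\<alpha> \<le> M"
proof -
  have "0 \<in> U" using disc by (simp add: discretisation_def subspace_0)
  with U_nontrivial obtain u where u: "u \<in> U" "u \<noteq> 0" by blast
  have "k * \<alpha> * (norm u)\<^sup>2 \<le> k * M * norm u * norm u"
    using cell_form_ge[OF adm k_pos, of 0 u] cell_form_le[OF adm k_pos, of 0 u u] N_ge by simp
  then have "(k * \<alpha>) * (norm u)\<^sup>2 \<le> (k * M) * (norm u)\<^sup>2" by (simp add: power2_eq_square mult.assoc)
  then have "k * \<alpha> \<le> k * M" using u by (simp add: mult_le_cancel_right)
  then show ?thesis using k_pos by simp
qed

sublocale dp: discrete_problem j "cell_form a k" \<Phi> B U N k M \<alpha> \<theta>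
proof
  show "1 \<le> M" "0 < \<alpha>" using adm by (auto simp: admissible_form_def)
  show "0 \<le> \<theta>" "\<theta> \<le> 1" using disc by (auto simp: discretisation_def)
  show "norm \<Phi> \<le> 1" using set by (simp add: setting_def)
  show "U = span B" by (rule U_eq)
qed (use finite_B j_inj k_pos \<alpha>_le_M N_ge bilinear_cell_form[OF adm k_pos]
    cell_form_le[OF adm k_pos] cell_form_ge[OF adm k_pos] in auto)

lemma scheme_iff:
  "theta_scheme T j a \<Phi> \<theta> U N f \<xi> w \<longleftrightarrow> (\<forall>m\<le>N. w m \<in> U) \<and>
     (\<forall>m<N. \<forall>u\<in>U. dp.res w m u = (LINT t|lebesgue_on (cell k m). f t u)) \<and>
     (\<forall>u\<in>U. inner (j (w 0) - \<Phi> (j (w N))) (j u) = inner \<xi> (j u))"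
proof -
  have *: "inner (j ((w (m + 1) - w m) /\<^sub>R k)) (j u)
        + 1 / k * (LINT t|lebesgue_on {real m * k..real (m + 1) * k}. a t (\<theta> *\<^sub>R w (m + 1) + (1 - \<theta>) *\<^sub>R w m) u)
        = 1 / k * (LINT t|lebesgue_on {real m * k..real (m + 1) * k}. blinfun_apply (f t) u)
      \<longleftrightarrow> dp.res w m u = (LINT t|lebesgue_on (cell k m). f t u)" for m u
  proof -
    have "inner (j ((w (m + 1) - w m) /\<^sub>R k)) (j u) = inner (j (w (Suc m) - w m)) (j u) / k"
      by (simp add: blinfun.scaleR_right divide_inverse mult.commute)
    then show ?thesis
      unfolding dp.res_def dp.mid_def cell_form_def cell_def using k_pos
      by (simp add: add_divide_distrib[symmetric])
  qed
  show ?thesis unfolding theta_scheme_def Let_def step_size_eq * by blast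
qed

text \<open>The scheme determines only the values up to N, so uniqueness refers to families
  normalised beyond N.\<close>

lemma scheme_ex1:
  assumes st: "dp.stable K" and f: "f \<in> L2 T"
  shows "\<exists>!w. w \<in> {..N} \<rightarrow>\<^sub>E U \<and> theta_scheme T j a \<Phi> \<theta> U N f \<xi> w"
proof -
  define F where "F m u = (LINT t|lebesgue_on (cell k m). f t u)" for m u
  have lin: "linear_on_subspace U (F m)" if "m < N" for m
  proof -
    have "integrable (lebesgue_on (cell k m)) (\<lambda>t. f t u)" for u
      using integrable_on_cell[OF L2_integrable_apply[OF L2_k[OF f]] _ that] k_pos by simp
    then show ?thesis unfolding F_def linear_on_subspace_def
      by (simp add: blinfun.add_right blinfun.scaleR_right)
  qed
  note iff = scheme_iff[of f \<xi>, folded F_def]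
  obtain w where w: "theta_scheme T j a \<Phi> \<theta> U N f \<xi> w"
    unfolding iff using dp.scheme_exists[where \<xi>=\<xi> and F=F, OF st lin] by blast
  have r: "dp.res (restrict w {..N}) m u = dp.res w m u" if "m < N" for m u
    using that by (simp add: dp.res_def dp.mid_def)
  show ?thesis
  proof (rule ex1I[of _ "restrict w {..N}"])
    show "restrict w {..N} \<in> {..N} \<rightarrow>\<^sub>E U \<and> theta_scheme T j a \<Phi> \<theta> U N f \<xi> (restrict w {..N})"
      using w r unfolding iff by auto
    fix w' assume w': "w' \<in> {..N} \<rightarrow>\<^sub>E U \<and> theta_scheme T j a \<Phi> \<theta> U N f \<xi> w'"
    have "w' m = w m" if "m \<le> N" for m
      by (rule dp.scheme_unique[where F=F and \<xi>=\<xi>, OF st _ _ _ _ _ _ that]) (use w w' in \<open>simp_all add: iff\<close>)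
    then show "w' = restrict w {..N}"
      using w' by (intro extensionalityI[of _ "{..N}"]) (auto simp: PiE_iff)
  qed
qed

end

section \<open>Consistency\<close>

context theta_method
begin

definition err :: "(real \<Rightarrow> 'u \<Rightarrow>\<^sub>L real) \<Rightarrow> (nat \<Rightarrow> 'u) \<Rightarrow> (real \<Rightarrow> 'u) \<Rightarrow> real" where
  "err u' w v = pairing T u' v - discrete_derivative T j U N (step_function T \<theta> N w) v"

lemma k_nonneg: "0 \<le> k"
  using k_pos by simp

lemma interval_eq: "{0..T} = {0..real N * k}"
  using T_eq by (rule arg_cong)

lemma piecewise_constant_in_L2: "piecewise_constant k (v :: nat \<Rightarrow> 'b::real_normed_vector) \<in> L2 T"
  by (subst T_eq) (rule piecewise_constant_L2(1)[OF k_pos])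

lemma L2_norm_piecewise_constant:
  "(L2_norm T (piecewise_constant k (v :: nat \<Rightarrow> 'b::real_normed_vector)))\<^sup>2 = k * (\<Sum>m<N. (norm (v m))\<^sup>2)"
  by (subst T_eq) (rule piecewise_constant_L2(2)[OF k_pos])

lemma projection_exists:
  assumes "v \<in> L2 T"
  obtains p where "\<And>m. m < N \<Longrightarrow> p m \<in> U"
    "\<And>m t. m < N \<Longrightarrow> t \<in> open_cell k m \<Longrightarrow> V_projection T U N v t = p m"
    "\<And>m z. m < N \<Longrightarrow> z \<in> U \<Longrightarrow> k * inner (p m) z = (LINT t|lebesgue_on (cell k m). inner (v t) z)"
  using V_projection_cells[OF assms T_eq k_pos N_ge finite_B U_eq] by metis

lemma projection_norm:
  assumes v: "v \<in> L2 T" and p: "\<And>m. m < N \<Longrightarrow> p m \<in> U"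
    "\<And>m z. m < N \<Longrightarrow> z \<in> U \<Longrightarrow> k * inner (p m) z = (LINT t|lebesgue_on (cell k m). inner (v t) z)"
  shows "k * (\<Sum>m<N. (norm (p m))\<^sup>2) \<le> (L2_norm T v)\<^sup>2"
  by (subst T_eq) (rule projection_norm_le[OF L2_k[OF v] k_pos p(2)[OF _ p(1)]])

lemma integral_open_cell_cong:
  fixes h :: "real \<Rightarrow> real"
  assumes "m < N" "\<And>t. t \<in> open_cell k m \<Longrightarrow> h t = c"
  shows "(LINT t|lebesgue_on (cell k m). h t) = k * c"
proof -
  let ?a = "real m * k" and ?b = "real (m + 1) * k"
  have neg: "negligible {?a, ?b}" by simp
  have eq: "h t = c" if "t \<in> {?a..?b} - {?a, ?b}" for t
    using assms(2)[of t] that by (auto simp: open_cell_def)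
  have "(\<lambda>_. c) absolutely_integrable_on {?a..?b}" by auto
  then have "h absolutely_integrable_on {?a..?b}"
    by (rule absolutely_integrable_spike[OF _ neg]) (rule eq)
  then have i: "integrable (lebesgue_on {?a..?b}) h" by (rule absolutely_integrable_imp_integrable) simp
  have "(LINT t|lebesgue_on (cell k m). h t) = integral {?a..?b} h"
    using lebesgue_integral_eq_integral[OF i] by (simp add: cell_def)
  also have "\<dots> = integral {?a..?b} (\<lambda>_. c)"
    by (rule integral_spike[OF neg]) (use eq in auto)
  also have "\<dots> = (?b - ?a) * c" using k_pos by (simp add: mult_right_mono)
  finally show ?thesis by (simp add: algebra_simps)
qed

text \<open>On each cell the difference of the projected and the given value lies in U, so it may be
  tested against itself. This makes \<open>err\<close> explicit on V_n.\<close>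

lemma V_projection_piecewise_constant:
  assumes v: "\<And>m. m < N \<Longrightarrow> v m \<in> U" and m: "m < N" "t \<in> open_cell k m"
  shows "V_projection T U N (piecewise_constant k v) t = v m"
proof -
  obtain p where p: "\<And>m. m < N \<Longrightarrow> p m \<in> U"
    "\<And>m t. m < N \<Longrightarrow> t \<in> open_cell k m \<Longrightarrow> V_projection T U N (piecewise_constant k v) t = p m"
    "\<And>m z. m < N \<Longrightarrow> z \<in> U \<Longrightarrow> k * inner (p m) z = (LINT t|lebesgue_on (cell k m). inner (piecewise_constant k v t) z)"
    using projection_exists[OF piecewise_constant_in_L2[of v]] by metis
  have d: "p m - v m \<in> U" using p(1)[OF m(1)] v[OF m(1)] dp.subspace_U by (rule subspace_diff[rotated])
  have "k * inner (p m) (p m - v m) = k * inner (v m) (p m - v m)"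
    unfolding p(3)[OF m(1) d]
    by (rule integral_open_cell_cong[OF m(1)]) (simp add: piecewise_constant_open_cell[OF k_pos])
  then have "inner (p m - v m) (p m - v m) = 0" using k_pos by (simp add: inner_diff_left)
  then show ?thesis using p(2)[OF m] by simp
qed

lemma pairing_piecewise_constant:
  fixes f :: "real \<Rightarrow> 'u \<Rightarrow>\<^sub>L real"
  assumes f: "f \<in> L2 T"
  shows "pairing T f (piecewise_constant k v) = (\<Sum>m<N. LINT t|lebesgue_on (cell k m). f t (v m))"
  unfolding pairing_def interval_eq
  by (rule piecewise_integral[THEN conjunct2, OF k_nonneg
      integrable_on_cell[OF L2_integrable_apply[OF L2_k[OF f]] k_nonneg]])
    (auto simp: piecewise_constant_open_cell[OF k_pos])

lemma integrable_cell_form_L2: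
  assumes u: "u \<in> L2 T" and m: "m < N"
  shows "integrable (lebesgue_on (cell k m)) (\<lambda>t. a t (u t) x)"
  by (rule integrable_on_cell[OF L2_integrable_form[OF adm L2_k[OF u]] k_nonneg m])

lemma form_op_piecewise_constant:
  assumes u: "u \<in> L2 T"
  shows "form_op T a u (piecewise_constant k v) = (\<Sum>m<N. LINT t|lebesgue_on (cell k m). a t (u t) (v m))"
  unfolding form_op_def interval_eq
  by (rule piecewise_integral[THEN conjunct2, OF k_nonneg integrable_cell_form_L2[OF u]])
    (auto simp: piecewise_constant_open_cell[OF k_pos])

lemma discrete_derivative_eq:
  assumes "\<And>m t. m < N \<Longrightarrow> t \<in> open_cell k m \<Longrightarrow> V_projection T U N v t = p m"
  shows "discrete_derivative T j U N (step_function T \<theta> N w) v = (\<Sum>m<N. inner (j (w (Suc m) - w m)) (j (p m)))"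
  by (rule discrete_derivative_step[OF T_eq k_pos N_ge assms])

lemma err_piecewise_constant:
  assumes u': "u' \<in> L2 T" and v: "\<And>m. m < N \<Longrightarrow> v m \<in> U"
  shows "err u' w (piecewise_constant k v) =
    (\<Sum>m<N. (LINT t|lebesgue_on (cell k m). u' t (v m)) - inner (j (w (Suc m) - w m)) (j (v m)))"
proof -
  have "discrete_derivative T j U N (step_function T \<theta> N w) (piecewise_constant k v)
    = (\<Sum>m<N. inner (j (w (Suc m) - w m)) (j (v m)))"
    by (rule discrete_derivative_eq) (rule V_projection_piecewise_constant[where v=v, OF v])
  then show ?thesis by (simp add: err_def pairing_piecewise_constant[OF u'] sum_subtractf)
qed

text \<open>A crude bound, whose purpose is to show that a dual norm is the supremum of a bounded
  set.\<close>

lemma abs_pairing_le: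
  fixes u' :: "real \<Rightarrow> 'u \<Rightarrow>\<^sub>L real"
  assumes u': "u' \<in> L2 T" and v: "v \<in> L2 T"
  shows "\<bar>pairing T u' v\<bar> \<le> (L2_norm T u')\<^sup>2 + (L2_norm T v)\<^sup>2"
proof (cases "integrable (lebesgue_on {0..T}) (\<lambda>t. u' t (v t))")
  case True
  have i: "integrable (lebesgue_on {0..T}) (\<lambda>t. (norm (u' t))\<^sup>2)" "integrable (lebesgue_on {0..T}) (\<lambda>t. (norm (v t))\<^sup>2)"
    using u' v unfolding L2_def by auto
  have "\<bar>pairing T u' v\<bar> \<le> (LINT t|lebesgue_on {0..T}. \<bar>u' t (v t)\<bar>)"
    unfolding pairing_def by (rule integral_abs_bound)
  also have "\<dots> \<le> (LINT t|lebesgue_on {0..T}. (norm (u' t))\<^sup>2 + (norm (v t))\<^sup>2)"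
  proof (rule integral_mono)
    show "\<bar>u' t (v t)\<bar> \<le> (norm (u' t))\<^sup>2 + (norm (v t))\<^sup>2" for t
    proof -
      have "\<bar>u' t (v t)\<bar> \<le> norm (u' t) * norm (v t)" using norm_blinfun[of "u' t" "v t"] by simp
      also have "\<dots> \<le> (norm (u' t))\<^sup>2 + (norm (v t))\<^sup>2"
        using sum_squares_bound[of "norm (u' t)" "norm (v t)"]
          mult_nonneg_nonneg[OF norm_ge_zero[of "u' t"] norm_ge_zero[of "v t"]] by linarith
      finally show ?thesis .
    qed
  qed (use True i in auto)
  also have "\<dots> = (L2_norm T u')\<^sup>2 + (L2_norm T v)\<^sup>2" unfolding L2_norm_def using i by simp
  finally show ?thesis .
\<comment> \<open>An integral that does not exist has the default value 0, which satisfies the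
  bound.\<close>
qed (simp add: pairing_def not_integrable_integral_eq)

text \<open>Needed to give the real supremum in \<open>dual_norm\<close> its meaning. Since the
  bound may depend on k and w, it is enough that the projection of a unit vector has all its values
  at most 1 + 1 / k in norm.\<close>

lemma err_bdd_above:
  assumes u': "u' \<in> L2 T"
  shows "bdd_above {\<bar>err u' w v\<bar> | v. v \<in> L2 T \<and> L2_norm T v \<le> 1}"
proof -
  have "\<bar>err u' w v\<bar> \<le> (L2_norm T u')\<^sup>2 + 1 + (\<Sum>m<N. norm (j (w (Suc m) - w m)) * (norm j * (1 + 1 / k)))"
    if v: "v \<in> L2 T" "L2_norm T v \<le> 1" for v
  proof -
    obtain p where p: "\<And>m. m < N \<Longrightarrow> p m \<in> U"
      "\<And>m t. m < N \<Longrightarrow> t \<in> open_cell k m \<Longrightarrow> V_projection T U N v t = p m"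
      "\<And>m z. m < N \<Longrightarrow> z \<in> U \<Longrightarrow> k * inner (p m) z = (LINT t|lebesgue_on (cell k m). inner (v t) z)"
      using projection_exists[OF v(1)] by metis
    have n0: "0 \<le> L2_norm T v" by (simp add: L2_norm_def)
    have n1: "(L2_norm T v)\<^sup>2 \<le> 1" using v(2) n0 by (simp add: power_le_one)
    have "k * (\<Sum>m<N. (norm (p m))\<^sup>2) \<le> 1" using projection_norm[OF v(1) p(1,3)] n1 by linarith
    then have S: "(\<Sum>m<N. (norm (p m))\<^sup>2) \<le> 1 / k" using k_pos by (simp add: field_simps)
    have pm: "norm (j (p m)) \<le> norm j * (1 + 1 / k)" if "m < N" for m
    proof -
      have "(norm (p m))\<^sup>2 \<le> (\<Sum>m<N. (norm (p m))\<^sup>2)"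
        using that by (intro member_le_sum) auto
      then have "norm (p m) \<le> 1 + 1 / k" using norm_le_one_plus_power2[of "norm (p m)"] S by linarith
      then show ?thesis using norm_blinfun[of j "p m"] mult_left_mono[of "norm (p m)" "1 + 1/k" "norm j"] by force
    qed
    have "\<bar>\<Sum>m<N. inner (j (w (Suc m) - w m)) (j (p m))\<bar>
        \<le> (\<Sum>m<N. norm (j (w (Suc m) - w m)) * (norm j * (1 + 1 / k)))"
    proof (intro order_trans[OF sum_abs] sum_mono)
      fix m assume "m \<in> {..<N}"
      then have "norm (j (p m)) \<le> norm j * (1 + 1 / k)" using pm by simp
      then show "\<bar>inner (j (w (Suc m) - w m)) (j (p m))\<bar> \<le> norm (j (w (Suc m) - w m)) * (norm j * (1 + 1 / k))"
        by (intro order_trans[OF Cauchy_Schwarz_ineq2] mult_left_mono) auto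
    qed
    moreover have "discrete_derivative T j U N (step_function T \<theta> N w) v
      = (\<Sum>m<N. inner (j (w (Suc m) - w m)) (j (p m)))"
      by (rule discrete_derivative_eq) (rule p(2))
    ultimately show ?thesis
      using abs_pairing_le[OF u' v(1)] n1 unfolding err_def by linarith
  qed
  then show ?thesis by (intro bdd_aboveI) auto
qed

lemma err_le_dual_norm:
  assumes u': "u' \<in> L2 T" and v: "v \<in> L2 T" "L2_norm T v \<le> 1"
  shows "\<bar>err u' w v\<bar> \<le> dual_norm T (err u' w)"
  unfolding dual_norm_def using v by (intro cSup_upper err_bdd_above[OF u']) auto

lemma dual_norm_err_nonneg:
  assumes u': "u' \<in> L2 T"
  shows "0 \<le> dual_norm T (err u' w)"
proof -
  have "(L2_norm T (piecewise_constant k (\<lambda>_. 0 :: 'u)))\<^sup>2 = 0"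
    by (subst L2_norm_piecewise_constant) simp
  then show ?thesis
    using err_le_dual_norm[OF u' piecewise_constant_in_L2[of "\<lambda>_. 0"], of w] by simp
qed

text \<open>Rescaling the step function to norm one; homogeneity is read off the explicit form of
  the functional on V_n, and in the degenerate case all \<open>v m\<close> vanish.\<close>

lemma err_piecewise_constant_le:
  assumes u': "u' \<in> L2 T" and v: "\<And>m. m < N \<Longrightarrow> v m \<in> U"
  shows "err u' w (piecewise_constant k v) \<le> dual_norm T (err u' w) * sqrt (k * (\<Sum>m<N. (norm (v m))\<^sup>2))"
proof -
  define P where "P = k * (\<Sum>m<N. (norm (v m))\<^sup>2)"
  have P0: "0 \<le> P" unfolding P_def using k_pos by (simp add: sum_nonneg)
  show ?thesis
  proof (cases "P = 0")
    case True
    then have "(\<Sum>m<N. (norm (v m))\<^sup>2) = 0" unfolding P_def using k_pos by simp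
    then have "\<forall>m\<in>{..<N}. (norm (v m))\<^sup>2 = 0" by (subst (asm) sum_nonneg_eq_0_iff) auto
    then have "v m = 0" if "m < N" for m using that by simp
    then have "err u' w (piecewise_constant k v) = 0"
      by (subst err_piecewise_constant[where v=v, OF assms])
        (assumption, intro sum.neutral, simp add: blinfun.zero_right)
    then show ?thesis unfolding P_def[symmetric] True by simp
  next
    case False
    then have P: "0 < sqrt P" using P0 by simp
    define c where "c = 1 / sqrt P"
    define v' where "v' m = c *\<^sub>R v m" for m
    have v': "v' m \<in> U" if "m < N" for m
      using v[OF that] dp.subspace_U by (simp add: v'_def subspace_scale)
    have "(L2_norm T (piecewise_constant k v'))\<^sup>2 = k * (\<Sum>m<N. c\<^sup>2 * (norm (v m))\<^sup>2)"
      by (subst L2_norm_piecewise_constant) (simp add: v'_def power_mult_distrib)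
    also have "\<dots> = c\<^sup>2 * P" unfolding P_def by (simp add: sum_distrib_left[symmetric])
    also have "\<dots> = 1" unfolding c_def using P0 False by (simp add: power_divide)
    finally have "L2_norm T (piecewise_constant k v') \<le> 1"
      by (metis order_refl power2_eq_1_iff one_power2 power2_le_imp_le zero_le_one)
    then have "err u' w (piecewise_constant k v') \<le> dual_norm T (err u' w)"
      using err_le_dual_norm[OF u' piecewise_constant_in_L2] by (meson abs_le_D1)
    moreover have "err u' w (piecewise_constant k v') = c * err u' w (piecewise_constant k v)"
    proof -
      have "err u' w (piecewise_constant k v') =
        (\<Sum>m<N. (LINT t|lebesgue_on (cell k m). u' t (v' m)) - inner (j (w (Suc m) - w m)) (j (v' m)))"
        by (rule err_piecewise_constant[OF u' v'])
      also have "\<dots> = c * (\<Sum>m<N. (LINT t|lebesgue_on (cell k m). u' t (v m)) - inner (j (w (Suc m) - w m)) (j (v m)))"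
        unfolding sum_distrib_left
        by (intro sum.cong refl) (simp add: v'_def blinfun.scaleR_right right_diff_distrib)
      also have "(\<Sum>m<N. (LINT t|lebesgue_on (cell k m). u' t (v m)) - inner (j (w (Suc m) - w m)) (j (v m)))
        = err u' w (piecewise_constant k v)"
        by (rule err_piecewise_constant[OF u' v, symmetric])
      finally show ?thesis .
    qed
    ultimately have "err u' w (piecewise_constant k v) / sqrt P \<le> dual_norm T (err u' w)"
      unfolding c_def by simp
    then show ?thesis using P unfolding P_def[symmetric] by (simp add: pos_divide_le_eq)
  qed
qed

text \<open>Cauchy-Schwarz for the form by way of Young's inequality with a free weight s: the
  weighted bound is linear in the squared norms, so it can be integrated and summed cell by cell,
  and optimising s at the end gives back the product.\<close>

lemma form_defect_le:
  assumes u: "u \<in> L2 T" and E: "\<And>m t. m < N \<Longrightarrow> t \<in> open_cell k m \<Longrightarrow> E t = c m"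
  shows "(\<Sum>m<N. (LINT t|lebesgue_on (cell k m). a t (u t) (v m)) - cell_form a k m (c m) (v m))
    \<le> M * L2_norm T (\<lambda>t. u t - E t) * sqrt (k * (\<Sum>m<N. (norm (v m))\<^sup>2))"
proof -
  define P where "P = k * (\<Sum>m<N. (norm (v m))\<^sup>2)"
  define A where "A = L2_norm T (\<lambda>t. u t - E t)"
  have P0: "0 \<le> P" unfolding P_def using k_pos by (simp add: sum_nonneg)
  have A0: "0 \<le> A" by (simp add: A_def L2_norm_def)
  have M: "0 < M" using dp.M_ge by simp
  have A2: "A\<^sup>2 = (\<Sum>m<N. LINT t|lebesgue_on (cell k m). (norm (u t - c m))\<^sup>2)"
  proof -
    have "A\<^sup>2 = (LINT t|lebesgue_on {0..T}. (norm (u t - E t))\<^sup>2)" by (simp add: A_def L2_norm_def)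
    also have "\<dots> = (\<Sum>m<N. LINT t|lebesgue_on (cell k m). (norm (u t - c m))\<^sup>2)"
      unfolding interval_eq
      by (rule piecewise_integral[THEN conjunct2, OF k_nonneg integrable_cell_norm_diff[OF L2_k[OF u] k_nonneg]])
        (use E in auto)
    finally show ?thesis .
  qed
  have "(\<Sum>m<N. (LINT t|lebesgue_on (cell k m). a t (u t) (v m)) - cell_form a k m (c m) (v m))
     \<le> M * ((s * A\<^sup>2 + (sqrt P)\<^sup>2 / s) / 2)" if s: "0 < s" for s
  proof -
    have "(LINT t|lebesgue_on (cell k m). a t (u t) (v m)) - cell_form a k m (c m) (v m)
       \<le> M * s / 2 * (LINT t|lebesgue_on (cell k m). (norm (u t - c m))\<^sup>2) + M / (2 * s) * (k * (norm (v m))\<^sup>2)"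
      if m: "m < N" for m
    proof -
      have i1: "integrable (lebesgue_on (cell k m)) (\<lambda>t. a t (u t) (v m))"
        by (rule integrable_cell_form_L2[OF u m])
      have i2: "integrable (lebesgue_on (cell k m)) (\<lambda>t. a t (c m) (v m))"
        by (rule integrable_cell_form[OF adm k_pos m])
      have i3: "integrable (lebesgue_on (cell k m)) (\<lambda>t. (norm (u t - c m))\<^sup>2)"
        by (rule integrable_cell_norm_diff[OF L2_k[OF u] k_nonneg m])
      have "(LINT t|lebesgue_on (cell k m). a t (u t) (v m)) - cell_form a k m (c m) (v m)
        = (LINT t|lebesgue_on (cell k m). a t (u t) (v m) - a t (c m) (v m))"
        unfolding cell_form_def by (rule Bochner_Integration.integral_diff[OF i1 i2, symmetric])
      also have "\<dots> \<le> (LINT t|lebesgue_on (cell k m). M * s / 2 * (norm (u t - c m))\<^sup>2 + M / (2 * s) * (norm (v m))\<^sup>2)"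
      proof (rule integral_mono_AE)
        have "AE t in lebesgue_on {0..real N * k}. \<forall>v w. \<bar>a t v w\<bar> \<le> M * norm v * norm w"
          using adm unfolding admissible_form_def by blast
        then have "AE t in lebesgue_on (cell k m). \<forall>v w. \<bar>a t v w\<bar> \<le> M * norm v * norm w"
          by (rule AE_lebesgue_on_subset[OF _ cell_subset[OF k_nonneg m]]) auto
        moreover have "AE t in lebesgue_on (cell k m). bilinear (a t)"
        proof (rule AE_I2)
          fix t assume "t \<in> space (lebesgue_on (cell k m))"
          then have "t \<in> {0..real N * k}" using cell_subset[OF k_nonneg m] by auto
          then show "bilinear (a t)" using adm unfolding admissible_form_def by blast
        qed
        ultimately show "AE t in lebesgue_on (cell k m). a t (u t) (v m) - a t (c m) (v m)
          \<le> M * s / 2 * (norm (u t - c m))\<^sup>2 + M / (2 * s) * (norm (v m))\<^sup>2"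
        proof eventually_elim
          case (elim t)
          let ?x = "norm (u t - c m)" and ?y = "norm (v m)"
          have "a t (u t) (v m) - a t (c m) (v m) = a t (u t - c m) (v m)"
            using bilinear_lsub[OF elim(2)] by simp
          also have "\<dots> \<le> M * ?x * ?y" using elim(1) by (meson abs_le_D1)
          also have "\<dots> \<le> M * (s / 2 * ?x\<^sup>2 + 1 / (2 * s) * ?y\<^sup>2)"
          proof -
            have "0 \<le> (s * ?x - ?y)\<^sup>2 / (2 * s)" using s by simp
            also have "\<dots> = s / 2 * ?x\<^sup>2 + 1 / (2 * s) * ?y\<^sup>2 - ?x * ?y"
              using s by (simp add: power2_eq_square field_simps)
            finally have "?x * ?y \<le> s / 2 * ?x\<^sup>2 + 1 / (2 * s) * ?y\<^sup>2" by simp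
            then show ?thesis using mult_left_mono[OF _ less_imp_le[OF M]] by (simp only: mult.assoc)
          qed
          also have "\<dots> = M * s / 2 * ?x\<^sup>2 + M / (2 * s) * ?y\<^sup>2" by (simp add: distrib_left)
          finally show ?case .
        qed
      qed (use i1 i2 i3 in auto)
      also have "\<dots> = (LINT t|lebesgue_on (cell k m). M * s / 2 * (norm (u t - c m))\<^sup>2)
          + (LINT t|lebesgue_on (cell k m). M / (2 * s) * (norm (v m))\<^sup>2)"
        by (rule Bochner_Integration.integral_add) (use i3 in auto)
      also have "\<dots> = M * s / 2 * (LINT t|lebesgue_on (cell k m). (norm (u t - c m))\<^sup>2) + M / (2 * s) * (k * (norm (v m))\<^sup>2)"
        by (subst integral_cell_const[OF k_nonneg]) simp
      finally show ?thesis .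
    qed
    then have "(\<Sum>m<N. (LINT t|lebesgue_on (cell k m). a t (u t) (v m)) - cell_form a k m (c m) (v m))
      \<le> (\<Sum>m<N. M * s / 2 * (LINT t|lebesgue_on (cell k m). (norm (u t - c m))\<^sup>2) + M / (2 * s) * (k * (norm (v m))\<^sup>2))"
      by (intro sum_mono) auto
    also have "\<dots> = M * s / 2 * A\<^sup>2 + M / (2 * s) * P"
      unfolding A2 P_def by (simp only: sum.distrib sum_distrib_left)
    also have "\<dots> = M * ((s * A\<^sup>2 + (sqrt P)\<^sup>2 / s) / 2)" using P0 by (simp add: field_simps)
    finally show ?thesis .
  qed
  \<comment> \<open>Division by M leaves exactly the weighted inequality of
    \<open>le_mult_of_le_weighted\<close>.\<close>
  then have "(\<Sum>m<N. (LINT t|lebesgue_on (cell k m). a t (u t) (v m)) - cell_form a k m (c m) (v m)) / M \<le> A * sqrt P"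
    by (intro le_mult_of_le_weighted A0) (use P0 M in \<open>auto simp: pos_divide_le_eq mult.commute\<close>)
  then show ?thesis using M unfolding P_def A_def by (simp add: pos_divide_le_eq mult_ac)
qed

end

section \<open>Quasi-optimality\<close>

text \<open>The square root of the factor collected in \<open>total_error_le\<close>: 4 + 2 * M^2
  bounds the data of z by the squared error of the comparison function, 3 + (3 * M^2 + 4) * K bounds
  by these data what z adds to the three error terms, and the first 3 comes from splitting the
  squares.\<close>

definition quasi_const :: "real \<Rightarrow> real \<Rightarrow> real" where
  "quasi_const M K = sqrt (3 + (3 + (3 * M\<^sup>2 + 4) * K) * (4 + 2 * M\<^sup>2))"

lemma quasi_const_gt_1: "0 \<le> K \<Longrightarrow> 1 < quasi_const M K"
proof -
  assume K: "0 \<le> K"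
  have "0 \<le> (3 + (3 * M\<^sup>2 + 4) * K) * (4 + 2 * M\<^sup>2)" using K by simp
  then show ?thesis unfolding quasi_const_def by (simp add: real_less_rsqrt)
qed

context theta_method
begin

text \<open>Galerkin orthogonality: step functions with values in U are admissible tests in the
  evolution equation, so f cancels against the scheme.\<close>

lemma residual_identity:
  assumes f: "f \<in> L2 T" and scheme: "theta_scheme T j a \<Phi> \<theta> U N f \<xi>\<^sub>0 w"
    and sol: "solves T j a \<Phi> f \<xi>\<^sub>0 u u' uc"
    and v: "\<And>m. m < N \<Longrightarrow> v m \<in> U"
  shows "(\<Sum>m<N. dp.res (\<lambda>m. w m - ws m) m (v m)) = err u' ws (piecewise_constant k v)
     + (\<Sum>m<N. (LINT t|lebesgue_on (cell k m). a t (u t) (v m)) - cell_form a k m (dp.mid ws m) (v m))"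
proof -
  let ?V = "piecewise_constant k v"
  have u: "u \<in> L2 T" "u' \<in> L2 T"
    using sol by (auto simp: solves_def W_element_def has_weak_derivative_def)
  have "pairing T u' ?V + form_op T a u ?V = pairing T f ?V"
    using sol piecewise_constant_in_L2[of v] unfolding solves_def by blast
  then have eq: "(\<Sum>m<N. LINT t|lebesgue_on (cell k m). u' t (v m))
      + (\<Sum>m<N. LINT t|lebesgue_on (cell k m). a t (u t) (v m))
      = (\<Sum>m<N. LINT t|lebesgue_on (cell k m). f t (v m))"
    by (simp only: pairing_piecewise_constant[OF u(2)] pairing_piecewise_constant[OF f] form_op_piecewise_constant[OF u(1)])
  have "(\<Sum>m<N. dp.res (\<lambda>m. w m - ws m) m (v m))
      = (\<Sum>m<N. (LINT t|lebesgue_on (cell k m). f t (v m)) - dp.res ws m (v m))"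
    using scheme v unfolding scheme_iff by (intro sum.cong refl) (simp add: dp.res_diff)
  also have "\<dots> = (\<Sum>m<N. LINT t|lebesgue_on (cell k m). f t (v m))
     - (\<Sum>m<N. inner (j (ws (Suc m) - ws m)) (j (v m))) - (\<Sum>m<N. cell_form a k m (dp.mid ws m) (v m))"
    by (simp add: dp.res_def sum_subtractf sum.distrib)
  also have "\<dots> = (\<Sum>m<N. LINT t|lebesgue_on (cell k m). u' t (v m))
     - (\<Sum>m<N. inner (j (ws (Suc m) - ws m)) (j (v m)))
     + ((\<Sum>m<N. LINT t|lebesgue_on (cell k m). a t (u t) (v m)) - (\<Sum>m<N. cell_form a k m (dp.mid ws m) (v m)))"
    using eq by simp
  also have "\<dots> = err u' ws ?V
     + (\<Sum>m<N. (LINT t|lebesgue_on (cell k m). a t (u t) (v m)) - cell_form a k m (dp.mid ws m) (v m))"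
  proof -
    have "err u' ws ?V = (\<Sum>m<N. (LINT t|lebesgue_on (cell k m). u' t (v m)) - inner (j (ws (Suc m) - ws m)) (j (v m)))"
      by (rule err_piecewise_constant[OF u(2) v])
    then show ?thesis by (simp only: sum_subtractf)
  qed
  finally show ?thesis .
qed

lemma step_function_cell_value:
  "t \<in> open_cell k m \<Longrightarrow> step_function T \<theta> N w t = dp.mid w m"
  using step_function_open_cell[OF step_size_eq k_pos] by (simp add: dp.mid_def)

lemma residual_le:
  assumes f: "f \<in> L2 T" and scheme: "theta_scheme T j a \<Phi> \<theta> U N f \<xi>\<^sub>0 w"
    and sol: "solves T j a \<Phi> f \<xi>\<^sub>0 u u' uc" and ws: "\<forall>m\<le>N. ws m \<in> U"
  shows "dp.res_le (\<lambda>m. w m - ws m)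
    (dual_norm T (err u' ws) + M * L2_norm T (\<lambda>t. u t - step_function T \<theta> N ws t))"
  unfolding dp.res_le_def
proof (intro conjI allI impI)
  have u: "u \<in> L2 T" "u' \<in> L2 T"
    using sol by (auto simp: solves_def W_element_def has_weak_derivative_def)
  show "0 \<le> dual_norm T (err u' ws) + M * L2_norm T (\<lambda>t. u t - step_function T \<theta> N ws t)"
    using dual_norm_err_nonneg[OF u(2)] dp.M_ge by (simp add: L2_norm_def)
  show "w m - ws m \<in> U" if "m \<le> N" for m
    using that ws scheme dp.subspace_U unfolding scheme_iff by (simp add: subspace_diff)
  fix v assume v: "\<forall>m<N. v m \<in> U"
  have "(\<Sum>m<N. dp.res (\<lambda>m. w m - ws m) m (v m)) = err u' ws (piecewise_constant k v)
     + (\<Sum>m<N. (LINT t|lebesgue_on (cell k m). a t (u t) (v m)) - cell_form a k m (dp.mid ws m) (v m))"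
    using residual_identity[OF f scheme sol, of v ws] v by blast
  also have "\<dots> \<le> dual_norm T (err u' ws) * sqrt (k * (\<Sum>m<N. (norm (v m))\<^sup>2))
     + M * L2_norm T (\<lambda>t. u t - step_function T \<theta> N ws t) * sqrt (k * (\<Sum>m<N. (norm (v m))\<^sup>2))"
    by (intro add_mono err_piecewise_constant_le[OF u(2)] form_defect_le[OF u(1)])
      (use v step_function_cell_value in auto)
  finally show "(\<Sum>m<N. dp.res (\<lambda>m. w m - ws m) m (v m))
     \<le> (dual_norm T (err u' ws) + M * L2_norm T (\<lambda>t. u t - step_function T \<theta> N ws t)) * sqrt (k * (\<Sum>m<N. (norm (v m))\<^sup>2))"
    by (simp add: distrib_right)
qed

text \<open>The two functionals differ by the discrete derivative of z, which the scheme expresses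
  as residual minus form. Both are evaluated at the projection of v, whose norm does not exceed that
  of v.\<close>

lemma dual_norm_err_le:
  assumes u': "u' \<in> L2 T" and r: "dp.res_le (\<lambda>m. w m - ws m) g"
  shows "dual_norm T (err u' w) \<le> dual_norm T (err u' ws) + g
    + M * sqrt (k * (\<Sum>m<N. (norm (dp.mid (\<lambda>m. w m - ws m) m))\<^sup>2))"
proof -
  define z where "z m = w m - ws m" for m
  define Z where "Z = sqrt (k * (\<Sum>m<N. (norm (dp.mid z m))\<^sup>2))"
  have r: "dp.res_le z g" using r unfolding z_def[abs_def] .
  have g: "0 \<le> g" using r unfolding dp.res_le_def by simp
  have Z: "0 \<le> Z" unfolding Z_def using k_pos by (simp add: sum_nonneg)
  have "dual_norm T (err u' w) \<le> dual_norm T (err u' ws) + g + M * Z"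
    unfolding dual_norm_def[of T "err u' w"]
  proof (rule cSup_least)
    have "(L2_norm T (piecewise_constant k (\<lambda>_. 0 :: 'u)))\<^sup>2 = 0"
      by (subst L2_norm_piecewise_constant) simp
    then show "{\<bar>err u' w v\<bar> |v. v \<in> L2 T \<and> L2_norm T v \<le> 1} \<noteq> {}"
      using piecewise_constant_in_L2[of "\<lambda>_. 0 :: 'u"] by fastforce
    fix x assume "x \<in> {\<bar>err u' w v\<bar> |v. v \<in> L2 T \<and> L2_norm T v \<le> 1}"
    then obtain v where x: "x = \<bar>err u' w v\<bar>" and v: "v \<in> L2 T" "L2_norm T v \<le> 1" by blast
    obtain p where p: "\<And>m. m < N \<Longrightarrow> p m \<in> U"
      "\<And>m t. m < N \<Longrightarrow> t \<in> open_cell k m \<Longrightarrow> V_projection T U N v t = p m"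
      "\<And>m z. m < N \<Longrightarrow> z \<in> U \<Longrightarrow> k * inner (p m) z = (LINT t|lebesgue_on (cell k m). inner (v t) z)"
      using projection_exists[OF v(1)] by metis
    define s where "s = sqrt (k * (\<Sum>m<N. (norm (p m))\<^sup>2))"
    have n0: "0 \<le> L2_norm T v" by (simp add: L2_norm_def)
    have "k * (\<Sum>m<N. (norm (p m))\<^sup>2) \<le> (L2_norm T v)\<^sup>2" by (rule projection_norm[OF v(1) p(1,3)])
    then have s: "0 \<le> s" "s \<le> 1"
      unfolding s_def using v(2) n0 k_pos power_le_one[OF n0 v(2), of 2]
      by (auto simp: sum_nonneg real_sqrt_le_1_iff)
    have dd: "discrete_derivative T j U N (step_function T \<theta> N w) v = (\<Sum>m<N. inner (j (w (Suc m) - w m)) (j (p m)))" for w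
      by (rule discrete_derivative_eq) (rule p(2))
    define D where "D = (\<Sum>m<N. inner (j (z (Suc m) - z m)) (j (p m)))"
    have "discrete_derivative T j U N (step_function T \<theta> N w) v
        = discrete_derivative T j U N (step_function T \<theta> N ws) v + D"
      unfolding dd D_def sum.distrib[symmetric]
      by (intro sum.cong refl) (simp add: z_def blinfun.diff_right inner_diff_left)
    then have "err u' w v = err u' ws v - D" by (simp add: err_def)
    then have "x \<le> \<bar>err u' ws v\<bar> + \<bar>D\<bar>" unfolding x by linarith
    also have "\<bar>err u' ws v\<bar> \<le> dual_norm T (err u' ws)" by (rule err_le_dual_norm[OF u' v])
    also have "\<bar>D\<bar> \<le> g + M * Z"
    proof -
      let ?b = "\<Sum>m<N. cell_form a k m (dp.mid z m) (p m)"
      have D: "D = (\<Sum>m<N. dp.res z m (p m)) - ?b"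
        unfolding D_def by (simp add: dp.res_def sum.distrib)
      have "(\<Sum>m<N. dp.res z m (p m)) \<le> g * s"
        using r p(1) unfolding dp.res_le_def s_def by blast
      \<comment> \<open>The residual bound is one-sided, so the test sequence is negated to reach
        the absolute value.\<close>
      moreover have "(\<Sum>m<N. dp.res z m (- p m)) \<le> g * sqrt (k * (\<Sum>m<N. (norm (- p m))\<^sup>2))"
        by (rule dp.res_le_on[OF r subset_refl]) (use p(1) dp.subspace_U in \<open>auto simp: subspace_neg\<close>)
      moreover have "dp.res z m (- p m) = - dp.res z m (p m)" if "m < N" for m
        using bilinear_rneg[OF dp.bil[OF that]] by (simp add: dp.res_def blinfun.minus_right)
      ultimately have "\<bar>\<Sum>m<N. dp.res z m (p m)\<bar> \<le> g * s"
        unfolding s_def by (simp add: sum_negf)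
      moreover have "g * s \<le> g" using g s by (simp add: mult_left_le)
      moreover have "\<bar>?b\<bar> \<le> M * Z * s"
        unfolding Z_def s_def by (rule dp.form_sum_le) simp
      moreover have "M * Z * s \<le> M * Z" using Z s dp.M_ge by (intro mult_left_le) auto
      ultimately show ?thesis unfolding D by linarith
    qed
    finally show "x \<le> dual_norm T (err u' ws) + g + M * Z" by simp
  qed
  then show ?thesis unfolding Z_def z_def[abs_def] .
qed

section \<open>The error terms in V and in the supremum norm\<close>

lemma L2_norm_error_le:
  assumes u: "u \<in> L2 T"
  shows "(L2_norm T (\<lambda>t. u t - step_function T \<theta> N w t))\<^sup>2
     \<le> 2 * (L2_norm T (\<lambda>t. u t - step_function T \<theta> N ws t))\<^sup>2
       + 2 * (k * (\<Sum>m<N. (norm (dp.mid (\<lambda>m. w m - ws m) m))\<^sup>2))"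
proof -
  note int = integrable_cell_norm_diff[OF L2_k[OF u] k_nonneg]
  have eq: "(L2_norm T (\<lambda>t. u t - step_function T \<theta> N w t))\<^sup>2
      = (\<Sum>m<N. LINT t|lebesgue_on (cell k m). (norm (u t - dp.mid w m))\<^sup>2)" for w
  proof -
    have "(L2_norm T (\<lambda>t. u t - step_function T \<theta> N w t))\<^sup>2
       = (LINT t|lebesgue_on {0..T}. (norm (u t - step_function T \<theta> N w t))\<^sup>2)"
      by (simp add: L2_norm_def)
    also have "\<dots> = (\<Sum>m<N. LINT t|lebesgue_on (cell k m). (norm (u t - dp.mid w m))\<^sup>2)"
      unfolding interval_eq
      by (rule piecewise_integral[THEN conjunct2, OF k_nonneg int]) (auto simp: step_function_cell_value)
    finally show ?thesis .
  qed
  have "(LINT t|lebesgue_on (cell k m). (norm (u t - dp.mid w m))\<^sup>2)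
      \<le> 2 * (LINT t|lebesgue_on (cell k m). (norm (u t - dp.mid ws m))\<^sup>2)
        + 2 * (k * (norm (dp.mid (\<lambda>m. w m - ws m) m))\<^sup>2)" if m: "m < N" for m
  proof -
    let ?d = "dp.mid (\<lambda>m. w m - ws m) m"
    have d: "dp.mid w m = dp.mid ws m + ?d" by (simp add: dp.mid_def algebra_simps)
    have "(LINT t|lebesgue_on (cell k m). (norm (u t - dp.mid w m))\<^sup>2)
       \<le> (LINT t|lebesgue_on (cell k m). 2 * (norm (u t - dp.mid ws m))\<^sup>2 + 2 * (norm ?d)\<^sup>2)"
    proof (rule integral_mono)
      show "(norm (u t - dp.mid w m))\<^sup>2 \<le> 2 * (norm (u t - dp.mid ws m))\<^sup>2 + 2 * (norm ?d)\<^sup>2" for t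
      proof -
        have "(norm (u t - dp.mid w m))\<^sup>2 = (norm ((u t - dp.mid ws m) - ?d))\<^sup>2"
          unfolding d by (simp add: algebra_simps)
        also have "\<dots> \<le> (norm (u t - dp.mid ws m) + norm ?d)\<^sup>2"
          by (intro power_mono norm_triangle_ineq4) auto
        also have "\<dots> \<le> 2 * (norm (u t - dp.mid ws m))\<^sup>2 + 2 * (norm ?d)\<^sup>2"
          using sum_squares_bound[of "norm (u t - dp.mid ws m)" "norm ?d"] by (simp add: power2_sum)
        finally show ?thesis .
      qed
    qed (use int[OF m] in auto)
    also have "\<dots> = (LINT t|lebesgue_on (cell k m). 2 * (norm (u t - dp.mid ws m))\<^sup>2)
        + (LINT t|lebesgue_on (cell k m). 2 * (norm ?d)\<^sup>2)"
      by (rule Bochner_Integration.integral_add) (use int[OF m] in auto)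
    also have "\<dots> = 2 * (LINT t|lebesgue_on (cell k m). (norm (u t - dp.mid ws m))\<^sup>2) + 2 * (k * (norm ?d)\<^sup>2)"
      by (subst integral_cell_const[OF k_nonneg]) simp
    finally show ?thesis .
  qed
  then have "(\<Sum>m<N. LINT t|lebesgue_on (cell k m). (norm (u t - dp.mid w m))\<^sup>2)
      \<le> (\<Sum>m<N. 2 * (LINT t|lebesgue_on (cell k m). (norm (u t - dp.mid ws m))\<^sup>2)
        + 2 * (k * (norm (dp.mid (\<lambda>m. w m - ws m) m))\<^sup>2))"
    by (intro sum_mono) auto
  then show ?thesis unfolding eq by (simp add: sum.distrib sum_distrib_left)
qed

text \<open>The index depends on t alone, so one case distinction serves all sequences and can be
  applied to a difference. The end point T counts as node N, so no value beyond index N is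
  read.\<close>

lemma step_function_cases:
  assumes "t \<in> {0..T}"
  obtains m where "m \<le> N" "\<forall>w :: nat \<Rightarrow> 'u. step_function T \<theta> N w t = w m"
  | m where "m < N" "\<forall>w. step_function T \<theta> N w t = dp.mid w m"
proof -
  define m where "m = nat \<lfloor>t / k\<rfloor>"
  have tk: "0 \<le> t / k" "t / k \<le> real N"
    using assms k_pos T_eq by (auto simp: pos_divide_le_eq)
  have m: "real m \<le> t / k" unfolding m_def using tk by linarith
  show ?thesis
  proof (cases "t = real m * k")
    case True
    have "real m \<le> real N" using m tk by linarith
    then show ?thesis using that(1)[of m] True unfolding step_function_def Let_def step_size_eq m_def by auto
  next
    case False
    have "real m \<noteq> t / k" using False k_pos by (simp add: field_simps)
    then have "real m < real N" using m tk by linarith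
    then show ?thesis using that(2)[of m] False unfolding step_function_def Let_def step_size_eq m_def dp.mid_def by auto
  qed
qed

text \<open>Between the nodes the values are convex combinations of neighbouring nodal values, as
  \<theta> lies in [0,1].\<close>

lemma step_function_bound:
  assumes "t \<in> {0..T}" and b: "\<And>m. m \<le> N \<Longrightarrow> norm (j (z m)) \<le> c"
  shows "norm (j (step_function T \<theta> N z t)) \<le> c"
  using assms(1)
proof (cases rule: step_function_cases)
  case (1 m)
  then show ?thesis using b by simp
next
  case (2 m)
  have "norm (j (dp.mid z m)) \<le> norm (\<theta> *\<^sub>R j (z (Suc m))) + norm ((1 - \<theta>) *\<^sub>R j (z m))"
    unfolding dp.mid_def blinfun.add_right blinfun.scaleR_right by (rule norm_triangle_ineq)
  also have "\<dots> = \<theta> * norm (j (z (Suc m))) + (1 - \<theta>) * norm (j (z m))"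
    using dp.\<theta>_ge dp.\<theta>_le by simp
  also have "\<dots> \<le> \<theta> * c + (1 - \<theta>) * c"
    using dp.\<theta>_ge dp.\<theta>_le 2(1) by (intro add_mono mult_left_mono b) auto
  finally show ?thesis using 2 by (simp add: algebra_simps)
qed

text \<open>Compactness bounds the continuous representative; boundedness gives the real supremum in
  the error its meaning.\<close>

lemma sup_bdd_above:
  assumes "continuous_on {0..T} uc"
  shows "bdd_above ((\<lambda>t. (norm (uc t - j (step_function T \<theta> N w t)))\<^sup>2) ` {0..T})"
proof -
  have "compact (uc ` {0..T})" by (intro compact_continuous_image assms compact_Icc)
  then obtain C where C: "\<And>t. t \<in> {0..T} \<Longrightarrow> norm (uc t) \<le> C"
    using compact_imp_bounded bounded_iff by (metis imageI)
  define c where "c = (\<Sum>m\<le>N. norm (j (w m)))"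
  have c: "norm (j (w m)) \<le> c" if "m \<le> N" for m
    unfolding c_def using that by (intro member_le_sum) auto
  show ?thesis
  proof (rule bdd_aboveI2)
    fix t assume t: "t \<in> {0..T}"
    have "norm (uc t - j (step_function T \<theta> N w t)) \<le> norm (uc t) + norm (j (step_function T \<theta> N w t))"
      by (rule norm_triangle_ineq4)
    also have "\<dots> \<le> C + c" by (intro add_mono C[OF t] step_function_bound[OF t c])
    finally show "(norm (uc t - j (step_function T \<theta> N w t)))\<^sup>2 \<le> (C + c)\<^sup>2"
      by (intro power_mono) auto
  qed
qed

text \<open>The supremum term of the error is what controls the boundary defect \<open>e\<close>: it
  involves the comparison function at 0 and T, and both errors there are among the values under the
  supremum.\<close>

lemma total_error_le:
  assumes st: "dp.stable K" and K: "0 \<le> K"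
    and f: "f \<in> L2 T" and scheme: "theta_scheme T j a \<Phi> \<theta> U N f \<xi>\<^sub>0 w"
    and sol: "solves T j a \<Phi> f \<xi>\<^sub>0 u u' uc" and ws: "\<forall>m\<le>N. ws m \<in> U"
  shows "total_error T j U N u u' uc (step_function T \<theta> N w)
    \<le> quasi_const M K * total_error T j U N u u' uc (step_function T \<theta> N ws)"
proof -
  have u: "u \<in> L2 T" "u' \<in> L2 T" and uc: "continuous_on {0..T} uc"
    using sol by (auto simp: solves_def W_element_def has_weak_derivative_def)
  define z where "z m = w m - ws m" for m
  define d where "d = dual_norm T (err u' ws)"
  define E where "E = L2_norm T (\<lambda>t. u t - step_function T \<theta> N ws t)"
  define S where "S = (SUP t\<in>{0..T}. (norm (uc t - j (step_function T \<theta> N ws t)))\<^sup>2)"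
  define g where "g = d + M * E"
  define \<xi> where "\<xi> = (uc 0 - j (ws 0)) - \<Phi> (uc T - j (ws N))"
  define e where "e = norm \<xi>"
  define Q where "Q = g\<^sup>2 + e\<^sup>2"
  define X where "X = d\<^sup>2 + E\<^sup>2 + S"
  define Z where "Z = k * (\<Sum>m<N. (norm (dp.mid z m))\<^sup>2)"
  have d0: "0 \<le> d" unfolding d_def by (rule dual_norm_err_nonneg[OF u(2)])
  have E0: "0 \<le> E" by (simp add: E_def L2_norm_def)
  have Z0: "0 \<le> Z" unfolding Z_def using k_pos by (simp add: sum_nonneg)
  have Q0: "0 \<le> Q" "g\<^sup>2 \<le> Q" unfolding Q_def by auto
  have S_ge: "(norm (uc t - j (step_function T \<theta> N ws t)))\<^sup>2 \<le> S" if "t \<in> {0..T}" for t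
    unfolding S_def by (rule cSUP_upper[OF that sup_bdd_above[OF uc]])
  have S0: "0 \<le> S" using S_ge[of 0] T_pos by (smt (verit) atLeastAtMost_iff zero_le_power2)
  have r: "dp.res_le z g"
    unfolding z_def[abs_def] g_def d_def E_def by (rule residual_le[OF f scheme sol ws])
  have nodes: "norm (uc 0 - j (ws 0)) \<le> sqrt S" "norm (uc T - j (ws N)) \<le> sqrt S"
  proof -
    have "step_function T \<theta> N ws 0 = ws 0" using step_function_node[OF step_size_eq k_pos, of \<theta> ws 0] by simp
    then show "norm (uc 0 - j (ws 0)) \<le> sqrt S" using S_ge[of 0] T_pos by (simp add: real_le_rsqrt)
    have "step_function T \<theta> N ws T = ws N"
      using step_function_node[OF step_size_eq k_pos, of \<theta> ws N] T_eq by metis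
    then show "norm (uc T - j (ws N)) \<le> sqrt S" using S_ge[of T] T_pos by (simp add: real_le_rsqrt)
  qed
  have "e \<le> norm (uc 0 - j (ws 0)) + norm (\<Phi> (uc T - j (ws N)))"
    unfolding e_def \<xi>_def by (rule norm_triangle_ineq4)
  also have "norm (\<Phi> (uc T - j (ws N))) \<le> norm \<Phi> * norm (uc T - j (ws N))" by (rule norm_blinfun)
  also have "\<dots> \<le> 1 * norm (uc T - j (ws N))" using dp.\<Phi>_le by (intro mult_right_mono) auto
  finally have "e \<le> 2 * sqrt S" using nodes by linarith
  then have "e\<^sup>2 \<le> (2 * sqrt S)\<^sup>2" by (intro power_mono) (auto simp: e_def)
  then have e2: "e\<^sup>2 \<le> 4 * S" using S0 by (simp add: power_mult_distrib)
  have bd: "norm (j (z 0)) \<le> norm \<Phi> * norm (j (z N)) + e"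
    unfolding e_def
  proof (rule dp.boundary_le)
    show "z 0 \<in> U" using r unfolding dp.res_le_def by simp
    show "inner (j (z 0) - \<Phi> (j (z N))) (j x) = inner \<xi> (j x)" if "x \<in> U" for x
    proof -
      have "inner (j (w 0) - \<Phi> (j (w N))) (j x) = inner \<xi>\<^sub>0 (j x)"
        using scheme that unfolding scheme_iff by blast
      also have "\<xi>\<^sub>0 = uc 0 - \<Phi> (uc T)" using sol unfolding solves_def by simp
      finally show ?thesis
        unfolding z_def \<xi>_def by (simp add: blinfun.diff_right inner_diff_left)
    qed
  qed
  have e0: "0 \<le> e" by (simp add: e_def)
  from st r e0 bd have stab: "\<And>m. m \<le> N \<Longrightarrow> (norm (j (z m)))\<^sup>2 \<le> K * Q" "Z \<le> K * Q"
    unfolding dp.stable_def Q_def Z_def by blast+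
  have Q_le: "Q \<le> (4 + 2 * M\<^sup>2) * X"
  proof -
    have "g\<^sup>2 \<le> 2 * d\<^sup>2 + 2 * (M\<^sup>2 * E\<^sup>2)"
      unfolding g_def using sum_squares_bound[of d "M * E"] by (simp add: power2_sum power_mult_distrib mult_ac)
    moreover have "(4 + 2 * M\<^sup>2) * X = 4 * d\<^sup>2 + 4 * E\<^sup>2 + 4 * S + 2 * (M\<^sup>2 * d\<^sup>2) + 2 * (M\<^sup>2 * E\<^sup>2) + 2 * (M\<^sup>2 * S)"
      unfolding X_def by (simp add: algebra_simps)
    moreover have "0 \<le> M\<^sup>2 * d\<^sup>2" "0 \<le> M\<^sup>2 * S" "0 \<le> d\<^sup>2" "0 \<le> E\<^sup>2" using S0 by auto
    ultimately show ?thesis unfolding Q_def using e2 by linarith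
  qed
  have dn: "(dual_norm T (err u' w))\<^sup>2 \<le> 3 * d\<^sup>2 + 3 * Q + 3 * M\<^sup>2 * (K * Q)"
  proof -
    have "dual_norm T (err u' w) \<le> d + g + M * sqrt Z"
      using dual_norm_err_le[OF u(2), of w ws g] r unfolding d_def Z_def z_def[abs_def] by simp
    then have "(dual_norm T (err u' w))\<^sup>2 \<le> (d + g + M * sqrt Z)\<^sup>2"
      by (intro power_mono dual_norm_err_nonneg[OF u(2)])
    also have "\<dots> \<le> 3 * d\<^sup>2 + 3 * g\<^sup>2 + 3 * (M * sqrt Z)\<^sup>2"
      using sum_squares_bound[of d g] sum_squares_bound[of d "M * sqrt Z"] sum_squares_bound[of g "M * sqrt Z"]
      by (simp add: power2_sum distrib_left distrib_right)
    also have "(M * sqrt Z)\<^sup>2 = M\<^sup>2 * Z" using Z0 by (simp add: power_mult_distrib)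
    finally have "(dual_norm T (err u' w))\<^sup>2 \<le> 3 * d\<^sup>2 + 3 * g\<^sup>2 + 3 * (M\<^sup>2 * Z)" .
    moreover have "M\<^sup>2 * Z \<le> M\<^sup>2 * (K * Q)" using stab(2) by (intro mult_left_mono) auto
    ultimately show ?thesis using Q0(2) by simp
  qed
  have L2: "(L2_norm T (\<lambda>t. u t - step_function T \<theta> N w t))\<^sup>2 \<le> 2 * E\<^sup>2 + 2 * (K * Q)"
    using L2_norm_error_le[OF u(1), of w ws] stab(2) unfolding E_def Z_def z_def[abs_def] by linarith
  have SUP: "(SUP t\<in>{0..T}. (norm (uc t - j (step_function T \<theta> N w t)))\<^sup>2) \<le> 2 * S + 2 * (K * Q)"
  proof (rule cSUP_least)
    show "{0..T} \<noteq> {}" using T_pos by simp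
    fix t assume t: "t \<in> {0..T}"
    let ?x = "uc t - j (step_function T \<theta> N ws t)" and ?y = "j (step_function T \<theta> N z t)"
    have mid: "dp.mid z m = dp.mid w m - dp.mid ws m" for m
      by (simp add: z_def dp.mid_def algebra_simps)
    have "step_function T \<theta> N z t = step_function T \<theta> N w t - step_function T \<theta> N ws t"
      using t by (cases rule: step_function_cases) (simp_all add: z_def mid)
    then have split: "uc t - j (step_function T \<theta> N w t) = ?x - ?y"
      by (simp add: blinfun.diff_right)
    have "(norm (uc t - j (step_function T \<theta> N w t)))\<^sup>2 \<le> (norm ?x + norm ?y)\<^sup>2"
      unfolding split by (intro power_mono norm_triangle_ineq4) auto
    also have "\<dots> \<le> 2 * (norm ?x)\<^sup>2 + 2 * (norm ?y)\<^sup>2"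
      using sum_squares_bound[of "norm ?x" "norm ?y"] by (simp add: power2_sum)
    also have "(norm ?y)\<^sup>2 \<le> (sqrt (K * Q))\<^sup>2"
      using stab(1) by (intro power_mono step_function_bound[OF t]) (auto intro: real_le_rsqrt)
    also have "(sqrt (K * Q))\<^sup>2 = K * Q" using K Q0 by simp
    finally show "(norm (uc t - j (step_function T \<theta> N w t)))\<^sup>2 \<le> 2 * S + 2 * (K * Q)"
      using S_ge[OF t] by simp
  qed
  have "(dual_norm T (err u' w))\<^sup>2 + (L2_norm T (\<lambda>t. u t - step_function T \<theta> N w t))\<^sup>2
      + (SUP t\<in>{0..T}. (norm (uc t - j (step_function T \<theta> N w t)))\<^sup>2)
    \<le> 3 * X + (3 + (3 * M\<^sup>2 + 4) * K) * Q"
  proof -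
    have "3 * X + (3 + (3 * M\<^sup>2 + 4) * K) * Q
      = 3 * d\<^sup>2 + 3 * E\<^sup>2 + 3 * S + 3 * Q + 3 * M\<^sup>2 * (K * Q) + 4 * (K * Q)"
      unfolding X_def by (simp add: algebra_simps)
    then show ?thesis using dn L2 SUP S0 zero_le_power2[of E] by linarith
  qed
  also have "\<dots> \<le> 3 * X + (3 + (3 * M\<^sup>2 + 4) * K) * ((4 + 2 * M\<^sup>2) * X)"
    using Q_le K by (intro add_left_mono mult_left_mono) auto
  also have "\<dots> = (3 + (3 + (3 * M\<^sup>2 + 4) * K) * (4 + 2 * M\<^sup>2)) * X" by (simp only: distrib_right mult.assoc)
  finally have "sqrt ((dual_norm T (err u' w))\<^sup>2 + (L2_norm T (\<lambda>t. u t - step_function T \<theta> N w t))\<^sup>2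
      + (SUP t\<in>{0..T}. (norm (uc t - j (step_function T \<theta> N w t)))\<^sup>2))
    \<le> sqrt ((3 + (3 + (3 * M\<^sup>2 + 4) * K) * (4 + 2 * M\<^sup>2)) * X)"
    by (rule real_sqrt_le_mono)
  also have "\<dots> = quasi_const M K * sqrt X" by (simp add: quasi_const_def real_sqrt_mult)
  finally show ?thesis
    unfolding total_error_def X_def d_def E_def S_def err_def[abs_def] .
qed

lemma quasi_optimal_of_stable:
  assumes st: "dp.stable K" and K: "0 \<le> K"
  shows "quasi_optimal (2 * M / (quasi_const M K - 1)) T j a M \<Phi> \<theta> U N"
    and "0 < 2 * M / (quasi_const M K - 1)"
proof -
  have L: "1 < quasi_const M K" by (rule quasi_const_gt_1[OF K])
  have M: "0 < M" using dp.M_ge by simp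
  then show "0 < 2 * M / (quasi_const M K - 1)" using L by simp
  have eq: "1 + 2 * M / (2 * M / (quasi_const M K - 1)) = quasi_const M K" using M L by simp
  show "quasi_optimal (2 * M / (quasi_const M K - 1)) T j a M \<Phi> \<theta> U N"
    unfolding quasi_optimal_def eq
  proof (intro ballI allI impI)
    fix f \<xi>\<^sub>0 w u u' uc
    assume f: "f \<in> L2 T" and s: "theta_scheme T j a \<Phi> \<theta> U N f \<xi>\<^sub>0 w" "solves T j a \<Phi> f \<xi>\<^sub>0 u u' uc"
    have ne: "W_discrete T \<theta> U N \<noteq> {}"
    proof -
      have "step_function T \<theta> N (\<lambda>_. 0) \<in> W_discrete T \<theta> U N"
        unfolding W_discrete_def using subspace_0[OF dp.subspace_U] by blast
      then show ?thesis by blast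
    qed
    \<comment> \<open>Dividing by the constant first gives one lower bound for the errors of all
      comparison functions, hence for their infimum.\<close>
    have "total_error T j U N u u' uc (step_function T \<theta> N w) / quasi_const M K
      \<le> (INF v\<in>W_discrete T \<theta> U N. total_error T j U N u u' uc v)"
    proof (rule cINF_greatest[OF ne])
      fix v assume "v \<in> W_discrete T \<theta> U N"
      then obtain ws where ws: "v = step_function T \<theta> N ws" "\<forall>m\<le>N. ws m \<in> U"
        unfolding W_discrete_def by blast
      show "total_error T j U N u u' uc (step_function T \<theta> N w) / quasi_const M K \<le> total_error T j U N u u' uc v"
        using total_error_le[OF st K f s ws(2)] L unfolding ws(1) by (simp add: pos_divide_le_eq mult.commute)
    qed
    then show "total_error T j U N u u' uc (step_function T \<theta> N w)
      \<le> quasi_const M K * (INF v\<in>W_discrete T \<theta> U N. total_error T j U N u u' uc v)"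
      using L by (simp add: pos_divide_le_eq mult.commute)
  qed
qed

end

section \<open>Choice of the constant\<close>

text \<open>The stability constants are functions of explicit parameters, so that \<beta> can be
  fixed in the theorem before the embedding, the form and the discretisation are introduced.\<close>

definition stab_lt :: "real \<Rightarrow> real \<Rightarrow> real \<Rightarrow> real \<Rightarrow> real \<Rightarrow> real" where
  "stab_lt T M \<alpha> \<theta> C = stab_const T C
     ((2 / \<alpha> + \<alpha> + 1) * (1 + 2 * (T * (\<alpha>\<^sup>2 / (24 * M^3 * (1/2 - \<theta>)))) * M\<^sup>2))"

definition stab_half :: "real \<Rightarrow> real \<Rightarrow> real \<Rightarrow> real \<Rightarrow> real \<Rightarrow> real" where
  "stab_half T M \<alpha> L C = stab_const T C ((2 / \<alpha> + \<alpha> + 1) * (1 + 2 * L\<^sup>2 * M\<^sup>2))"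

definition stab_gt :: "real \<Rightarrow> real \<Rightarrow> real \<Rightarrow> real \<Rightarrow> real" where
  "stab_gt T \<alpha> \<theta> C = stab_const T C (2 / \<alpha> + T / (2 * \<theta> - 1))"

definition stab_contraction :: "real \<Rightarrow> real \<Rightarrow> real" where
  "stab_contraction \<alpha> r = (let K = 2 * (1 / \<alpha> + 1) / (1 - r)\<^sup>2 + 1 / \<alpha> in K + K / \<alpha>)"

definition beta_of :: "real \<Rightarrow> real \<Rightarrow> real" where
  "beta_of M K = 2 * M / (quasi_const M K - 1)"

section \<open>Stability of the scheme in each case\<close>

context theta_method
begin

lemma j_le: "norm (j v) \<le> C\<^sub>H * norm v"
  using set by (simp add: setting_def dense_embedding_def)

lemma inverse_constant_pos: "0 < inverse_constant j U"
  and norm_le_inverse_constant: "u \<in> U \<Longrightarrow> norm u \<le> inverse_constant j U * norm (j u)"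
  using inverse_constant_bound[OF finite_B U_eq j_inj U_nontrivial] by auto

lemma T_eq': "T = k * real N"
  using T_eq by (rule trans) (rule mult.commute)

lemma stable_lt: "\<theta> < 1/2 \<Longrightarrow> dp.stable (stab_lt T M \<alpha> \<theta> C\<^sub>H) \<and> 0 \<le> stab_lt T M \<alpha> \<theta> C\<^sub>H"
proof
  assume \<theta>: "\<theta> < 1/2"
  let ?\<mu> = "inverse_constant j U"
  have "k \<le> \<alpha>\<^sup>2 / (24 * ?\<mu>\<^sup>2 * M^3 * (1/2 - \<theta>))"
    using disc \<theta> unfolding discretisation_def step_size_eq by blast
  then have "k * ?\<mu>\<^sup>2 \<le> \<alpha>\<^sup>2 / (24 * ?\<mu>\<^sup>2 * M^3 * (1/2 - \<theta>)) * ?\<mu>\<^sup>2"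
    by (intro mult_right_mono) auto
  also have "\<dots> = \<alpha>\<^sup>2 / (24 * M^3 * (1/2 - \<theta>))" using inverse_constant_pos by simp
  finally have k: "k * ?\<mu>\<^sup>2 \<le> \<alpha>\<^sup>2 / (24 * M^3 * (1/2 - \<theta>))" .
  show "dp.stable (stab_lt T M \<alpha> \<theta> C\<^sub>H)"
    unfolding stab_lt_def
    by (rule dp.stable_lt_half[OF T_eq' j_le \<theta> less_imp_le[OF inverse_constant_pos] norm_le_inverse_constant k])
  have "0 \<le> \<alpha>\<^sup>2 / (24 * M^3 * (1/2 - \<theta>))" using dp.M_ge \<theta> by simp
  moreover have "0 < (2 / \<alpha> + \<alpha> + 1) * (1 + 2 * (T * q) * M\<^sup>2)" if "0 \<le> q" for q
    using T_pos dp.\<alpha>_pos that by (intro mult_pos_pos add_pos_nonneg add_pos_pos) auto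
  ultimately have "0 < (2 / \<alpha> + \<alpha> + 1) * (1 + 2 * (T * (\<alpha>\<^sup>2 / (24 * M^3 * (1/2 - \<theta>)))) * M\<^sup>2)"
    by blast
  then show "0 \<le> stab_lt T M \<alpha> \<theta> C\<^sub>H"
    unfolding stab_lt_def using stab_const_pos[OF T_pos] by (simp only: less_imp_le)
qed

lemma stable_half: "\<theta> = 1/2 \<Longrightarrow> k * inverse_constant j U \<le> L \<Longrightarrow>
  dp.stable (stab_half T M \<alpha> L C\<^sub>H) \<and> 0 \<le> stab_half T M \<alpha> L C\<^sub>H"
proof
  assume \<theta>: "\<theta> = 1/2" and L: "k * inverse_constant j U \<le> L"
  show "dp.stable (stab_half T M \<alpha> L C\<^sub>H)"
    unfolding stab_half_def
    by (rule dp.stable_half[OF T_eq' j_le \<theta> less_imp_le[OF inverse_constant_pos] norm_le_inverse_constant L])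
  have "0 < (2 / \<alpha> + \<alpha> + 1) * (1 + 2 * L\<^sup>2 * M\<^sup>2)"
    using dp.\<alpha>_pos by (intro mult_pos_pos add_pos_nonneg add_pos_pos) auto
  then show "0 \<le> stab_half T M \<alpha> L C\<^sub>H"
    unfolding stab_half_def using stab_const_pos[OF T_pos] by (simp only: less_imp_le)
qed

lemma stable_gt: "1/2 < \<theta> \<Longrightarrow> dp.stable (stab_gt T \<alpha> \<theta> C\<^sub>H) \<and> 0 \<le> stab_gt T \<alpha> \<theta> C\<^sub>H"
proof
  assume \<theta>: "1/2 < \<theta>"
  show "dp.stable (stab_gt T \<alpha> \<theta> C\<^sub>H)"
    unfolding stab_gt_def by (intro dp.stable_gt_half T_eq' j_le \<theta>)
  have "0 < 2 / \<alpha> + T / (2 * \<theta> - 1)" using dp.\<alpha>_pos T_pos \<theta> by (intro add_pos_pos) auto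
  then show "0 \<le> stab_gt T \<alpha> \<theta> C\<^sub>H"
    unfolding stab_gt_def using stab_const_pos[OF T_pos] by (simp only: less_imp_le)
qed

lemma stable_contraction: "\<theta> = 1/2 \<Longrightarrow> norm \<Phi> < 1 \<Longrightarrow>
  dp.stable (stab_contraction \<alpha> (norm \<Phi>)) \<and> 0 \<le> stab_contraction \<alpha> (norm \<Phi>)"
  using dp.stable_contraction dp.\<alpha>_pos unfolding stab_contraction_def Let_def
  by (auto intro!: add_nonneg_nonneg)

text \<open>For \<theta> = 1/2 the bound on k * \<mu> is taken to be k * \<mu> itself; the constant
  then depends on the discretisation, which is allowed where mere existence is claimed.\<close>

lemma stable_exists: "\<exists>K\<ge>0. dp.stable K"
proof -
  consider "\<theta> < 1/2" | "\<theta> = 1/2" | "1/2 < \<theta>" by linarith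
  then show ?thesis
    using stable_lt stable_half[OF _ order_refl] stable_gt by cases blast+
qed

lemma quasi_optimal_beta:
  "dp.stable K \<and> 0 \<le> K \<Longrightarrow> 0 < beta_of M K \<and> quasi_optimal (beta_of M K) T j a M \<Phi> \<theta> U N"
  using quasi_optimal_of_stable[of K] unfolding beta_of_def by blast

end

text \<open>\<beta> is chosen before the hypotheses that make it positive. If the candidate
  \<open>b\<close> is not positive, no setting has these parameters, the claim is vacuous and 1
  serves.\<close>

lemma ex_positiveI:
  fixes b :: real
  assumes "0 < b \<Longrightarrow> R b" "\<not> 0 < b \<Longrightarrow> R 1"
  shows "\<exists>\<beta>>0. R \<beta>"
  using assms by (cases "0 < b") (auto intro: exI[of _ 1])

theorem theorem4p8:
  fixes T M \<alpha> :: real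
  shows
  "(\<forall>(j :: 'u::{real_inner,complete_space} \<Rightarrow>\<^sub>L 'h::{real_inner,complete_space}) C\<^sub>H a \<Phi> \<theta> U\<^sub>n N.
      setting T j C\<^sub>H a M \<alpha> \<Phi> \<longrightarrow> discretisation T j M \<alpha> \<theta> U\<^sub>n N \<longrightarrow>
      (\<forall>f\<in>L2 T. \<forall>\<xi>\<^sub>0. \<exists>!w. w \<in> {..N} \<rightarrow>\<^sub>E U\<^sub>n \<and> theta_scheme T j a \<Phi> \<theta> U\<^sub>n N f \<xi>\<^sub>0 w) \<and>
      (\<exists>\<beta>>0. quasi_optimal \<beta> T j a M \<Phi> \<theta> U\<^sub>n N))
   \<and>
   (\<forall>\<theta> C\<^sub>H. 0 \<le> \<theta> \<and> \<theta> < 1/2 \<longrightarrow> (\<exists>\<beta>>0.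
      \<forall>(j :: 'u \<Rightarrow>\<^sub>L 'h) a \<Phi> U\<^sub>n N.
        setting T j C\<^sub>H a M \<alpha> \<Phi> \<longrightarrow> discretisation T j M \<alpha> \<theta> U\<^sub>n N \<longrightarrow>
        quasi_optimal \<beta> T j a M \<Phi> \<theta> U\<^sub>n N))
   \<and>
   (\<forall>C C\<^sub>H. 0 < C \<longrightarrow> (\<exists>\<beta>>0.
      \<forall>(j :: 'u \<Rightarrow>\<^sub>L 'h) a \<Phi> U\<^sub>n N.
        setting T j C\<^sub>H a M \<alpha> \<Phi> \<longrightarrow> discretisation T j M \<alpha> (1/2) U\<^sub>n N \<longrightarrow>
        norm \<Phi> = 1 \<longrightarrow> step_size T N * inverse_constant j U\<^sub>n \<le> C \<longrightarrow>
        quasi_optimal \<beta> T j a M \<Phi> (1/2) U\<^sub>n N))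
   \<and>
   (\<forall>r<1. \<exists>\<beta>>0.
      \<forall>(j :: 'u \<Rightarrow>\<^sub>L 'h) C\<^sub>H a \<Phi> U\<^sub>n N.
        setting T j C\<^sub>H a M \<alpha> \<Phi> \<longrightarrow> discretisation T j M \<alpha> (1/2) U\<^sub>n N \<longrightarrow>
        norm \<Phi> = r \<longrightarrow>
        quasi_optimal \<beta> T j a M \<Phi> (1/2) U\<^sub>n N)
   \<and>
   (\<forall>\<theta> C\<^sub>H. 1/2 < \<theta> \<and> \<theta> \<le> 1 \<longrightarrow> (\<exists>\<beta>>0.
      \<forall>(j :: 'u \<Rightarrow>\<^sub>L 'h) a \<Phi> U\<^sub>n N.
        setting T j C\<^sub>H a M \<alpha> \<Phi> \<longrightarrow> discretisation T j M \<alpha> \<theta> U\<^sub>n N \<longrightarrow>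
        quasi_optimal \<beta> T j a M \<Phi> \<theta> U\<^sub>n N))"
    (is "?P0 \<and> ?Pa \<and> ?Pb \<and> ?Pc \<and> ?Pd")
proof (intro conjI)
  show ?P0
  proof (intro allI impI conjI ballI)
    fix j :: "'u \<Rightarrow>\<^sub>L 'h" and C\<^sub>H a \<Phi> \<theta> U\<^sub>n N
    assume "setting T j C\<^sub>H a M \<alpha> \<Phi>" "discretisation T j M \<alpha> \<theta> U\<^sub>n N"
    then interpret theta_method T j C\<^sub>H a M \<alpha> \<Phi> \<theta> U\<^sub>n N by unfold_locales
    obtain K where K: "0 \<le> K" "dp.stable K" using stable_exists by blast
    show "\<exists>!w. w \<in> {..N} \<rightarrow>\<^sub>E U\<^sub>n \<and> theta_scheme T j a \<Phi> \<theta> U\<^sub>n N f \<xi>\<^sub>0 w" if "f \<in> L2 T" for f \<xi>\<^sub>0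
      by (rule scheme_ex1[OF K(2) that])
    show "\<exists>\<beta>>0. quasi_optimal \<beta> T j a M \<Phi> \<theta> U\<^sub>n N" using quasi_optimal_beta K by blast
  qed
  show ?Pa
  proof (intro allI impI)
    fix \<theta> C\<^sub>H :: real assume \<theta>: "0 \<le> \<theta> \<and> \<theta> < 1/2"
    \<comment> \<open>Positivity is proved together with quasi-optimality, since the conditions on
      M, \<alpha> and T are available only inside a setting.\<close>
    have *: "0 < beta_of M (stab_lt T M \<alpha> \<theta> C\<^sub>H) \<and> quasi_optimal (beta_of M (stab_lt T M \<alpha> \<theta> C\<^sub>H)) T j a M \<Phi> \<theta> U\<^sub>n N"
      if "setting T j C\<^sub>H a M \<alpha> \<Phi>" "discretisation T j M \<alpha> \<theta> U\<^sub>n N" for j :: "'u \<Rightarrow>\<^sub>L 'h" and a \<Phi> U\<^sub>n N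
    proof -
      interpret theta_method T j C\<^sub>H a M \<alpha> \<Phi> \<theta> U\<^sub>n N using that by unfold_locales
      show ?thesis using quasi_optimal_beta stable_lt \<theta> by blast
    qed
    show "\<exists>\<beta>>0. \<forall>(j :: 'u \<Rightarrow>\<^sub>L 'h) a \<Phi> U\<^sub>n N.
        setting T j C\<^sub>H a M \<alpha> \<Phi> \<longrightarrow> discretisation T j M \<alpha> \<theta> U\<^sub>n N \<longrightarrow>
        quasi_optimal \<beta> T j a M \<Phi> \<theta> U\<^sub>n N"
      by (rule ex_positiveI[of "beta_of M (stab_lt T M \<alpha> \<theta> C\<^sub>H)"]) (use * in blast)+
  qed
  show ?Pb
  proof (intro allI impI)
    fix C C\<^sub>H :: real
    have *: "0 < beta_of M (stab_half T M \<alpha> C C\<^sub>H) \<and> quasi_optimal (beta_of M (stab_half T M \<alpha> C C\<^sub>H)) T j a M \<Phi> (1/2) U\<^sub>n N"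
      if "setting T j C\<^sub>H a M \<alpha> \<Phi>" "discretisation T j M \<alpha> (1/2) U\<^sub>n N"
        "step_size T N * inverse_constant j U\<^sub>n \<le> C" for j :: "'u \<Rightarrow>\<^sub>L 'h" and a \<Phi> U\<^sub>n N
    proof -
      interpret theta_method T j C\<^sub>H a M \<alpha> \<Phi> "1/2" U\<^sub>n N using that by unfold_locales
      show ?thesis using quasi_optimal_beta stable_half[OF refl, of C] that(3) unfolding step_size_eq by blast
    qed
    show "\<exists>\<beta>>0. \<forall>(j :: 'u \<Rightarrow>\<^sub>L 'h) a \<Phi> U\<^sub>n N.
        setting T j C\<^sub>H a M \<alpha> \<Phi> \<longrightarrow> discretisation T j M \<alpha> (1/2) U\<^sub>n N \<longrightarrow>
        norm \<Phi> = 1 \<longrightarrow> step_size T N * inverse_constant j U\<^sub>n \<le> C \<longrightarrow>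
        quasi_optimal \<beta> T j a M \<Phi> (1/2) U\<^sub>n N"
      by (rule ex_positiveI[of "beta_of M (stab_half T M \<alpha> C C\<^sub>H)"]) (use * in blast)+
  qed
  show ?Pc
  proof (intro allI impI)
    fix r :: real assume r: "r < 1"
    have *: "0 < beta_of M (stab_contraction \<alpha> r) \<and> quasi_optimal (beta_of M (stab_contraction \<alpha> r)) T j a M \<Phi> (1/2) U\<^sub>n N"
      if "setting T j C\<^sub>H a M \<alpha> \<Phi>" "discretisation T j M \<alpha> (1/2) U\<^sub>n N" "norm \<Phi> = r"
      for j :: "'u \<Rightarrow>\<^sub>L 'h" and C\<^sub>H a \<Phi> U\<^sub>n N
    proof -
      interpret theta_method T j C\<^sub>H a M \<alpha> \<Phi> "1/2" U\<^sub>n N using that by unfold_locales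
      show ?thesis using quasi_optimal_beta stable_contraction that(3) r by blast
    qed
    show "\<exists>\<beta>>0. \<forall>(j :: 'u \<Rightarrow>\<^sub>L 'h) C\<^sub>H a \<Phi> U\<^sub>n N.
        setting T j C\<^sub>H a M \<alpha> \<Phi> \<longrightarrow> discretisation T j M \<alpha> (1/2) U\<^sub>n N \<longrightarrow>
        norm \<Phi> = r \<longrightarrow> quasi_optimal \<beta> T j a M \<Phi> (1/2) U\<^sub>n N"
      by (rule ex_positiveI[of "beta_of M (stab_contraction \<alpha> r)"]) (use * in blast)+
  qed
  show ?Pd
  proof (intro allI impI)
    fix \<theta> C\<^sub>H :: real assume \<theta>: "1/2 < \<theta> \<and> \<theta> \<le> 1"
    have *: "0 < beta_of M (stab_gt T \<alpha> \<theta> C\<^sub>H) \<and> quasi_optimal (beta_of M (stab_gt T \<alpha> \<theta> C\<^sub>H)) T j a M \<Phi> \<theta> U\<^sub>n N"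
      if "setting T j C\<^sub>H a M \<alpha> \<Phi>" "discretisation T j M \<alpha> \<theta> U\<^sub>n N" for j :: "'u \<Rightarrow>\<^sub>L 'h" and a \<Phi> U\<^sub>n N
    proof -
      interpret theta_method T j C\<^sub>H a M \<alpha> \<Phi> \<theta> U\<^sub>n N using that by unfold_locales
      show ?thesis using quasi_optimal_beta stable_gt \<theta> by blast
    qed
    show "\<exists>\<beta>>0. \<forall>(j :: 'u \<Rightarrow>\<^sub>L 'h) a \<Phi> U\<^sub>n N.
        setting T j C\<^sub>H a M \<alpha> \<Phi> \<longrightarrow> discretisation T j M \<alpha> \<theta> U\<^sub>n N \<longrightarrow>
        quasi_optimal \<beta> T j a M \<Phi> \<theta> U\<^sub>n N"
      by (rule ex_positiveI[of "beta_of M (stab_gt T \<alpha> \<theta> C\<^sub>H)"]) (use * in blast)+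
  qed
qed

end
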